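(* Let $G$ be a finitely generated group with the word length metric. Then $G$ has exactly two ends if and only if its Higson corona $\nu G$ is a topological sum of two non-metrizable indecomposable continua, each of which is homeomorphic to $\nu\mathbb{N}$.
   Context: The word length metric on $G$ is taken with respect to a finite generating set; with it $G$ is a proper metric space. $\mathbb{N}$ is the space of natural numbers with the metric $d(x,y)=|x-y|$. Ends: a proper ray in a metric space $X$ is a proper continuous map $r:[0,\infty)\to X$. Two proper rays $r_1,r_2$ define the same end of $X$ if for every compact $K\subset X$ there is $N\in\mathbb{N}$ such that $r_1([N,\infty))$ and $r_2([N,\infty))$ are contained in the same path component of $X\setminus K$. This is an equivalence relation, and an end of $X$ is an equivalence class of proper rays. The number of ends of a finitely generated group $G$ is the number of ends of its Cayley graph with respect to a finite generating set (it does not depend on the choice of finite generating set). Higson corona: for a proper metric space $X$ with closed balls $B(x,r)$, let $C_H(X)$ be the set of bounded continuous functions $f:X\to\mathbb{R}$ such that for all $r>0$ and $\varepsilon>0$ there is a compact $K\subset X$ with $\operatorname{diam} f(B(x,r))<\varepsilon$ for all $x\in X\setminus K$. The evaluation map $e:X\to\prod_{f\in C_H(X)}[\inf f,\sup f]$, $(e(x))_f=f(x)$, is a topological embedding; the Higson compactification $X^\nu$ is the closure of $e(X)$ (with $X$ identified with $e(X)$), and the Higson corona is $\nu X=X^\nu\setminus X$. A continuum is a non-empty compact connected Hausdorff space; it is decomposable if it is the union of two of its proper subcontinua (subcontinua not equal to the whole space), and indecomposable otherwise. *)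

theory Defs
  imports "HOL-Analysis.Analysis" "HOL-Algebra.Generated_Groups"
begin

section \<open>Word metrics\<close>

definition generating_set :: "('a, 'b) monoid_scheme \<Rightarrow> 'a set \<Rightarrow> bool" where
  "generating_set G S \<longleftrightarrow> S \<subseteq> carrier G \<and> generate G S = carrier G"

definition word_product :: "('a, 'b) monoid_scheme \<Rightarrow> 'a list \<Rightarrow> 'a" where
  "word_product G ws = foldr (\<lambda>x y. x \<otimes>\<^bsub>G\<^esub> y) ws \<one>\<^bsub>G\<^esub>"

definition word_length :: "('a, 'b) monoid_scheme \<Rightarrow> 'a set \<Rightarrow> 'a \<Rightarrow> nat" where
  "word_length G S g =
     (LEAST n. \<exists>ws. length ws = n \<and> set ws \<subseteq> S \<union> m_inv G ` S \<and> word_product G ws = g)"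

text \<open>The library asks a metric to be symmetric and nonnegative on the whole type, hence the
  value \<open>0\<close> outside the carrier.\<close>

definition word_dist :: "('a, 'b) monoid_scheme \<Rightarrow> 'a set \<Rightarrow> 'a \<Rightarrow> 'a \<Rightarrow> real" where
  "word_dist G S g h =
     (if g \<in> carrier G \<and> h \<in> carrier G
      then real (word_length G S (inv\<^bsub>G\<^esub> g \<otimes>\<^bsub>G\<^esub> h)) else 0)"

definition word_metric :: "('a, 'b) monoid_scheme \<Rightarrow> 'a set \<Rightarrow> 'a metric" where
  "word_metric G S = metric (carrier G, word_dist G S)"

context group
begin

lemma word_product_simps [simp]:
  "word_product G [] = \<one>" "word_product G (w # ws) = w \<otimes> word_product G ws"
  by (simp_all add: word_product_def)

lemma word_product_closed:
  "set ws \<subseteq> carrier G \<Longrightarrow> word_product G ws \<in> carrier G"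
  by (induction ws) auto

lemma word_product_append:
  "set us \<subseteq> carrier G \<Longrightarrow> set ws \<subseteq> carrier G \<Longrightarrow>
     word_product G (us @ ws) = word_product G us \<otimes> word_product G ws"
  by (induction us) (auto simp: m_assoc word_product_closed)

lemma word_product_inv:
  "set ws \<subseteq> carrier G \<Longrightarrow>
     word_product G (rev (map (m_inv G) ws)) = inv (word_product G ws)"
proof (induction ws)
  case Nil
  then show ?case by simp
next
  case (Cons w ws)
  moreover have "set (rev (map (m_inv G) ws)) \<subseteq> carrier G"
    using Cons.prems by auto
  ultimately show ?case
    by (simp add: word_product_append word_product_closed inv_mult_group)
qed

lemma generating_set_letters:
  "generating_set G S \<Longrightarrow> S \<union> m_inv G ` S \<subseteq> carrier G"
  by (auto simp: generating_set_def)

lemma word_exists: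
  assumes S: "generating_set G S" and g: "g \<in> carrier G"
  shows "\<exists>ws. set ws \<subseteq> S \<union> m_inv G ` S \<and> word_product G ws = g"
proof -
  have sub: "S \<union> m_inv G ` S \<subseteq> carrier G"
    using S by (rule generating_set_letters)
  have "g \<in> generate G S"
    using S g by (simp add: generating_set_def)
  then show ?thesis
  proof induction
    case one
    show ?case by (rule exI[of _ "[]"]) simp
  next
    case (incl h)
    then show ?case using sub by (intro exI[of _ "[h]"]) auto
  next
    case (inv h)
    then show ?case using sub by (intro exI[of _ "[inv h]"]) auto
  next
    case (eng h1 h2)
    then obtain us ws where
      "set us \<subseteq> S \<union> m_inv G ` S" "word_product G us = h1"
      "set ws \<subseteq> S \<union> m_inv G ` S" "word_product G ws = h2" by blast
    then show ?case
      using sub by (intro exI[of _ "us @ ws"]) (simp add: word_product_append subset_trans)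
  qed
qed

lemma word_length_witness:
  assumes "generating_set G S" "g \<in> carrier G"
  obtains ws where "length ws = word_length G S g" "set ws \<subseteq> S \<union> m_inv G ` S"
    "word_product G ws = g"
proof -
  have "\<exists>n ws. length ws = n \<and> set ws \<subseteq> S \<union> m_inv G ` S \<and> word_product G ws = g"
    using word_exists[OF assms] by blast
  from LeastI_ex[OF this] show ?thesis
    using that unfolding word_length_def by blast
qed

lemma word_length_le:
  "set ws \<subseteq> S \<union> m_inv G ` S \<Longrightarrow> word_length G S (word_product G ws) \<le> length ws"
  unfolding word_length_def by (rule Least_le) blast

lemma word_length_inv_le:
  assumes S: "generating_set G S" and g: "g \<in> carrier G"
  shows "word_length G S (inv g) \<le> word_length G S g"
proof -
  obtain ws where ws: "length ws = word_length G S g" "set ws \<subseteq> S \<union> m_inv G ` S"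
    "word_product G ws = g" using word_length_witness[OF S g] by metis
  have sub: "S \<union> m_inv G ` S \<subseteq> carrier G"
    using S by (rule generating_set_letters)
  have "set (rev (map (m_inv G) ws)) \<subseteq> S \<union> m_inv G ` S"
    using ws(2) sub by fastforce
  from word_length_le[OF this] show ?thesis
    using ws sub word_product_inv[of ws] by (simp add: subset_trans)
qed

lemma word_length_mult_le:
  assumes S: "generating_set G S" and g: "g \<in> carrier G" and h: "h \<in> carrier G"
  shows "word_length G S (g \<otimes> h) \<le> word_length G S g + word_length G S h"
proof -
  obtain us where us: "length us = word_length G S g" "set us \<subseteq> S \<union> m_inv G ` S"
    "word_product G us = g" using word_length_witness[OF S g] by metis
  obtain ws where ws: "length ws = word_length G S h" "set ws \<subseteq> S \<union> m_inv G ` S"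
    "word_product G ws = h" using word_length_witness[OF S h] by metis
  have sub: "S \<union> m_inv G ` S \<subseteq> carrier G"
    using S by (rule generating_set_letters)
  have "word_product G (us @ ws) = g \<otimes> h"
    using us ws sub by (simp add: word_product_append subset_trans)
  then show ?thesis
    using word_length_le[of "us @ ws" S] us ws by simp
qed

lemma word_length_eq_0_iff:
  assumes S: "generating_set G S" and g: "g \<in> carrier G"
  shows "word_length G S g = 0 \<longleftrightarrow> g = \<one>"
proof
  assume "word_length G S g = 0"
  then show "g = \<one>"
    using word_length_witness[OF S g] by (metis length_0_conv word_product_simps(1))
next
  assume "g = \<one>"
  then show "word_length G S g = 0"
    using word_length_le[of "[]" S] by simp
qed

lemma Metric_space_word_dist:
  assumes S: "generating_set G S"
  shows "Metric_space (carrier G) (word_dist G S)"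
proof
  fix x y z
  show "0 \<le> word_dist G S x y"
    by (simp add: word_dist_def)
  show "word_dist G S x y = word_dist G S y x"
  proof (cases "x \<in> carrier G \<and> y \<in> carrier G")
    case True
    then have "inv (inv x \<otimes> y) = inv y \<otimes> x" "inv (inv y \<otimes> x) = inv x \<otimes> y"
      by (simp_all add: inv_mult_group)
    then have "word_length G S (inv x \<otimes> y) = word_length G S (inv y \<otimes> x)"
      using word_length_inv_le[OF S, of "inv x \<otimes> y"] word_length_inv_le[OF S, of "inv y \<otimes> x"] True
      by simp
    then show ?thesis by (simp add: word_dist_def)
  qed (auto simp: word_dist_def)
  assume x: "x \<in> carrier G" and y: "y \<in> carrier G"
  have "inv x \<otimes> y = \<one> \<longleftrightarrow> x = y"
    using x y by (metis inv_closed inv_equality inv_inv l_inv)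
  then show "word_dist G S x y = 0 \<longleftrightarrow> x = y"
    using x y by (simp add: word_dist_def word_length_eq_0_iff[OF S])
  assume z: "z \<in> carrier G"
  have "(inv x \<otimes> y) \<otimes> (inv y \<otimes> z) = inv x \<otimes> z"
    using x y z by (metis inv_closed m_assoc m_closed r_inv l_one)
  then have "word_length G S (inv x \<otimes> z) \<le>
      word_length G S (inv x \<otimes> y) + word_length G S (inv y \<otimes> z)"
    using word_length_mult_le[OF S, of "inv x \<otimes> y" "inv y \<otimes> z"] x y z by simp
  then show "word_dist G S x z \<le> word_dist G S x y + word_dist G S y z"
    using x y z by (simp add: word_dist_def)
qed

lemma word_metric_simps:
  assumes "generating_set G S"
  shows "mspace (word_metric G S) = carrier G" "mdist (word_metric G S) = word_dist G S"
  using Metric_space_word_dist[OF assms]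
  by (simp_all add: word_metric_def Metric_space.mspace_metric Metric_space.mdist_metric)

end


section \<open>Cayley graphs and ends\<close>

text \<open>The geometric realization of the Cayley graph: a point is given by its barycentric
  coordinates on the vertex set, which form a function on the carrier supported on one vertex
  or on the two vertices of an edge. Edges join \<open>g\<close> to \<open>g s\<close>; loops and multiple edges are
  collapsed, which does not affect the ends. For a finite \<open>S\<close> the graph is locally finite, so that the topology of
  pointwise convergence of the coordinates is the topology of the CW complex and of the
  path metric with edges of length one.\<close>

definition cayley_vertex :: "('a, 'b) monoid_scheme \<Rightarrow> 'a \<Rightarrow> 'a \<Rightarrow> real" where
  "cayley_vertex G g = (\<lambda>k\<in>carrier G. if k = g then 1 else 0)"

definition cayley_edge :: "('a, 'b) monoid_scheme \<Rightarrow> 'a \<Rightarrow> 'a \<Rightarrow> ('a \<Rightarrow> real) set" where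
  "cayley_edge G g h =
     (\<lambda>t. \<lambda>k\<in>carrier G. (1 - t) * cayley_vertex G g k + t * cayley_vertex G h k) ` {0..1}"

definition cayley_graph :: "('a, 'b) monoid_scheme \<Rightarrow> 'a set \<Rightarrow> ('a \<Rightarrow> real) topology" where
  "cayley_graph G S =
     subtopology (product_topology (\<lambda>_. euclideanreal) (carrier G))
       (cayley_vertex G ` carrier G \<union> (\<Union>g\<in>carrier G. \<Union>s\<in>S. cayley_edge G g (g \<otimes>\<^bsub>G\<^esub> s)))"

text \<open>For maps into a locally compact Hausdorff space, such as a proper metric space,
  \<open>proper_map\<close> means that preimages of compact sets are compact. The notion of end depends only on the topology.\<close>

definition proper_ray :: "'a topology \<Rightarrow> (real \<Rightarrow> 'a) \<Rightarrow> bool" where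
  "proper_ray X r \<longleftrightarrow>
     continuous_map (top_of_set {0..}) X r \<and> proper_map (top_of_set {0..}) X r"

definition same_end :: "'a topology \<Rightarrow> (real \<Rightarrow> 'a) \<Rightarrow> (real \<Rightarrow> 'a) \<Rightarrow> bool" where
  "same_end X r1 r2 \<longleftrightarrow>
     (\<forall>K. compactin X K \<longrightarrow>
        (\<exists>N::nat. \<exists>C\<in>path_components_of (subtopology X (topspace X - K)).
            r1 ` {real N..} \<subseteq> C \<and> r2 ` {real N..} \<subseteq> C))"

text \<open>The values of a ray at negative arguments are irrelevant; rays that differ only there
  lie in the same class.\<close>

definition ends :: "'a topology \<Rightarrow> (real \<Rightarrow> 'a) set set" where
  "ends X = {r. proper_ray X r} // {(r1, r2). proper_ray X r1 \<and> proper_ray X r2 \<and> same_end X r1 r2}"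


section \<open>The Higson corona\<close>

text \<open>Functions are taken to be extensional, so that \<open>higson_functions m\<close> consists of
  functions on the space and not of their extensions to the ambient type.\<close>

definition higson_functions :: "'a metric \<Rightarrow> ('a \<Rightarrow> real) set" where
  "higson_functions m =
     {f \<in> extensional (mspace m).
        continuous_map (mtopology_of m) euclideanreal f \<and>
        bounded (f ` mspace m) \<and>
        (\<forall>r>0. \<forall>\<epsilon>>0. \<exists>K. compactin (mtopology_of m) K \<and>
           (\<forall>x\<in>mspace m - K. diameter (f ` mcball_of m x r) < \<epsilon>))}"

definition higson_cube :: "'a metric \<Rightarrow> (('a \<Rightarrow> real) \<Rightarrow> real) topology" where
  "higson_cube m =
     product_topology (\<lambda>f. top_of_set {Inf (f ` mspace m)..Sup (f ` mspace m)}) (higson_functions m)"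

definition higson_eval :: "'a metric \<Rightarrow> 'a \<Rightarrow> ('a \<Rightarrow> real) \<Rightarrow> real" where
  "higson_eval m x = (\<lambda>f\<in>higson_functions m. f x)"

definition higson_compactification :: "'a metric \<Rightarrow> (('a \<Rightarrow> real) \<Rightarrow> real) topology" where
  "higson_compactification m =
     subtopology (higson_cube m) (higson_cube m closure_of (higson_eval m ` mspace m))"

definition higson_corona :: "'a metric \<Rightarrow> (('a \<Rightarrow> real) \<Rightarrow> real) topology" where
  "higson_corona m =
     subtopology (higson_compactification m)
       (topspace (higson_compactification m) - higson_eval m ` mspace m)"

definition nat_metric :: "nat metric" where
  "nat_metric = metric (UNIV, \<lambda>x y. \<bar>real x - real y\<bar>)"

lemma nat_metric_simps:
  "mspace nat_metric = UNIV" "mdist nat_metric = (\<lambda>x y. \<bar>real x - real y\<bar>)"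
proof -
  have "Metric_space (UNIV::nat set) (\<lambda>x y. \<bar>real x - real y\<bar>)"
    by unfold_locales auto
  then show "mspace nat_metric = UNIV" "mdist nat_metric = (\<lambda>x y. \<bar>real x - real y\<bar>)"
    by (simp_all add: nat_metric_def Metric_space.mspace_metric Metric_space.mdist_metric)
qed


section \<open>Continua\<close>

definition continuum :: "'a topology \<Rightarrow> bool" where
  "continuum X \<longleftrightarrow>
     topspace X \<noteq> {} \<and> compact_space X \<and> connected_space X \<and> Hausdorff_space X"

definition decomposable :: "'a topology \<Rightarrow> bool" where
  "decomposable X \<longleftrightarrow>
     (\<exists>A B. A \<subset> topspace X \<and> B \<subset> topspace X \<and> A \<union> B = topspace X \<and>
        continuum (subtopology X A) \<and> continuum (subtopology X B))"

definition indecomposable_continuum :: "'a topology \<Rightarrow> bool" where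
  "indecomposable_continuum X \<longleftrightarrow> continuum X \<and> \<not> decomposable X"

end

theory Submission
  imports Defs
begin

text \<open>
  Both sides of the equivalence are statements about almost invariant sets, that is, about sets \<open>A\<close> of
  group elements such that each right multiplication moves only finitely many elements of \<open>A\<close> out of
  \<open>A\<close>. The group has exactly two ends if and only if it splits into two infinite almost invariant
  sets and does not contain three disjoint ones (\<open>two_ends_iff\<close>). To get a set from a ray, take the
  vertices in the component in which the ray ends up; to get a ray from a set, use Koenig's lemma.
  On the other side, the indicator function of an almost invariant set is a Higson function and so
  defines a clopen subset of the corona, and by compactness every clopen subset of the corona arises
  in this way (\<open>clopen_subset_corona\<close>, \<open>coarsely_clopen_word_metric_iff\<close>). Hence a corona that is the
  sum of two connected nonempty pieces forces exactly two ends.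

  For the converse, let \<open>A\<close> be an almost invariant set of a two-ended group, infinite and with infinite
  complement. All but finitely many translates \<open>g A\<close> are nested with \<open>A\<close>, up to complements
  (\<open>translate_corner_empty\<close>), and so some \<open>g\<close> moves \<open>A\<close> strictly into itself, with finite difference.
  The translates of \<open>A\<close> by the powers of \<open>g\<close> exhaust the group and have empty intersection, since only
  finitely many of the translates of the finite frontier of \<open>A\<close> contain a given element. So the group
  has a height function with finite level sets, which \<open>g\<close> raises by one (\<open>two_ended_height\<close>); in other
  words it is coarsely a line. Both \<open>A\<close> and its complement are then coarsely equivalent to \<open>\<nat>\<close>, and
  coarse equivalences induce homeomorphisms of coronas (\<open>corona_part_homeomorphic\<close>).

  It remains to see that the corona of \<open>\<nat>\<close> is an indecomposable and not metrizable continuum. It is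
  connected because a set of natural numbers with finite boundary is finite or cofinite. The other
  two properties use that subsets of \<open>\<nat>\<close> which diverge from one another are separated by a Higson
  function (\<open>divergent_sets_separated\<close>). A neighbourhood of a point outside of a closed set \<open>P\<close>
  contains arbitrarily long intervals. Cutting \<open>\<nat>\<close> in the middle of such intervals, and sorting the
  resulting blocks alternately into two classes, one obtains two sets that diverge from one another
  off the neighbourhood and so disconnect \<open>P\<close> if it has interior
  (\<open>nat_corona_proper_subcontinua\<close>). Finally, in a metrizable corona a sparse sequence of natural
  numbers could be chosen so as to accumulate only at one point, but its terms of even and of odd
  index diverge from one another.
\<close>

section \<open>Locally finite metric spaces and Higson functions\<close>

text \<open>The metric notion behind a locally finite graph; such a space is proper and discrete, so that
  its compact subsets are the finite ones.\<close>

definition finite_balls :: "'a metric \<Rightarrow> bool" where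
  "finite_balls m \<longleftrightarrow> (\<forall>x\<in>mspace m. \<forall>r. finite (mcball_of m x r))"

lemma mcball_of_eq: "mcball_of m x r = {y. x \<in> mspace m \<and> y \<in> mspace m \<and> mdist m x y \<le> r}"
  by auto

lemma mdist_refl: "x \<in> mspace m \<Longrightarrow> mdist m x x = 0"
  by simp

lemma finite_balls_mcball: "finite_balls m \<Longrightarrow> finite {y \<in> mspace m. mdist m x y \<le> r}" if "x \<in> mspace m"
  using that unfolding finite_balls_def mcball_of_eq by simp

lemma mtopology_of_finite_balls:
  assumes "finite_balls m"
  shows "mtopology_of m = discrete_topology (mspace m)"
proof -
  interpret Metric_space "mspace m" "mdist m" by (rule Metric_space_mspace_mdist)
  have "openin mtopology {x}" if x: "x \<in> mspace m" for x
  proof -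
    have "finite (mcball x 1)"
      using finite_balls_mcball[OF x assms, of 1] x by (simp add: mcball_def)
    then have "finite (mball x 1 - {x})"
      using mball_subset_mcball finite_subset by blast
    then have "closedin mtopology (mball x 1 - {x})"
      by (intro closedin_Hausdorff_finite[OF Hausdorff_space_mtopology]) auto
    moreover have "mball x 1 - (mball x 1 - {x}) = {x}"
      using x by auto
    ultimately show ?thesis
      using openin_diff[OF openin_mball, of "mball x 1 - {x}" x 1] by simp
  qed
  then have "discrete_topology (mspace m) = mtopology"
    by (simp add: discrete_topology_unique)
  then show ?thesis by (simp add: mtopology_of_def)
qed

definition oscillation_set :: "'a metric \<Rightarrow> ('a \<Rightarrow> real) \<Rightarrow> real \<Rightarrow> real \<Rightarrow> 'a set" where
  "oscillation_set m f r e = {x \<in> mspace m. \<exists>y\<in>mspace m. mdist m x y \<le> r \<and> e \<le> \<bar>f x - f y\<bar>}"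

text \<open>Since compact sets are finite, a Higson function is a bounded function that oscillates by a given
  amount at a given scale at only finitely many points. Passing between diameters of balls and
  oscillation at the centre costs a factor two, which the quantifier over \<open>e\<close> absorbs.\<close>

lemma higson_functions_finite_balls:
  assumes "finite_balls m"
  shows "f \<in> higson_functions m \<longleftrightarrow>
    f \<in> extensional (mspace m) \<and> bounded (f ` mspace m) \<and>
    (\<forall>r. \<forall>e>0. finite (oscillation_set m f r e))"
proof -
  have d: "diameter (f ` mcball_of m x r) \<le> 2 * e"
    if x: "x \<in> mspace m" and r: "0 < r" and e: "\<And>y. y \<in> mspace m \<Longrightarrow> mdist m x y \<le> r \<Longrightarrow> \<bar>f x - f y\<bar> < e" for x r e
  proof (rule diameter_le)
    have "x \<in> mcball_of m x r" using x r by (simp add: mcball_of_eq mdist_refl)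
    then show "f ` mcball_of m x r \<noteq> {} \<or> 0 \<le> 2 * e" by auto
    fix a b assume "a \<in> f ` mcball_of m x r" "b \<in> f ` mcball_of m x r"
    then obtain y z where "a = f y" "b = f z" "y \<in> mcball_of m x r" "z \<in> mcball_of m x r"
      by blast
    then have "a = f y" "b = f z" "\<bar>f x - f y\<bar> < e" "\<bar>f x - f z\<bar> < e"
      using e by (simp_all only: mcball_of_eq mem_Collect_eq)
    then show "norm (a - b) \<le> 2 * e" by (simp add: abs_if split: if_splits)
  qed
  have e: "\<bar>f x - f y\<bar> \<le> diameter (f ` mcball_of m x r)"
    if "x \<in> mspace m" "y \<in> mspace m" "mdist m x y \<le> r" "0 < r" for x y r
  proof -
    have "finite (mcball_of m x r)" using assms that by (auto simp: finite_balls_def)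
    then have "bounded (f ` mcball_of m x r)" by (simp add: finite_imp_bounded)
    moreover have "x \<in> mcball_of m x r" "y \<in> mcball_of m x r"
      using that by (simp_all add: mcball_of_eq mdist_refl)
    ultimately have "dist (f x) (f y) \<le> diameter (f ` mcball_of m x r)"
      using diameter_bounded_bound by blast
    then show ?thesis by (simp add: dist_real_def)
  qed
  have "(\<forall>r>0. \<forall>\<epsilon>>0. \<exists>K. compactin (mtopology_of m) K \<and>
           (\<forall>x\<in>mspace m - K. diameter (f ` mcball_of m x r) < \<epsilon>)) \<longleftrightarrow>
        (\<forall>r. \<forall>e>0. finite (oscillation_set m f r e))" (is "?L \<longleftrightarrow> ?R")
  proof
    assume L: ?L
    show ?R
    proof (intro allI impI)
      fix r e :: real assume "0 < e"
      then obtain K where K: "compactin (mtopology_of m) K"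
        "\<forall>x\<in>mspace m - K. diameter (f ` mcball_of m x (max r 1)) < e"
        using L[rule_format, of "max r 1" e, OF less_le_trans[OF zero_less_one max.cobounded2]] by blast
      have "finite K"
        using K(1) by (simp add: mtopology_of_finite_balls[OF assms] compactin_discrete_topology)
      moreover have "oscillation_set m f r e \<subseteq> K"
        using K(2) e[of _ _ "max r 1"] by (force simp: oscillation_set_def)
      ultimately show "finite (oscillation_set m f r e)" by (rule rev_finite_subset)
    qed
  next
    assume R: ?R
    show ?L
    proof (intro allI impI)
      fix r e :: real assume re: "0 < r" "0 < e"
      have "finite (oscillation_set m f r (e/3))" using R re by simp
      moreover have "diameter (f ` mcball_of m x r) < e" if "x \<in> mspace m - oscillation_set m f r (e/3)" for x
      proof -
        have "diameter (f ` mcball_of m x r) \<le> 2 * (e/3)"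
          using that re by (intro d) (force simp: oscillation_set_def)+
        then show ?thesis using re by simp
      qed
      moreover have "oscillation_set m f r (e/3) \<subseteq> mspace m" by (auto simp: oscillation_set_def)
      ultimately show "\<exists>K. compactin (mtopology_of m) K \<and> (\<forall>x\<in>mspace m - K. diameter (f ` mcball_of m x r) < e)"
        by (intro exI[of _ "oscillation_set m f r (e/3)"])
           (simp add: mtopology_of_finite_balls[OF assms] compactin_discrete_topology)
    qed
  qed
  moreover have "continuous_map (mtopology_of m) euclideanreal f"
    by (simp add: mtopology_of_finite_balls[OF assms])
  ultimately show ?thesis
    unfolding higson_functions_def mem_Collect_eq by blast
qed

lemma finite_support_higson:
  assumes m: "finite_balls m" and f: "f \<in> extensional (mspace m)"
    and fin: "finite {x \<in> mspace m. f x \<noteq> 0}"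
  shows "f \<in> higson_functions m"
proof -
  let ?N = "{x \<in> mspace m. f x \<noteq> 0}"
  have "f ` mspace m \<subseteq> insert 0 (f ` ?N)" by auto
  then have "bounded (f ` mspace m)"
    by (rule bounded_subset[rotated]) (use fin in \<open>simp add: finite_imp_bounded\<close>)
  moreover have "finite (oscillation_set m f r e)" if "0 < e" for r e
  proof (rule finite_subset)
    show "oscillation_set m f r e \<subseteq> ?N \<union> (\<Union>y\<in>?N. {x \<in> mspace m. mdist m y x \<le> r})"
      using that by (auto simp: oscillation_set_def mdist_commute)
    show "finite (?N \<union> (\<Union>y\<in>?N. {x \<in> mspace m. mdist m y x \<le> r}))"
      using fin finite_balls_mcball[OF _ m] by auto
  qed
  ultimately show ?thesis using f by (simp add: higson_functions_finite_balls[OF m])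
qed

text \<open>The trace on the space of a basic neighbourhood of \<open>q\<close> in the cube.\<close>

definition higson_nbhd :: "'a metric \<Rightarrow> (('a \<Rightarrow> real) \<Rightarrow> real) \<Rightarrow> ('a \<Rightarrow> real) set \<Rightarrow> real \<Rightarrow> 'a set" where
  "higson_nbhd m q F e = {x \<in> mspace m. \<forall>f\<in>F. \<bar>f x - q f\<bar> < e}"

lemma higson_nbhd_mono: "F \<subseteq> F' \<Longrightarrow> e' \<le> e \<Longrightarrow> higson_nbhd m q F' e' \<subseteq> higson_nbhd m q F e"
  by (force simp: higson_nbhd_def)

abbreviation real_product :: "'i set \<Rightarrow> ('i \<Rightarrow> real) topology" where
  "real_product I \<equiv> product_topology (\<lambda>_. euclideanreal) I"

lemma real_product_nbhd:
  assumes V: "openin (real_product I) V" and q: "q \<in> V"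
  obtains F e where "finite F" "F \<subseteq> I" "0 < e"
    "\<And>p. p \<in> extensional I \<Longrightarrow> (\<And>f. f \<in> F \<Longrightarrow> \<bar>p f - q f\<bar> < e) \<Longrightarrow> p \<in> V"
proof -
  obtain U where U: "finite {i \<in> I. U i \<noteq> UNIV}" "\<And>i. i \<in> I \<Longrightarrow> open (U i)"
    "q \<in> Pi\<^sub>E I U" "Pi\<^sub>E I U \<subseteq> V"
    using assms by (auto simp: openin_product_topology_alt)
  let ?F = "{i \<in> I. U i \<noteq> UNIV}"
  have "\<exists>e>0. \<forall>y. \<bar>y - q i\<bar> < e \<longrightarrow> y \<in> U i" if "i \<in> I" for i
    using U(2)[OF that] PiE_mem[OF U(3) that] unfolding open_real by auto
  then obtain d where d: "\<And>i. i \<in> I \<Longrightarrow> 0 < d i" "\<And>i y. i \<in> I \<Longrightarrow> \<bar>y - q i\<bar> < d i \<Longrightarrow> y \<in> U i"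
    by metis
  define e where "e = Min (insert 1 (d ` ?F))"
  have e0: "0 < e" using U(1) d(1) by (auto simp: e_def)
  have ed: "e \<le> d i" if "i \<in> ?F" for i using U(1) that by (auto simp: e_def)
  show ?thesis
  proof (rule that[OF U(1) _ e0])
    fix p assume p: "p \<in> extensional I" "\<And>f. f \<in> ?F \<Longrightarrow> \<bar>p f - q f\<bar> < e"
    have "p i \<in> U i" if "i \<in> I" for i
      using p(2)[of i] ed[of i] d(2)[OF that, of "p i"] that by (cases "U i = UNIV") force+
    then have "p \<in> Pi\<^sub>E I U" using p(1) by (simp add: PiE_iff)
    then show "p \<in> V" using U(4) by blast
  qed auto
qed

lemma open_real_product_nbhd:
  assumes "finite F" "F \<subseteq> I"
  shows "openin (real_product I) {p \<in> extensional I. \<forall>f\<in>F. \<bar>p f - q f\<bar> < e}"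
proof -
  have "openin (real_product I) (Pi\<^sub>E I (\<lambda>i. if i \<in> F then {y. \<bar>y - q i\<bar> < e} else UNIV))"
  proof (rule openin_PiE_gen[THEN iffD2], rule disjI2, intro conjI ballI)
    show "finite {i \<in> I. (if i \<in> F then {y. \<bar>y - q i\<bar> < e} else UNIV) \<noteq> topspace euclideanreal}"
      by (rule finite_subset[OF _ assms(1)]) auto
    show "openin euclideanreal (if i \<in> F then {y. \<bar>y - q i\<bar> < e} else UNIV)" for i
    proof -
      have "{y. \<bar>y - q i\<bar> < e} = ball (q i) e" by (auto simp: dist_real_def)
      then show ?thesis by simp
    qed
  qed
  also have "Pi\<^sub>E I (\<lambda>i. if i \<in> F then {y. \<bar>y - q i\<bar> < e} else UNIV) = {p \<in> extensional I. \<forall>f\<in>F. \<bar>p f - q f\<bar> < e}"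
    (is "?A = ?B")
  proof (intro equalityI subsetI CollectI conjI ballI)
    fix p f assume p: "p \<in> ?A" and f: "f \<in> F"
    show "\<bar>p f - q f\<bar> < e" using PiE_mem[OF p, of f] f assms(2) by (simp add: subset_iff)
  next
    fix p assume "p \<in> ?B"
    then show "p \<in> ?A" by (simp add: PiE_iff)
  qed (simp add: PiE_iff)
  finally show ?thesis .
qed

definition corona_points :: "'a metric \<Rightarrow> (('a \<Rightarrow> real) \<Rightarrow> real) set" where
  "corona_points m = {q \<in> extensional (higson_functions m).
     \<forall>F e. finite F \<longrightarrow> F \<subseteq> higson_functions m \<longrightarrow> 0 < e \<longrightarrow> infinite (higson_nbhd m q F e)}"

lemma corona_pointsD:
  "q \<in> corona_points m \<Longrightarrow> finite F \<Longrightarrow> F \<subseteq> higson_functions m \<Longrightarrow> 0 < e \<Longrightarrow> infinite (higson_nbhd m q F e)"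
  by (simp add: corona_points_def)

lemma higson_eval_in_cube:
  assumes "x \<in> mspace m"
  shows "higson_eval m x \<in> Pi\<^sub>E (higson_functions m) (\<lambda>f. {Inf (f ` mspace m)..Sup (f ` mspace m)})"
proof -
  have "Inf (f ` mspace m) \<le> f x" "f x \<le> Sup (f ` mspace m)" if "f \<in> higson_functions m" for f
  proof -
    have "bounded (f ` mspace m)" using that by (simp add: higson_functions_def)
    then show "Inf (f ` mspace m) \<le> f x" "f x \<le> Sup (f ` mspace m)"
      using assms by (auto intro!: cInf_lower cSup_upper bounded_imp_bdd_below bounded_imp_bdd_above)
  qed
  then show ?thesis by (auto simp: higson_eval_def)
qed

lemma in_closure_of_real_product:
  "q \<in> real_product I closure_of S \<longleftrightarrow> q \<in> extensional I \<and>
     (\<forall>F e. finite F \<longrightarrow> F \<subseteq> I \<longrightarrow> 0 < e \<longrightarrow> (\<exists>p\<in>S \<inter> extensional I. \<forall>f\<in>F. \<bar>p f - q f\<bar> < e))"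
proof (intro iffI conjI allI impI)
  assume q: "q \<in> real_product I closure_of S"
  show qe: "q \<in> extensional I"
    using subsetD[OF closure_of_subset_topspace q] by (simp add: PiE_iff)
  fix F and e :: real assume F: "finite F" "F \<subseteq> I" "0 < e"
  have "q \<in> {p \<in> extensional I. \<forall>f\<in>F. \<bar>p f - q f\<bar> < e}" using qe F by simp
  then obtain y where "y \<in> S" "y \<in> {p \<in> extensional I. \<forall>f\<in>F. \<bar>p f - q f\<bar> < e}"
    using conjunct2[OF q[unfolded in_closure_of], rule_format,
        OF conjI[OF _ open_real_product_nbhd[OF F(1,2), of q e]]] by blast
  then show "\<exists>p\<in>S \<inter> extensional I. \<forall>f\<in>F. \<bar>p f - q f\<bar> < e" by auto
next
  assume q: "q \<in> extensional I \<and>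
     (\<forall>F e. finite F \<longrightarrow> F \<subseteq> I \<longrightarrow> 0 < e \<longrightarrow> (\<exists>p\<in>S \<inter> extensional I. \<forall>f\<in>F. \<bar>p f - q f\<bar> < e))"
  show "q \<in> real_product I closure_of S"
    unfolding in_closure_of
  proof (intro conjI allI impI)
    show "q \<in> topspace (real_product I)" using conjunct1[OF q] by (simp add: PiE_iff)
    fix V assume V: "q \<in> V \<and> openin (real_product I) V"
    obtain F e where F: "finite F" "F \<subseteq> I" "0 < e"
      "\<And>p. p \<in> extensional I \<Longrightarrow> (\<And>f. f \<in> F \<Longrightarrow> \<bar>p f - q f\<bar> < e) \<Longrightarrow> p \<in> V"
      using real_product_nbhd[OF conjunct2[OF V] conjunct1[OF V]] by blast
    obtain p where p: "p \<in> S \<inter> extensional I" "\<forall>f\<in>F. \<bar>p f - q f\<bar> < e"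
      using conjunct2[OF q, rule_format, OF F(1-3)] ..
    have "p \<in> V" by (rule F(4)) (simp_all add: p IntD2[OF p(1)])
    then show "\<exists>y. y \<in> S \<and> y \<in> V" using IntD1[OF p(1)] by (intro exI conjI)
  qed
qed

section \<open>The points of the Higson corona\<close>

text \<open>A point of the closure belongs to the space exactly if some basic neighbourhood of it contains only
  finitely many points of the space: finitely many points other than the limit can be cut away by
  further coordinates, and the indicator function of a single point is a Higson function. So the
  corona is described by the infinite traces, without reference to the compactification.\<close>

lemma higson_corona_eq:
  assumes m: "finite_balls m"
  shows "higson_corona m = subtopology (real_product (higson_functions m)) (corona_points m)"
proof -
  let ?H = "higson_functions m" and ?C = "Pi\<^sub>E (higson_functions m) (\<lambda>f. {Inf (f ` mspace m)..Sup (f ` mspace m)})"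
  let ?E = "higson_eval m ` mspace m" and ?P = "real_product (higson_functions m)"
  have cube: "higson_cube m = subtopology ?P ?C"
    unfolding higson_cube_def by (simp add: subtopology_product_topology)
  define cl where "cl = ?P closure_of ?E"
  have EC: "?E \<subseteq> ?C" using higson_eval_in_cube by (rule image_subsetI)
  have "closedin ?P ?C" by (simp add: closedin_product_topology)
  then have clC: "cl \<subseteq> ?C" unfolding cl_def using EC by (rule closure_of_minimal[rotated])
  have "?C \<inter> ?E = ?E" using EC by (simp only: Int_absorb1)
  then have cubecl: "higson_cube m closure_of ?E = cl"
    unfolding cube closure_of_subtopology cl_def[symmetric]
    using clC by (simp only: cl_def[symmetric] Int_absorb1)
  have clsub: "cl \<subseteq> topspace ?P" unfolding cl_def by (rule closure_of_subset_topspace)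
  have "cl - ?E = corona_points m"
  proof (intro Set.set_eqI iffI)
    fix q assume q: "q \<in> cl - ?E"
    then have qcl: "q \<in> cl" and qe: "q \<in> extensional ?H"
      by (simp_all add: cl_def in_closure_of_real_product)
    note qcl' = conjunct2[OF qcl[unfolded cl_def in_closure_of_real_product], rule_format]
    have "infinite (higson_nbhd m q F e)" if F: "finite F" "F \<subseteq> ?H" "0 < e" for F e
    proof
      let ?N = "higson_nbhd m q F e"
      assume fin: "finite ?N"
      have "\<exists>f\<in>?H. f x \<noteq> q f" if "x \<in> ?N" for x
      proof (rule ccontr)
        assume "\<not> (\<exists>f\<in>?H. f x \<noteq> q f)"
        then have "q = higson_eval m x"
          using qe by (auto simp: higson_eval_def fun_eq_iff extensional_def)
        then show False using q that by (auto simp: higson_nbhd_def)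
      qed
      then obtain g where g: "\<And>x. x \<in> ?N \<Longrightarrow> g x \<in> ?H \<and> g x x \<noteq> q (g x)" by metis
      define d where "d = Min (insert e ((\<lambda>x. \<bar>g x x - q (g x)\<bar>) ` ?N))"
      have d: "0 < d" "d \<le> e" "\<And>x. x \<in> ?N \<Longrightarrow> d \<le> \<bar>g x x - q (g x)\<bar>"
        using fin g F(3) by (auto simp: d_def)
      obtain x where x: "x \<in> mspace m" "\<forall>f\<in>F \<union> g ` ?N. \<bar>higson_eval m x f - q f\<bar> < d"
      proof -
        have "\<exists>p\<in>?E \<inter> extensional ?H. \<forall>f\<in>F \<union> g ` ?N. \<bar>p f - q f\<bar> < d"
          by (rule qcl') (use F fin g d(1) in auto)
        then show ?thesis using that by auto
      qed
      have "\<bar>f x - q f\<bar> < d" if "f \<in> F \<union> g ` ?N" for f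
      proof -
        have "f \<in> ?H" using that F g by auto
        then show ?thesis using bspec[OF x(2) that] by (simp add: higson_eval_def)
      qed
      then have "x \<in> ?N" and "\<forall>y\<in>?N. \<bar>g y x - q (g y)\<bar> < d"
        using x(1) d(2) by (force simp: higson_nbhd_def)+
      then show False using d(3) by force
    qed
    then show "q \<in> corona_points m" using qe by (simp add: corona_points_def)
  next
    fix q assume q: "q \<in> corona_points m"
    then have qe: "q \<in> extensional ?H" by (simp add: corona_points_def)
    have "\<exists>p\<in>?E \<inter> extensional ?H. \<forall>f\<in>F. \<bar>p f - q f\<bar> < e" if F: "finite F" "F \<subseteq> ?H" "0 < e" for F e
    proof -
      obtain x where x: "x \<in> higson_nbhd m q F e"
        using infinite_imp_nonempty[OF corona_pointsD[OF q F]] by blast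
      then show ?thesis using F(2)
        by (intro bexI[of _ "higson_eval m x"]) (auto simp: higson_nbhd_def higson_eval_def)
    qed
    then have "q \<in> cl" using qe by (simp add: cl_def in_closure_of_real_product)
    moreover have "q \<noteq> higson_eval m x" if x: "x \<in> mspace m" for x
    proof
      assume qx: "q = higson_eval m x"
      let ?f = "\<lambda>y\<in>mspace m. if y = x then 1 else 0 :: real"
      have "finite {y \<in> mspace m. ?f y \<noteq> 0}" by (rule finite_subset[of _ "{x}"]) auto
      then have f: "?f \<in> ?H" by (intro finite_support_higson[OF m]) auto
      have "higson_nbhd m q {?f} 1 \<subseteq> {x}"
        using f x by (auto simp: higson_nbhd_def qx higson_eval_def split: if_splits)
      then have "finite (higson_nbhd m q {?f} 1)" by (rule finite_subset) simp
      then show False using corona_pointsD[OF q, of "{?f}" 1] f by simp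
    qed
    ultimately show "q \<in> cl - ?E" by auto
  qed
  moreover have "topspace (higson_compactification m) = cl"
    unfolding higson_compactification_def cubecl unfolding cube
    using clC clsub by auto
  moreover have "?C \<inter> cl \<inter> (cl - ?E) = cl - ?E"
    using clC by blast
  ultimately show ?thesis
    unfolding higson_corona_def unfolding higson_compactification_def cubecl unfolding cube
    by (simp add: subtopology_subtopology)
qed

lemma corona_points_subset: "corona_points m \<subseteq> topspace (real_product (higson_functions m))"
  by (simp add: corona_points_def PiE_iff subset_iff)

lemma topspace_higson_corona:
  assumes "finite_balls m"
  shows "topspace (higson_corona m) = corona_points m"
  unfolding higson_corona_eq[OF assms] topspace_subtopology
  by (rule Int_absorb1[OF corona_points_subset])

lemma Hausdorff_higson_corona:
  assumes "finite_balls m"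
  shows "Hausdorff_space (higson_corona m)"
  unfolding higson_corona_eq[OF assms]
  by (intro Hausdorff_space_subtopology) (simp add: Hausdorff_space_product_topology)

lemma corona_nbhd_mem:
  assumes m: "finite_balls m" and U: "openin (higson_corona m) U" and q: "q \<in> U"
  obtains F e where "finite F" "F \<subseteq> higson_functions m" "0 < e"
    "\<And>p. p \<in> corona_points m \<Longrightarrow> (\<And>f. f \<in> F \<Longrightarrow> \<bar>p f - q f\<bar> < e) \<Longrightarrow> p \<in> U"
proof -
  obtain V where V: "openin (real_product (higson_functions m)) V" "U = V \<inter> corona_points m"
    using U unfolding higson_corona_eq[OF m] openin_subtopology by blast
  have "q \<in> V" using q V(2) by simp
  obtain F e where F: "finite F" "F \<subseteq> higson_functions m" "0 < e"
    "\<And>p. p \<in> extensional (higson_functions m) \<Longrightarrow> (\<And>f. f \<in> F \<Longrightarrow> \<bar>p f - q f\<bar> < e) \<Longrightarrow> p \<in> V"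
    using real_product_nbhd[OF V(1) \<open>q \<in> V\<close>] by blast
  show ?thesis
  proof (rule that[OF F(1-3)])
    fix p assume p: "p \<in> corona_points m" "\<And>f. f \<in> F \<Longrightarrow> \<bar>p f - q f\<bar> < e"
    have "p \<in> extensional (higson_functions m)" using p(1) by (simp add: corona_points_def)
    then have "p \<in> V" using p(2) by (rule F(4))
    then show "p \<in> U" using p(1) V(2) by simp
  qed
qed

lemma open_corona_nbhd:
  assumes "finite_balls m" "finite F" "F \<subseteq> higson_functions m"
  shows "openin (higson_corona m) {p \<in> corona_points m. \<forall>f\<in>F. \<bar>p f - q f\<bar> < e}"
proof -
  have "{p \<in> corona_points m. \<forall>f\<in>F. \<bar>p f - q f\<bar> < e} =
      {p \<in> extensional (higson_functions m). \<forall>f\<in>F. \<bar>p f - q f\<bar> < e} \<inter> corona_points m"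
    by (auto simp only: corona_points_def mem_Collect_eq Int_iff)
  then show ?thesis
    unfolding higson_corona_eq[OF assms(1)] openin_subtopology
    using open_real_product_nbhd[OF assms(2,3), of q e] by blast
qed

text \<open>If every point of the cube had a neighbourhood with finite trace on \<open>C\<close>, then finitely many of
  these would cover the cube, and \<open>C\<close> would be finite.\<close>

lemma infinite_set_accumulates:
  assumes m: "finite_balls m" and C: "C \<subseteq> mspace m" "infinite C"
  obtains q where "q \<in> corona_points m"
    "\<And>F e. finite F \<Longrightarrow> F \<subseteq> higson_functions m \<Longrightarrow> 0 < e \<Longrightarrow> infinite (C \<inter> higson_nbhd m q F e)"
proof -
  let ?H = "higson_functions m" and ?P = "real_product (higson_functions m)"
  define Cube where "Cube = Pi\<^sub>E ?H (\<lambda>f. {Inf (f ` mspace m)..Sup (f ` mspace m)})"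
  have comp: "compactin ?P Cube" unfolding Cube_def by (simp add: compactin_PiE)
  have Cube_ext: "q \<in> extensional ?H" if "q \<in> Cube" for q using that by (simp add: Cube_def PiE_iff)
  have "\<exists>q\<in>Cube. \<forall>F e. finite F \<longrightarrow> F \<subseteq> ?H \<longrightarrow> 0 < e \<longrightarrow> infinite (C \<inter> higson_nbhd m q F e)"
  proof (rule ccontr)
    assume neg: "\<not> ?thesis"
    define small where "small q F e \<longleftrightarrow> finite F \<and> F \<subseteq> ?H \<and> (0::real) < e \<and>
      finite (C \<inter> higson_nbhd m q F e)" for q F e
    have "\<forall>q\<in>Cube. \<exists>F e. small q F e"
      using neg unfolding small_def by blast
    then obtain F e where "\<And>q. q \<in> Cube \<Longrightarrow> small q (F q) (e q)" by metis
    then have Fe: "\<And>q. q \<in> Cube \<Longrightarrow> finite (F q) \<and> F q \<subseteq> ?H \<and> (0::real) < e q \<and>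
        finite (C \<inter> higson_nbhd m q (F q) (e q))"
      by (simp add: small_def)
    define W where "W q = {p \<in> extensional ?H. \<forall>f\<in>F q. \<bar>p f - q f\<bar> < e q}" for q
    have "\<exists>\<F>. finite \<F> \<and> \<F> \<subseteq> W ` Cube \<and> Cube \<subseteq> \<Union>\<F>"
    proof (rule compactinD[OF comp])
      show "openin ?P U" if U: "U \<in> W ` Cube" for U
      proof -
        obtain q where q: "q \<in> Cube" "U = W q" using U by blast
        show ?thesis unfolding q(2) W_def using Fe[OF q(1)] by (intro open_real_product_nbhd) simp_all
      qed
      have "q \<in> W q" if "q \<in> Cube" for q using Fe[OF that] that Cube_ext by (simp add: W_def)
      then show "Cube \<subseteq> \<Union>(W ` Cube)" by blast
    qed
    then obtain Q where Q: "finite Q" "Q \<subseteq> Cube" "Cube \<subseteq> \<Union>(W ` Q)"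
      using finite_subset_image[of _ W Cube] by metis
    have "C \<subseteq> (\<Union>q\<in>Q. C \<inter> higson_nbhd m q (F q) (e q))"
    proof
      fix x assume x: "x \<in> C"
      then obtain q where q: "q \<in> Q" "higson_eval m x \<in> W q"
        using higson_eval_in_cube[of x m, folded Cube_def] C(1) Q(3) by blast
      have qC: "q \<in> Cube" using q(1) Q(2) by blast
      have "\<bar>f x - q f\<bar> < e q" if f: "f \<in> F q" for f
      proof -
        have "f \<in> ?H" using f Fe[OF qC] by blast
        moreover have "\<bar>higson_eval m x f - q f\<bar> < e q" using q(2) f by (simp add: W_def)
        ultimately show ?thesis by (simp add: higson_eval_def)
      qed
      then have "x \<in> higson_nbhd m q (F q) (e q)"
        using x C(1) by (auto simp: higson_nbhd_def)
      then show "x \<in> (\<Union>q\<in>Q. C \<inter> higson_nbhd m q (F q) (e q))" using x q by blast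
    qed
    moreover have "finite (\<Union>q\<in>Q. C \<inter> higson_nbhd m q (F q) (e q))"
      using Q Fe by blast
    ultimately show False using C(2) by (meson finite_subset)
  qed
  then obtain q where q: "q \<in> Cube"
    "\<And>F e. finite F \<Longrightarrow> F \<subseteq> ?H \<Longrightarrow> 0 < e \<Longrightarrow> infinite (C \<inter> higson_nbhd m q F e)"
    by blast
  moreover have "q \<in> corona_points m"
    unfolding corona_points_def mem_Collect_eq
  proof (intro conjI allI impI)
    show "q \<in> extensional ?H" using q(1) by (rule Cube_ext)
    show "infinite (higson_nbhd m q F e)" if "finite F" "F \<subseteq> ?H" "0 < e" for F e
      using q(2)[OF that] by (meson finite_Int)
  qed
  ultimately show ?thesis using that by blast
qed

text \<open>The corona is closed in the compact cube, because a neighbourhood with finite trace is also a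
  neighbourhood of the nearby points.\<close>

lemma compact_higson_corona:
  assumes m: "finite_balls m"
  shows "compact_space (higson_corona m)"
proof -
  let ?H = "higson_functions m" and ?P = "real_product (higson_functions m)"
  let ?C = "Pi\<^sub>E (higson_functions m) (\<lambda>f. {Inf (f ` mspace m)..Sup (f ` mspace m)})"
  have "\<exists>V. openin ?P V \<and> q \<in> V \<and> V \<subseteq> topspace ?P - corona_points m"
    if q: "q \<in> topspace ?P - corona_points m" for q
  proof -
    have qe: "q \<in> extensional ?H" using DiffD1[OF q] by (simp add: PiE_iff)
    then obtain F e where F: "finite F" "F \<subseteq> ?H" "0 < e" "finite (higson_nbhd m q F e)"
      using DiffD2[OF q] unfolding corona_points_def by blast
    have "p \<notin> corona_points m" if "\<forall>f\<in>F. \<bar>p f - q f\<bar> < e/2" for p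
    proof
      assume p: "p \<in> corona_points m"
      have "higson_nbhd m p F (e/2) \<subseteq> higson_nbhd m q F e"
      proof
        fix x assume x: "x \<in> higson_nbhd m p F (e/2)"
        have "\<bar>f x - q f\<bar> < e" if f: "f \<in> F" for f
        proof -
          have "\<bar>f x - p f\<bar> < e/2" using x f by (simp add: higson_nbhd_def)
          moreover have "\<bar>p f - q f\<bar> < e/2" using f \<open>\<forall>f\<in>F. \<bar>p f - q f\<bar> < e/2\<close> by blast
          ultimately show ?thesis by linarith
        qed
        then show "x \<in> higson_nbhd m q F e" using x by (simp add: higson_nbhd_def)
      qed
      then have "finite (higson_nbhd m p F (e/2))" using F(4) by (rule finite_subset)
      then show False using corona_pointsD[OF p, of F "e/2"] F by simp
    qed
    then have "{p \<in> extensional ?H. \<forall>f\<in>F. \<bar>p f - q f\<bar> < e/2} \<subseteq> topspace ?P - corona_points m"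
      by (intro subsetI DiffI) (simp_all add: PiE_iff)
    moreover have "q \<in> {p \<in> extensional ?H. \<forall>f\<in>F. \<bar>p f - q f\<bar> < e/2}" using qe F(3) by simp
    ultimately show ?thesis using open_real_product_nbhd[OF F(1,2), of q "e/2"] by blast
  qed
  then have "closedin ?P (corona_points m)"
    unfolding closedin_def openin_subopen[of _ "topspace ?P - corona_points m"]
    using corona_points_subset by blast
  moreover have "corona_points m \<subseteq> ?C"
  proof
    fix q assume q: "q \<in> corona_points m"
    have "Inf (f ` mspace m) \<le> q f \<and> q f \<le> Sup (f ` mspace m)" if f: "f \<in> ?H" for f
    proof -
      have "\<exists>x\<in>mspace m. \<bar>f x - q f\<bar> < e" if "0 < e" for e
      proof -
        have "higson_nbhd m q {f} e \<noteq> {}" using corona_pointsD[OF q, of "{f}" e] f that by auto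
        then show ?thesis by (auto simp: higson_nbhd_def)
      qed
      moreover have "Inf (f ` mspace m) \<le> f x" "f x \<le> Sup (f ` mspace m)" if "x \<in> mspace m" for x
        using higson_eval_in_cube[OF that] f that by (auto simp: PiE_iff higson_eval_def)
      ultimately have "Inf (f ` mspace m) \<le> q f + e \<and> q f \<le> Sup (f ` mspace m) + e" if e: "0 < e" for e
      proof -
        obtain x where x: "x \<in> mspace m" "\<bar>f x - q f\<bar> < e"
          using \<open>\<And>e. 0 < e \<Longrightarrow> \<exists>x\<in>mspace m. \<bar>f x - q f\<bar> < e\<close>[OF e] by blast
        have "Inf (f ` mspace m) \<le> f x" "f x \<le> Sup (f ` mspace m)"
          using \<open>\<And>x. x \<in> mspace m \<Longrightarrow> Inf (f ` mspace m) \<le> f x\<close> x(1)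
            \<open>\<And>x. x \<in> mspace m \<Longrightarrow> f x \<le> Sup (f ` mspace m)\<close> by blast+
        then show ?thesis using x(2) by linarith
      qed
      then show ?thesis by (auto intro: field_le_epsilon)
    qed
    then show "q \<in> ?C" using q by (simp add: corona_points_def PiE_iff)
  qed
  moreover have "compactin ?P ?C" by (simp add: compactin_PiE)
  ultimately have "compactin ?P (corona_points m)"
    by (meson closed_compactin)
  then show ?thesis
    unfolding higson_corona_eq[OF m] by (simp add: compactin_subspace)
qed

lemma higson_corona_nonempty:
  assumes "finite_balls m" "infinite (mspace m)"
  shows "corona_points m \<noteq> {}"
  using infinite_set_accumulates[OF assms(1) subset_refl assms(2)] by (metis empty_iff)

text \<open>The function \<open>w\<close> localizes: only points at which it is close to its limit are relevant. With the
  indicator function of a set, functions that agree asymptotically on the set have the same limit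
  at the points of the corona that belong to it.\<close>

lemma corona_point_agree:
  assumes q: "q \<in> corona_points m" and u: "u \<in> higson_functions m" and v: "v \<in> higson_functions m"
    and w: "w \<in> higson_functions m"
    and agree: "\<And>d. 0 < d \<Longrightarrow> finite {x \<in> mspace m. \<bar>w x - q w\<bar> < 1 \<and> d \<le> \<bar>u x - v x\<bar>}"
  shows "q u = q v"
proof (rule ccontr)
  assume "q u \<noteq> q v"
  define d where "d = min 1 (\<bar>q u - q v\<bar> / 3)"
  have d: "0 < d" "3 * d \<le> \<bar>q u - q v\<bar>" "d \<le> 1" using \<open>q u \<noteq> q v\<close> by (auto simp: d_def min_def)
  have "higson_nbhd m q {u, v, w} d \<subseteq> {x \<in> mspace m. \<bar>w x - q w\<bar> < 1 \<and> d \<le> \<bar>u x - v x\<bar>}"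
    using d by (auto simp: higson_nbhd_def)
  then have "finite (higson_nbhd m q {u, v, w} d)" using agree[OF d(1)] by (rule finite_subset)
  then show False
    using corona_pointsD[OF q, of "{u,v,w}" d] u v w d(1) by simp
qed

section \<open>Clopen subsets of the corona\<close>

text \<open>These are the sets whose indicator functions are Higson functions. They induce clopen subsets of
  the corona, and every clopen subset of the corona arises from one of them.\<close>

definition coarsely_clopen :: "'a metric \<Rightarrow> 'a set \<Rightarrow> bool" where
  "coarsely_clopen m A \<longleftrightarrow> A \<subseteq> mspace m \<and>
     (\<forall>r. finite {x \<in> A. \<exists>y\<in>mspace m - A. mdist m x y \<le> r})"

definition set_indicator :: "'a metric \<Rightarrow> 'a set \<Rightarrow> 'a \<Rightarrow> real" where
  "set_indicator m A = (\<lambda>x\<in>mspace m. if x \<in> A then 1 else 0)"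

lemma set_indicator_simps:
  "x \<in> mspace m \<Longrightarrow> set_indicator m A x = (if x \<in> A then 1 else 0)"
  by (simp add: set_indicator_def)

lemma set_indicator_higson:
  assumes m: "finite_balls m" and A: "coarsely_clopen m A"
  shows "set_indicator m A \<in> higson_functions m"
  unfolding higson_functions_finite_balls[OF m]
proof (intro conjI allI impI)
  have "set_indicator m A ` mspace m \<subseteq> {0, 1}" by (auto simp: set_indicator_simps)
  then show "bounded (set_indicator m A ` mspace m)" by (rule bounded_subset[rotated]) simp
  fix r e :: real assume "0 < e"
  let ?B = "{x \<in> A. \<exists>y\<in>mspace m - A. mdist m x y \<le> r}"
  have B: "finite ?B" using A by (simp add: coarsely_clopen_def)
  have "oscillation_set m (set_indicator m A) r e \<subseteq> ?B \<union> (\<Union>x\<in>?B. {y \<in> mspace m. mdist m x y \<le> r})"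
  proof
    fix x assume "x \<in> oscillation_set m (set_indicator m A) r e"
    then obtain y where y: "x \<in> mspace m" "y \<in> mspace m" "mdist m x y \<le> r"
      "e \<le> \<bar>set_indicator m A x - set_indicator m A y\<bar>" by (auto simp: oscillation_set_def)
    then have "x \<in> A \<and> y \<notin> A \<or> x \<notin> A \<and> y \<in> A"
      using \<open>0 < e\<close> by (auto simp: set_indicator_simps split: if_splits)
    then show "x \<in> ?B \<union> (\<Union>x\<in>?B. {y \<in> mspace m. mdist m x y \<le> r})"
    proof
      assume "x \<in> A \<and> y \<notin> A"
      then show ?thesis using y(1-3) by blast
    next
      assume "x \<notin> A \<and> y \<in> A"
      moreover have "mdist m y x \<le> r" using y(3) by (simp add: mdist_commute)
      ultimately have "y \<in> ?B" "x \<in> {z \<in> mspace m. mdist m y z \<le> r}" using y(1,2) by blast+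
      then show ?thesis by blast
    qed
  qed
  moreover have "finite (?B \<union> (\<Union>x\<in>?B. {y \<in> mspace m. mdist m x y \<le> r}))"
  proof -
    have "x \<in> mspace m" if "x \<in> ?B" for x using that A by (auto simp: coarsely_clopen_def)
    then show ?thesis using B finite_balls_mcball[OF _ m] by blast
  qed
  ultimately show "finite (oscillation_set m (set_indicator m A) r e)" by (rule finite_subset)
qed (simp add: set_indicator_def)

definition corona_part :: "'a metric \<Rightarrow> 'a set \<Rightarrow> (('a \<Rightarrow> real) \<Rightarrow> real) set" where
  "corona_part m A = {q \<in> corona_points m. q (set_indicator m A) = 1}"

lemma set_indicator_limit:
  assumes m: "finite_balls m" and A: "coarsely_clopen m A" and q: "q \<in> corona_points m"
  shows "q (set_indicator m A) = 0 \<or> q (set_indicator m A) = 1"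
proof (rule ccontr)
  assume n: "\<not> ?thesis"
  let ?q = "q (set_indicator m A)"
  define d where "d = min \<bar>?q\<bar> \<bar>1 - ?q\<bar>"
  have d: "0 < d" using n by (auto simp: d_def)
  have "higson_nbhd m q {set_indicator m A} d \<noteq> {}"
    using corona_pointsD[OF q _ _ d, of "{set_indicator m A}"] set_indicator_higson[OF m A] by auto
  then obtain x where "x \<in> mspace m" "\<bar>set_indicator m A x - ?q\<bar> < d" by (auto simp: higson_nbhd_def)
  then show False by (auto simp: d_def set_indicator_simps split: if_splits)
qed

lemma clopen_corona_part:
  assumes m: "finite_balls m" and A: "coarsely_clopen m A"
  shows "openin (higson_corona m) (corona_part m A)"
    and "openin (higson_corona m) (corona_points m - corona_part m A)"
proof -
  let ?h = "set_indicator m A"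
  have "corona_part m A = {p \<in> corona_points m. \<forall>f\<in>{?h}. \<bar>p f - (\<lambda>_. 1) f\<bar> < 1}"
    using set_indicator_limit[OF m A] by (force simp: corona_part_def)
  then show "openin (higson_corona m) (corona_part m A)"
    using open_corona_nbhd[OF m, of "{?h}" "\<lambda>_. 1" 1] set_indicator_higson[OF m A] by simp
  have "corona_points m - corona_part m A = {p \<in> corona_points m. \<forall>f\<in>{?h}. \<bar>p f - (\<lambda>_. 0) f\<bar> < 1}"
    using set_indicator_limit[OF m A] by (force simp: corona_part_def)
  then show "openin (higson_corona m) (corona_points m - corona_part m A)"
    using open_corona_nbhd[OF m, of "{?h}" "\<lambda>_. 0" 1] set_indicator_higson[OF m A] by simp
qed

lemma corona_part_nonempty_iff:
  assumes m: "finite_balls m" and A: "coarsely_clopen m A"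
  shows "corona_part m A \<noteq> {} \<longleftrightarrow> infinite A"
proof
  let ?h = "set_indicator m A"
  have h: "?h \<in> higson_functions m" by (rule set_indicator_higson[OF m A])
  assume "corona_part m A \<noteq> {}"
  then obtain q where q: "q \<in> corona_points m" "q ?h = 1" by (auto simp: corona_part_def)
  have "higson_nbhd m q {?h} 1 \<subseteq> A"
    by (auto simp: higson_nbhd_def q(2) set_indicator_simps split: if_splits)
  moreover have "infinite (higson_nbhd m q {?h} 1)"
    using corona_pointsD[OF q(1), of "{?h}" 1] h by simp
  ultimately show "infinite A" by (meson finite_subset)
next
  let ?h = "set_indicator m A"
  have h: "?h \<in> higson_functions m" by (rule set_indicator_higson[OF m A])
  have Am: "A \<subseteq> mspace m" using A by (simp add: coarsely_clopen_def)
  assume "infinite A"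
  then obtain q where q: "q \<in> corona_points m"
    "\<And>F e. finite F \<Longrightarrow> F \<subseteq> higson_functions m \<Longrightarrow> 0 < e \<Longrightarrow> infinite (A \<inter> higson_nbhd m q F e)"
    using infinite_set_accumulates[OF m Am] by metis
  have "A \<inter> higson_nbhd m q {?h} 1 \<noteq> {}" using q(2)[of "{?h}" 1] h by auto
  then have "q ?h \<noteq> 0" using Am by (force simp: higson_nbhd_def set_indicator_simps)
  then have "q \<in> corona_part m A" using set_indicator_limit[OF m A q(1)] q(1) by (auto simp: corona_part_def)
  then show "corona_part m A \<noteq> {}" by blast
qed

lemma corona_part_disjoint:
  assumes m: "finite_balls m" and A: "coarsely_clopen m A" and B: "coarsely_clopen m B" and d: "A \<inter> B = {}"
  shows "corona_part m A \<inter> corona_part m B = {}"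
proof (rule ccontr)
  let ?f = "set_indicator m A" and ?g = "set_indicator m B"
  assume "corona_part m A \<inter> corona_part m B \<noteq> {}"
  then obtain q where q: "q \<in> corona_points m" "q ?f = 1" "q ?g = 1" by (auto simp: corona_part_def)
  have "higson_nbhd m q {?f, ?g} 1 \<noteq> {}"
    using corona_pointsD[OF q(1), of "{?f, ?g}" 1] set_indicator_higson[OF m] A B by auto
  then show False using d q(2,3) by (auto simp: higson_nbhd_def set_indicator_simps split: if_splits)
qed

text \<open>By compactness a clopen set and its complement stay a fixed distance apart in finitely many
  coordinates. The points of the space that are close to the clopen set in these coordinates form
  a coarsely clopen set, because the coordinates vary slowly near infinity.\<close>

lemma clopen_subset_corona:
  assumes m: "finite_balls m" and U: "openin (higson_corona m) U"
    and V: "openin (higson_corona m) (corona_points m - U)"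
  obtains A where "coarsely_clopen m A" "U = corona_part m A"
proof -
  let ?H = "higson_functions m"
  have Usub: "U \<subseteq> corona_points m"
    using openin_subset[OF U] by (simp add: topspace_higson_corona[OF m])
  have "closedin (higson_corona m) U"
    using V Usub by (simp add: closedin_def topspace_higson_corona[OF m])
  then have comp: "compactin (higson_corona m) U"
    using closedin_compact_space[OF compact_higson_corona[OF m]] by blast
  have "\<forall>p\<in>U. \<exists>F e. finite F \<and> F \<subseteq> ?H \<and> 0 < e \<and>
      (\<forall>q\<in>corona_points m. (\<forall>f\<in>F. \<bar>q f - p f\<bar> < 2 * e) \<longrightarrow> q \<in> U)"
  proof
    fix p assume "p \<in> U"
    from corona_nbhd_mem[OF m U this] obtain F e where "finite F" "F \<subseteq> ?H" "0 < e"
      "\<And>q. q \<in> corona_points m \<Longrightarrow> (\<And>f. f \<in> F \<Longrightarrow> \<bar>q f - p f\<bar> < e) \<Longrightarrow> q \<in> U" by blast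
    then show "\<exists>F e. finite F \<and> F \<subseteq> ?H \<and> 0 < e \<and>
      (\<forall>q\<in>corona_points m. (\<forall>f\<in>F. \<bar>q f - p f\<bar> < 2 * e) \<longrightarrow> q \<in> U)"
      by (intro exI[of _ F] exI[of _ "e/2"]) auto
  qed
  then obtain F e where Fe: "\<And>p. p \<in> U \<Longrightarrow> finite (F p) \<and> F p \<subseteq> ?H \<and> (0::real) < e p"
    and FeU: "\<And>p q. p \<in> U \<Longrightarrow> q \<in> corona_points m \<Longrightarrow> \<forall>f\<in>F p. \<bar>q f - p f\<bar> < 2 * e p \<Longrightarrow> q \<in> U"
    by metis
  define W where "W p = {q \<in> corona_points m. \<forall>f\<in>F p. \<bar>q f - p f\<bar> < e p}" for p
  have "\<exists>\<F>. finite \<F> \<and> \<F> \<subseteq> W ` U \<and> U \<subseteq> \<Union>\<F>"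
  proof (rule compactinD[OF comp])
    show "openin (higson_corona m) X" if "X \<in> W ` U" for X
      using that Fe open_corona_nbhd[OF m] unfolding W_def by fastforce
    have "q \<in> W q" if "q \<in> U" for q using Fe[OF that] that Usub by (auto simp: W_def)
    then show "U \<subseteq> \<Union>(W ` U)" by blast
  qed
  then obtain Q where Q: "finite Q" "Q \<subseteq> U" "U \<subseteq> \<Union>(W ` Q)"
    by (metis finite_subset_image)
  define F' where "F' = \<Union>(F ` Q)"
  define d where "d = Min (insert 1 (e ` Q)) / 3"
  have F': "finite F'" "F' \<subseteq> ?H" using Q Fe by (auto simp: F'_def)
  have d: "0 < d" using Q Fe by (auto simp: d_def)
  have de: "3 * d \<le> e p" if "p \<in> Q" for p using Q(1) that by (auto simp: d_def)
  have d1: "3 * d \<le> 1" using Q(1) by (auto simp: d_def)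
  have sep: "q \<in> U" if p: "p \<in> U" and q: "q \<in> corona_points m" and pq: "\<forall>f\<in>F'. \<bar>p f - q f\<bar> < 3 * d" for p q
  proof -
    obtain r where r: "r \<in> Q" "p \<in> W r" using p Q(3) by blast
    have "\<forall>f\<in>F r. \<bar>q f - r f\<bar> < 2 * e r"
    proof
      fix f assume f: "f \<in> F r"
      have "\<bar>p f - r f\<bar> < e r" using r f by (auto simp: W_def)
      moreover have "\<bar>p f - q f\<bar> < 3 * d" using pq f r(1) by (auto simp: F'_def)
      ultimately show "\<bar>q f - r f\<bar> < 2 * e r" using de[OF r(1)] by linarith
    qed
    then show ?thesis using FeU q r(1) Q(2) by blast
  qed
  define near where "near S = {x \<in> mspace m. \<exists>p\<in>S. x \<in> higson_nbhd m p F' d}" for S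
  let ?V = "corona_points m - U"
  have fin: "finite (mspace m - (near U \<union> near ?V))" (is "finite ?R")
  proof (rule ccontr)
    assume "infinite ?R"
    then obtain q where q: "q \<in> corona_points m"
      "\<And>F e. finite F \<Longrightarrow> F \<subseteq> ?H \<Longrightarrow> 0 < e \<Longrightarrow> infinite (?R \<inter> higson_nbhd m q F e)"
      using infinite_set_accumulates[OF m, of ?R] by blast
    then have "?R \<inter> higson_nbhd m q F' d \<noteq> {}" using F' d by (metis finite.emptyI)
    then show False using q(1) by (auto simp: near_def)
  qed
  have disj: "\<exists>f\<in>F'. d \<le> \<bar>f x - f y\<bar>" if x: "x \<in> near U" and y: "y \<in> near ?V" for x y
  proof (rule ccontr)
    assume n: "\<not> ?thesis"
    obtain p q where p: "p \<in> U" "\<forall>f\<in>F'. \<bar>f x - p f\<bar> < d" and q: "q \<in> ?V" "\<forall>f\<in>F'. \<bar>f y - q f\<bar> < d"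
      using x y by (auto simp: near_def higson_nbhd_def)
    have "\<forall>f\<in>F'. \<bar>p f - q f\<bar> < 3 * d"
    proof
      fix f assume f: "f \<in> F'"
      have "\<bar>f x - f y\<bar> < d" using n f by force
      then show "\<bar>p f - q f\<bar> < 3 * d" using p(2) q(2) f by (smt (verit, best))
    qed
    then show False using sep[OF p(1), of q] q by blast
  qed
  have clopen: "coarsely_clopen m (near U)"
    unfolding coarsely_clopen_def
  proof (intro conjI allI)
    show "near U \<subseteq> mspace m" by (auto simp: near_def)
    fix r
    let ?K = "(\<Union>f\<in>F'. oscillation_set m f r d) \<union> (\<Union>y\<in>?R. {x \<in> mspace m. mdist m y x \<le> r})"
    have "{x \<in> near U. \<exists>y\<in>mspace m - near U. mdist m x y \<le> r} \<subseteq> ?K"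
    proof
      fix x assume "x \<in> {x \<in> near U. \<exists>y\<in>mspace m - near U. mdist m x y \<le> r}"
      then obtain y where x: "x \<in> near U" and y: "y \<in> mspace m" "y \<notin> near U" "mdist m x y \<le> r" by blast
      have xm: "x \<in> mspace m" using x by (simp add: near_def)
      show "x \<in> ?K"
      proof (cases "y \<in> near ?V")
        case True
        then obtain f where "f \<in> F'" "d \<le> \<bar>f x - f y\<bar>" using disj[OF x] by blast
        then have "x \<in> oscillation_set m f r d" using xm y by (auto simp: oscillation_set_def)
        then show ?thesis using \<open>f \<in> F'\<close> by blast
      next
        case False
        then have "y \<in> ?R" using y by blast
        then show ?thesis using xm y(3) by (auto simp: mdist_commute)
      qed
    qed
    moreover have "finite ?K"
      using fin F' d finite_balls_mcball[OF _ m] higson_functions_finite_balls[OF m] by auto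
    ultimately show "finite {x \<in> near U. \<exists>y\<in>mspace m - near U. mdist m x y \<le> r}"
      by (rule finite_subset)
  qed
  let ?h = "set_indicator m (near U)"
  have h: "?h \<in> ?H" by (rule set_indicator_higson[OF m clopen])
  have ex: "\<exists>x\<in>mspace m. \<bar>?h x - q ?h\<bar> < 1 \<and> x \<in> higson_nbhd m q F' d" if "q \<in> corona_points m" for q
  proof -
    have "higson_nbhd m q (insert ?h F') d \<noteq> {}"
      using corona_pointsD[OF that, of "insert ?h F'" d] F' d h by auto
    then show ?thesis using d1 d by (fastforce simp: higson_nbhd_def)
  qed
  have "U = corona_part m (near U)"
  proof (intro equalityI subsetI)
    fix q assume q: "q \<in> U"
    then obtain x where x: "x \<in> mspace m" "\<bar>?h x - q ?h\<bar> < 1" "x \<in> higson_nbhd m q F' d"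
      using ex Usub by blast
    then have "x \<in> near U" using q by (auto simp: near_def)
    then have "q ?h \<noteq> 0" using x by (auto simp: set_indicator_simps)
    then show "q \<in> corona_part m (near U)"
      using set_indicator_limit[OF m clopen] q Usub by (auto simp: corona_part_def)
  next
    fix q assume q: "q \<in> corona_part m (near U)"
    then have qc: "q \<in> corona_points m" and q1: "q ?h = 1" by (auto simp: corona_part_def)
    show "q \<in> U"
    proof (rule ccontr)
      assume "q \<notin> U"
      obtain x where x: "x \<in> mspace m" "\<bar>?h x - q ?h\<bar> < 1" "x \<in> higson_nbhd m q F' d"
        using ex[OF qc] by blast
      then have "x \<in> near ?V" using qc \<open>q \<notin> U\<close> by (auto simp: near_def)
      then have "x \<notin> near U" using disj[of x x] d by auto
      then show False using x q1 by (auto simp: set_indicator_simps)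
    qed
  qed
  then show ?thesis using that clopen by blast
qed

section \<open>Coarse maps\<close>

text \<open>Between spaces with finite balls the finiteness of the fibres is properness.\<close>

definition coarse_map :: "'a metric \<Rightarrow> 'b metric \<Rightarrow> ('a \<Rightarrow> 'b) \<Rightarrow> bool" where
  "coarse_map m m' f \<longleftrightarrow> f ` mspace m \<subseteq> mspace m' \<and>
     (\<forall>y. finite {x \<in> mspace m. f x = y}) \<and>
     (\<forall>r. \<exists>s. \<forall>x\<in>mspace m. \<forall>y\<in>mspace m. mdist m x y \<le> r \<longrightarrow> mdist m' (f x) (f y) \<le> s)"

lemma coarse_map_vimage_finite:
  assumes "coarse_map m m' f" "finite B"
  shows "finite {x \<in> mspace m. f x \<in> B}"
proof -
  have "{x \<in> mspace m. f x \<in> B} = (\<Union>y\<in>B. {x \<in> mspace m. f x = y})" by blast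
  then show ?thesis using assms by (simp add: coarse_map_def)
qed

definition pullback :: "'a metric \<Rightarrow> ('a \<Rightarrow> 'b) \<Rightarrow> ('b \<Rightarrow> real) \<Rightarrow> 'a \<Rightarrow> real" where
  "pullback m f u = (\<lambda>x\<in>mspace m. u (f x))"

lemma pullback_higson:
  assumes m: "finite_balls m" and m': "finite_balls m'" and f: "coarse_map m m' f"
    and u: "u \<in> higson_functions m'"
  shows "pullback m f u \<in> higson_functions m"
  unfolding higson_functions_finite_balls[OF m]
proof (intro conjI allI impI)
  show "pullback m f u \<in> extensional (mspace m)" by (simp add: pullback_def)
  have "pullback m f u ` mspace m \<subseteq> u ` mspace m'"
    using f by (auto simp: pullback_def coarse_map_def)
  then show "bounded (pullback m f u ` mspace m)"
    using u unfolding higson_functions_finite_balls[OF m'] by (blast intro: bounded_subset)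
  fix r e :: real assume e: "0 < e"
  obtain s where s: "\<forall>x\<in>mspace m. \<forall>y\<in>mspace m. mdist m x y \<le> r \<longrightarrow> mdist m' (f x) (f y) \<le> s"
    using f unfolding coarse_map_def by blast
  have fm: "f x \<in> mspace m'" if "x \<in> mspace m" for x using f that by (auto simp: coarse_map_def)
  have "oscillation_set m (pullback m f u) r e \<subseteq> {x \<in> mspace m. f x \<in> oscillation_set m' u s e}"
  proof
    fix x assume "x \<in> oscillation_set m (pullback m f u) r e"
    then obtain y where "x \<in> mspace m" "y \<in> mspace m" "mdist m x y \<le> r" "e \<le> \<bar>u (f x) - u (f y)\<bar>"
      by (auto simp: oscillation_set_def pullback_def)
    then show "x \<in> {x \<in> mspace m. f x \<in> oscillation_set m' u s e}"
      using s fm unfolding oscillation_set_def by blast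
  qed
  moreover have "finite (oscillation_set m' u s e)"
    using u e unfolding higson_functions_finite_balls[OF m'] by blast
  ultimately show "finite (oscillation_set m (pullback m f u) r e)"
    using coarse_map_vimage_finite[OF f] by (meson finite_subset)
qed

text \<open>A coarse map pulls Higson functions back to Higson functions, and so acts on the coronas.\<close>

definition corona_map :: "'a metric \<Rightarrow> 'b metric \<Rightarrow> ('a \<Rightarrow> 'b) \<Rightarrow> (('a \<Rightarrow> real) \<Rightarrow> real) \<Rightarrow> (('b \<Rightarrow> real) \<Rightarrow> real)" where
  "corona_map m m' f q = (\<lambda>u\<in>higson_functions m'. q (pullback m f u))"

lemma corona_map_points:
  assumes m: "finite_balls m" and m': "finite_balls m'" and f: "coarse_map m m' f"
    and q: "q \<in> corona_points m"
  shows "corona_map m m' f q \<in> corona_points m'"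
  unfolding corona_points_def mem_Collect_eq
proof (intro conjI allI impI notI)
  show "corona_map m m' f q \<in> extensional (higson_functions m')" by (simp add: corona_map_def)
  fix F and e :: real
  assume F: "finite F" "F \<subseteq> higson_functions m'" "0 < e"
    and fin: "finite (higson_nbhd m' (corona_map m m' f q) F e)"
  have fm: "f x \<in> mspace m'" if "x \<in> mspace m" for x using f that by (auto simp: coarse_map_def)
  have "higson_nbhd m q (pullback m f ` F) e \<subseteq> {x \<in> mspace m. f x \<in> higson_nbhd m' (corona_map m m' f q) F e}"
  proof
    fix x assume x: "x \<in> higson_nbhd m q (pullback m f ` F) e"
    then have xm: "x \<in> mspace m" by (simp add: higson_nbhd_def)
    have "\<bar>u (f x) - corona_map m m' f q u\<bar> < e" if u: "u \<in> F" for u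
    proof -
      have "\<bar>pullback m f u x - q (pullback m f u)\<bar> < e" using x u by (simp add: higson_nbhd_def)
      then show ?thesis using xm u F(2) by (simp add: pullback_def corona_map_def subset_iff)
    qed
    then show "x \<in> {x \<in> mspace m. f x \<in> higson_nbhd m' (corona_map m m' f q) F e}"
      using xm fm by (simp add: higson_nbhd_def)
  qed
  then have "finite (higson_nbhd m q (pullback m f ` F) e)"
    using coarse_map_vimage_finite[OF f fin] by (rule finite_subset)
  moreover have "pullback m f ` F \<subseteq> higson_functions m"
    using F(2) pullback_higson[OF m m' f] by blast
  ultimately show False using corona_pointsD[OF q, of "pullback m f ` F" e] F by blast
qed

lemma continuous_corona_map:
  assumes m: "finite_balls m" and m': "finite_balls m'" and f: "coarse_map m m' f"
  shows "continuous_map (higson_corona m) (higson_corona m') (corona_map m m' f)"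
  unfolding higson_corona_eq[OF m'] continuous_map_in_subtopology
proof
  show "corona_map m m' f \<in> topspace (higson_corona m) \<rightarrow> corona_points m'"
    using corona_map_points[OF m m' f] by (simp add: topspace_higson_corona[OF m])
  have "continuous_map (real_product (higson_functions m)) (real_product (higson_functions m')) (corona_map m m' f)"
    unfolding corona_map_def continuous_map_componentwise
    by (auto intro!: continuous_map_product_projection pullback_higson[OF m m' f])
  then show "continuous_map (higson_corona m) (real_product (higson_functions m')) (corona_map m m' f)"
    unfolding higson_corona_eq[OF m] by (rule continuous_map_from_subtopology)
qed

text \<open>The maps induced by \<open>f\<close> and \<open>g\<close> are inverse to one another: a Higson function and its composition
  with a map at bounded distance from the identity have the same limits, and on the side of \<open>A\<close>
  only the distances within \<open>A\<close> count.\<close>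

lemma corona_part_homeomorphic:
  assumes m: "finite_balls m" and m': "finite_balls m'" and A: "coarsely_clopen m A"
    and f: "coarse_map m' m f" and g: "coarse_map m m' g"
    and fA: "f ` mspace m' \<subseteq> A" and gf: "\<And>n. n \<in> mspace m' \<Longrightarrow> g (f n) = n"
    and fg: "\<And>x. x \<in> A \<Longrightarrow> mdist m x (f (g x)) \<le> R"
  shows "subtopology (higson_corona m) (corona_part m A) homeomorphic_space higson_corona m'"
proof -
  let ?X = "subtopology (higson_corona m) (corona_part m A)"
  have Am: "A \<subseteq> mspace m" using A by (simp add: coarsely_clopen_def)
  have gm: "g x \<in> mspace m'" if "x \<in> mspace m" for x using g that by (auto simp: coarse_map_def)
  have fm: "f x \<in> mspace m" if "x \<in> mspace m'" for x using f that by (auto simp: coarse_map_def)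
  have topX: "topspace ?X = corona_part m A"
    by (auto simp: topspace_higson_corona[OF m] corona_part_def)
  have fpart: "corona_map m' m f q \<in> corona_part m A" if q: "q \<in> corona_points m'" for q
  proof -
    have p: "corona_map m' m f q \<in> corona_points m" by (rule corona_map_points[OF m' m f q])
    have h: "set_indicator m A \<in> higson_functions m" by (rule set_indicator_higson[OF m A])
    have "higson_nbhd m' q {pullback m' f (set_indicator m A)} 1 \<noteq> {}"
      using corona_pointsD[OF q, of "{pullback m' f (set_indicator m A)}" 1]
        pullback_higson[OF m' m f h] by (simp add: infinite_imp_nonempty)
    then obtain n where n: "n \<in> mspace m'" "\<bar>set_indicator m A (f n) - q (pullback m' f (set_indicator m A))\<bar> < 1"
      by (auto simp: higson_nbhd_def pullback_def)
    have "set_indicator m A (f n) = 1" using n(1) fA fm by (auto simp: set_indicator_simps)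
    then have "corona_map m' m f q (set_indicator m A) \<noteq> 0"
      using n(2) h by (simp add: corona_map_def)
    then show ?thesis using set_indicator_limit[OF m A p] p by (simp add: corona_part_def)
  qed
  have 1: "corona_map m m' g (corona_map m' m f q) = q" if q: "q \<in> corona_points m'" for q
  proof (rule extensionalityI)
    show "corona_map m m' g (corona_map m' m f q) \<in> extensional (higson_functions m')"
      by (simp add: corona_map_def)
    show "q \<in> extensional (higson_functions m')" using q by (simp add: corona_points_def)
    fix u assume u: "u \<in> higson_functions m'"
    then have ue: "u \<in> extensional (mspace m')" by (simp add: higson_functions_def)
    have "pullback m' f (pullback m g u) = u"
      by (rule extensionalityI[OF _ ue]) (simp_all add: pullback_def fm gf)
    then show "corona_map m m' g (corona_map m' m f q) u = q u"
      using u pullback_higson[OF m m' g u] by (simp add: corona_map_def)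
  qed
  have 2: "corona_map m' m f (corona_map m m' g q) = q" if q: "q \<in> corona_part m A" for q
  proof (rule extensionalityI)
    have qc: "q \<in> corona_points m" and q1: "q (set_indicator m A) = 1" using q by (simp_all add: corona_part_def)
    show "corona_map m' m f (corona_map m m' g q) \<in> extensional (higson_functions m)"
      by (simp add: corona_map_def)
    show "q \<in> extensional (higson_functions m)" using qc by (simp add: corona_points_def)
    fix u assume u: "u \<in> higson_functions m"
    let ?v = "pullback m g (pullback m' f u)"
    have v: "?v \<in> higson_functions m"
      by (intro pullback_higson[OF m m' g] pullback_higson[OF m' m f] u)
    have "q ?v = q u"
    proof (rule corona_point_agree[OF qc v u set_indicator_higson[OF m A]])
      fix d :: real assume d: "0 < d"
      have "{x \<in> mspace m. \<bar>set_indicator m A x - q (set_indicator m A)\<bar> < 1 \<and> d \<le> \<bar>?v x - u x\<bar>}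
          \<subseteq> oscillation_set m u R d"
      proof
        fix x assume "x \<in> {x \<in> mspace m. \<bar>set_indicator m A x - q (set_indicator m A)\<bar> < 1 \<and> d \<le> \<bar>?v x - u x\<bar>}"
        then have x: "x \<in> mspace m" "\<bar>set_indicator m A x - 1\<bar> < 1" "d \<le> \<bar>?v x - u x\<bar>"
          by (simp_all add: q1)
        have "x \<in> A" using x(1,2) by (simp add: set_indicator_simps split: if_splits)
        then have "mdist m x (f (g x)) \<le> R" by (rule fg)
        moreover have "d \<le> \<bar>u x - u (f (g x))\<bar>"
          using x gm by (simp add: pullback_def abs_minus_commute)
        ultimately show "x \<in> oscillation_set m u R d"
          using x(1) fm[OF gm[OF x(1)]] unfolding oscillation_set_def by blast
      qed
      moreover have "finite (oscillation_set m u R d)"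
        using u d unfolding higson_functions_finite_balls[OF m] by blast
      ultimately show "finite {x \<in> mspace m. \<bar>set_indicator m A x - q (set_indicator m A)\<bar> < 1 \<and> d \<le> \<bar>?v x - u x\<bar>}"
        by (rule finite_subset)
    qed
    then show "corona_map m' m f (corona_map m m' g q) u = q u"
      using u pullback_higson[OF m' m f u] by (simp add: corona_map_def)
  qed
  have "homeomorphic_maps ?X (higson_corona m') (corona_map m m' g) (corona_map m' m f)"
    unfolding homeomorphic_maps_def
  proof (intro conjI ballI)
    show "continuous_map ?X (higson_corona m') (corona_map m m' g)"
      by (rule continuous_map_from_subtopology[OF continuous_corona_map[OF m m' g]])
    show "continuous_map (higson_corona m') ?X (corona_map m' m f)"
      using continuous_corona_map[OF m' m f] fpart
      by (simp add: continuous_map_in_subtopology topspace_higson_corona[OF m'])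
  qed (simp_all add: topX 1 2 topspace_higson_corona[OF m'])
  then show ?thesis unfolding homeomorphic_space_def by blast
qed

lemma homeomorphic_space_clopen_sum:
  assumes U: "openin X U" and V: "openin X (topspace X - U)"
  shows "X homeomorphic_space sum_topology (\<lambda>b. subtopology X (if b then U else topspace X - U)) UNIV"
proof -
  let ?Y = "\<lambda>b. subtopology X (if b then U else topspace X - U)"
  have US: "U \<subseteq> topspace X" by (rule openin_subset[OF U])
  have "homeomorphic_maps X (sum_topology ?Y UNIV) (\<lambda>x. (x \<in> U, x)) snd"
    unfolding homeomorphic_maps_def
  proof (intro conjI ballI)
    show "continuous_map X (sum_topology ?Y UNIV) (\<lambda>x. (x \<in> U, x))"
      unfolding continuous_map_def
    proof (intro conjI allI impI)
      show "(\<lambda>x. (x \<in> U, x)) \<in> topspace X \<rightarrow> topspace (sum_topology ?Y UNIV)"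
        using US by auto
      fix W assume "openin (sum_topology ?Y UNIV) W"
      then have W: "openin (?Y b) {x. (b, x) \<in> W}" for b by (simp add: openin_sum_topology)
      have op: "openin X {x. (b, x) \<in> W}" for b
        by (rule openin_trans_full[OF W]) (use U V in simp)
      have sub: "{x. (b, x) \<in> W} \<subseteq> topspace (?Y b)" for b by (rule openin_subset[OF W])
      have "{x \<in> topspace X. (x \<in> U, x) \<in> W} = {x. (True, x) \<in> W} \<union> {x. (False, x) \<in> W}"
      proof (intro equalityI subsetI)
        fix x assume "x \<in> {x \<in> topspace X. (x \<in> U, x) \<in> W}"
        then show "x \<in> {x. (True, x) \<in> W} \<union> {x. (False, x) \<in> W}" by (cases "x \<in> U") simp_all
      next
        fix x assume "x \<in> {x. (True, x) \<in> W} \<union> {x. (False, x) \<in> W}"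
        then show "x \<in> {x \<in> topspace X. (x \<in> U, x) \<in> W}"
          using subsetD[OF sub[of True], of x] subsetD[OF sub[of False], of x] by auto
      qed
      then show "openin X {x \<in> topspace X. (x \<in> U, x) \<in> W}" using op by (simp add: openin_Un)
    qed
    show "continuous_map (sum_topology ?Y UNIV) X snd"
      unfolding continuous_map_def
    proof (intro conjI allI impI)
      show "snd \<in> topspace (sum_topology ?Y UNIV) \<rightarrow> topspace X" by auto
      fix W assume W: "openin X W"
      show "openin (sum_topology ?Y UNIV) {x \<in> topspace (sum_topology ?Y UNIV). snd x \<in> W}"
        unfolding openin_sum_topology
      proof (intro conjI ballI)
        fix b :: bool
        have "{x. (b, x) \<in> {x \<in> topspace (sum_topology ?Y UNIV). snd x \<in> W}} = W \<inter> (if b then U else topspace X - U)"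
          using openin_subset[OF W] by auto
        then show "openin (?Y b) {x. (b, x) \<in> {x \<in> topspace (sum_topology ?Y UNIV). snd x \<in> W}}"
          using W by (auto simp: openin_subtopology)
      qed auto
    qed
  qed (use US in \<open>auto split: if_splits\<close>)
  then show ?thesis unfolding homeomorphic_space_def by blast
qed

lemma coarsely_clopen_complement:
  assumes m: "finite_balls m" and A: "coarsely_clopen m A"
  shows "coarsely_clopen m (mspace m - A)"
  unfolding coarsely_clopen_def
proof (intro conjI allI)
  fix r
  let ?B = "{x \<in> A. \<exists>y\<in>mspace m - A. mdist m x y \<le> r}"
  have Am: "A \<subseteq> mspace m" using A by (simp add: coarsely_clopen_def)
  have "{x \<in> mspace m - A. \<exists>y\<in>mspace m - (mspace m - A). mdist m x y \<le> r} \<subseteq>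
      (\<Union>y\<in>?B. {x \<in> mspace m. mdist m y x \<le> r})"
  proof
    fix x assume "x \<in> {x \<in> mspace m - A. \<exists>y\<in>mspace m - (mspace m - A). mdist m x y \<le> r}"
    then obtain y where xy: "x \<in> mspace m - A" "y \<in> A" "mdist m y x \<le> r"
      by (auto simp: mdist_commute)
    then have "y \<in> ?B" by blast
    then show "x \<in> (\<Union>y\<in>?B. {x \<in> mspace m. mdist m y x \<le> r})" using xy by blast
  qed
  moreover have "finite (\<Union>y\<in>?B. {x \<in> mspace m. mdist m y x \<le> r})"
    using A Am finite_balls_mcball[OF _ m] by (auto simp: coarsely_clopen_def)
  ultimately show "finite {x \<in> mspace m - A. \<exists>y\<in>mspace m - (mspace m - A). mdist m x y \<le> r}"
    by (rule finite_subset)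
qed simp

lemma corona_part_complement:
  assumes m: "finite_balls m" and A: "coarsely_clopen m A"
  shows "corona_part m (mspace m - A) = corona_points m - corona_part m A"
proof -
  let ?f = "set_indicator m A" and ?g = "set_indicator m (mspace m - A)"
  have A': "coarsely_clopen m (mspace m - A)" by (rule coarsely_clopen_complement[OF m A])
  have "q ?f = 1 \<or> q ?g = 1" if q: "q \<in> corona_points m" for q
  proof -
    have "higson_nbhd m q {?f, ?g} 1 \<noteq> {}"
      using corona_pointsD[OF q, of "{?f, ?g}" 1] set_indicator_higson[OF m] A A'
      by (simp add: infinite_imp_nonempty)
    then obtain x where "x \<in> mspace m" "\<bar>?f x - q ?f\<bar> < 1" "\<bar>?g x - q ?g\<bar> < 1"
      by (auto simp: higson_nbhd_def)
    then have "q ?f \<noteq> 0 \<or> q ?g \<noteq> 0" by (auto simp: set_indicator_simps split: if_splits)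
    then show ?thesis using set_indicator_limit[OF m A q] set_indicator_limit[OF m A' q] by blast
  qed
  then have "corona_points m \<subseteq> corona_part m A \<union> corona_part m (mspace m - A)"
    unfolding corona_part_def by blast
  moreover have "corona_part m A \<union> corona_part m (mspace m - A) \<subseteq> corona_points m"
    unfolding corona_part_def by blast
  moreover have "corona_part m A \<inter> corona_part m (mspace m - A) = {}"
    using A by (intro corona_part_disjoint[OF m A A']) blast
  ultimately show ?thesis by blast
qed

section \<open>Accumulation points of subsets and separation\<close>

text \<open>The trace on the corona of the closure of the set in the Higson compactification.\<close>

definition corona_closure :: "'a metric \<Rightarrow> 'a set \<Rightarrow> (('a \<Rightarrow> real) \<Rightarrow> real) set" where
  "corona_closure m C = {q \<in> corona_points m.
     \<forall>F e. finite F \<longrightarrow> F \<subseteq> higson_functions m \<longrightarrow> 0 < e \<longrightarrow> infinite (C \<inter> higson_nbhd m q F e)}"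

lemma corona_closureD:
  "q \<in> corona_closure m C \<Longrightarrow> finite F \<Longrightarrow> F \<subseteq> higson_functions m \<Longrightarrow> 0 < e \<Longrightarrow>
    infinite (C \<inter> higson_nbhd m q F e)"
  by (simp add: corona_closure_def)

lemma corona_closure_points: "q \<in> corona_closure m C \<Longrightarrow> q \<in> corona_points m"
  by (simp add: corona_closure_def)

lemma corona_closure_nonempty:
  assumes "finite_balls m" "C \<subseteq> mspace m" "infinite C"
  obtains q where "q \<in> corona_closure m C"
proof -
  obtain q where "q \<in> corona_points m"
    "\<And>F e. finite F \<Longrightarrow> F \<subseteq> higson_functions m \<Longrightarrow> 0 < e \<Longrightarrow> infinite (C \<inter> higson_nbhd m q F e)"
    using infinite_set_accumulates[OF assms] by blast
  then have "q \<in> corona_closure m C" by (simp add: corona_closure_def)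
  then show ?thesis by (rule that)
qed

lemma corona_closure_mono:
  assumes "C \<subseteq> D" "q \<in> corona_closure m C"
  shows "q \<in> corona_closure m D"
  unfolding corona_closure_def mem_Collect_eq
proof (intro conjI allI impI)
  show "q \<in> corona_points m" using assms(2) by (rule corona_closure_points)
  fix F and e :: real assume F: "finite F" "F \<subseteq> higson_functions m" "0 < e"
  have "C \<inter> higson_nbhd m q F e \<subseteq> D \<inter> higson_nbhd m q F e" using assms(1) by blast
  then show "infinite (D \<inter> higson_nbhd m q F e)"
    using corona_closureD[OF assms(2) F] by (meson finite_subset)
qed

lemma corona_closure_Un:
  assumes q: "q \<in> corona_closure m (C \<union> D)"
  shows "q \<in> corona_closure m C \<or> q \<in> corona_closure m D"
proof (rule ccontr)
  assume n: "\<not> ?thesis"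
  have qc: "q \<in> corona_points m" using q by (rule corona_closure_points)
  obtain F e where F: "finite F" "F \<subseteq> higson_functions m" "0 < e" "finite (C \<inter> higson_nbhd m q F e)"
    using n qc unfolding corona_closure_def by blast
  obtain F' e' where F': "finite F'" "F' \<subseteq> higson_functions m" "0 < e'" "finite (D \<inter> higson_nbhd m q F' e')"
    using n qc unfolding corona_closure_def by blast
  let ?N = "higson_nbhd m q (F \<union> F') (min e e')"
  have "?N \<subseteq> higson_nbhd m q F e" "?N \<subseteq> higson_nbhd m q F' e'"
    by (rule higson_nbhd_mono; simp)+
  then have "(C \<union> D) \<inter> ?N \<subseteq> (C \<inter> higson_nbhd m q F e) \<union> (D \<inter> higson_nbhd m q F' e')" by blast
  then have "finite ((C \<union> D) \<inter> ?N)" using F(4) F'(4) by (meson finite_UnI finite_subset)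
  then show False using corona_closureD[OF q, of "F \<union> F'" "min e e'"] F F' by simp
qed

lemma corona_closure_mspace: "q \<in> corona_points m \<Longrightarrow> q \<in> corona_closure m (mspace m)"
proof -
  assume q: "q \<in> corona_points m"
  have "mspace m \<inter> higson_nbhd m q F e = higson_nbhd m q F e" for F e
    by (auto simp: higson_nbhd_def)
  then show ?thesis using q unfolding corona_closure_def by (simp add: corona_points_def)
qed

lemma corona_closure_limit:
  assumes q: "q \<in> corona_closure m C" and f: "f \<in> higson_functions m"
    and lim: "\<And>d. 0 < d \<Longrightarrow> finite {x \<in> C. d \<le> \<bar>f x - c\<bar>}"
  shows "q f = c"
proof (rule ccontr)
  assume "q f \<noteq> c"
  then have d: "0 < \<bar>q f - c\<bar> / 2" by simp
  have "C \<inter> higson_nbhd m q {f} (\<bar>q f - c\<bar> / 2) \<subseteq> {x \<in> C. \<bar>q f - c\<bar> / 2 \<le> \<bar>f x - c\<bar>}"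
  proof
    fix x assume "x \<in> C \<inter> higson_nbhd m q {f} (\<bar>q f - c\<bar> / 2)"
    then have "x \<in> C" "\<bar>f x - q f\<bar> < \<bar>q f - c\<bar> / 2" by (simp_all add: higson_nbhd_def)
    moreover have "\<bar>q f - c\<bar> \<le> \<bar>f x - q f\<bar> + \<bar>f x - c\<bar>"
      using abs_triangle_ineq[of "q f - f x" "f x - c"] by (simp add: abs_minus_commute)
    ultimately have "x \<in> C" "\<bar>q f - c\<bar> / 2 \<le> \<bar>f x - c\<bar>" by simp_all
    then show "x \<in> {x \<in> C. \<bar>q f - c\<bar> / 2 \<le> \<bar>f x - c\<bar>}" by simp
  qed
  then have "finite (C \<inter> higson_nbhd m q {f} (\<bar>q f - c\<bar> / 2))"
    using lim[OF d] by (rule finite_subset)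
  then show False using corona_closureD[OF q _ _ d, of "{f}"] f by simp
qed

lemma corona_closure_nbhd:
  assumes q: "q \<in> corona_closure m (higson_nbhd m p F e)" and f: "f \<in> F" "F \<subseteq> higson_functions m"
  shows "\<bar>q f - p f\<bar> \<le> e"
proof (rule ccontr)
  assume n: "\<not> ?thesis"
  then have d: "0 < \<bar>q f - p f\<bar> - e" by simp
  have "higson_nbhd m p F e \<inter> higson_nbhd m q {f} (\<bar>q f - p f\<bar> - e) \<noteq> {}"
    using corona_closureD[OF q _ _ d, of "{f}"] f by auto
  then obtain x where "\<bar>f x - p f\<bar> < e" "\<bar>f x - q f\<bar> < \<bar>q f - p f\<bar> - e"
    using f(1) by (auto simp: higson_nbhd_def)
  then show False by linarith
qed

text \<open>Sets that diverge from one another are separated by a Higson function: with \<open>a\<close> and \<open>b\<close> the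
  distances to the two sets, the function \<open>a / (a + b)\<close> varies by at most \<open>r / (a + b)\<close> over the
  distance \<open>r\<close>, and \<open>a + b\<close> tends to infinity.\<close>

lemma divergent_sets_separated:
  assumes m: "finite_balls m" and D1: "D1 \<subseteq> mspace m" and D2: "D2 \<subseteq> mspace m"
    and div: "\<And>r. finite {x \<in> D1. \<exists>y\<in>D2. mdist m x y \<le> r}"
  obtains f where "f \<in> higson_functions m" "\<And>x. x \<in> D1 \<Longrightarrow> f x = 0" "finite {x \<in> D2. f x \<noteq> 1}"
proof (cases "D1 = {} \<or> D2 = {}")
  case True
  have "bounded ((\<lambda>x\<in>mspace m. c) ` mspace m)" for c :: real
    by (rule bounded_subset[of "{c}"]) auto
  moreover have "oscillation_set m (\<lambda>x\<in>mspace m. c) r e = {}" if "0 < e" for c r e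
    using that by (simp add: oscillation_set_def)
  ultimately have const: "(\<lambda>x\<in>mspace m. c) \<in> higson_functions m" for c :: real
    unfolding higson_functions_finite_balls[OF m] by simp
  show ?thesis
  proof (cases "D1 = {}")
    case True
    have "{x \<in> D2. (\<lambda>x\<in>mspace m. 1 :: real) x \<noteq> 1} = {}" using D2 by auto
    then show ?thesis by (intro that[OF const[of 1]]) (simp_all only: True empty_iff finite.emptyI)
  next
    case False
    then have "D2 = {}" using \<open>D1 = {} \<or> D2 = {}\<close> by simp
    moreover have "(\<lambda>x\<in>mspace m. 0 :: real) x = 0" if "x \<in> D1" for x using D1 that by auto
    ultimately show ?thesis by (intro that[OF const[of 0]]) simp_all
  qed
next
  case False
  define a where "a D x = Inf (mdist m x ` D)" for D x
  have bdd: "bdd_below (mdist m x ` D)" for x D by (rule bdd_belowI[of _ 0]) auto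
  have a0: "0 \<le> a D x" if "D \<noteq> {}" for D x
    unfolding a_def using that by (intro cInf_greatest) auto
  have a_le: "a D x \<le> mdist m x y" if "y \<in> D" for D x y
    unfolding a_def using that bdd by (intro cInf_lower) auto
  have a_mem: "a D x = 0" if "x \<in> D" "x \<in> mspace m" for D x
    using a_le[OF that(1), of x] a0[of D x] that by (auto simp: mdist_refl)
  have a_near: "\<exists>y\<in>D. mdist m x y \<le> r + 1" if "a D x \<le> r" "D \<noteq> {}" for D x r
  proof -
    have "mdist m x ` D \<noteq> {}" using that(2) by simp
    moreover have "Inf (mdist m x ` D) < r + 1" using that(1) unfolding a_def by linarith
    ultimately obtain z where "z \<in> mdist m x ` D" "z < r + 1"
      by (meson cInf_lessD)
    then obtain y where "y \<in> D" "mdist m x y < r + 1" by blast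
    then show ?thesis by (intro bexI[of _ y]) linarith+
  qed
  have a_lip: "a D x \<le> a D y + mdist m x y" if "D \<subseteq> mspace m" "D \<noteq> {}" "x \<in> mspace m" "y \<in> mspace m" for D x y
  proof -
    have "a D x - mdist m x y \<le> a D y"
      unfolding a_def[of D y]
    proof (rule cInf_greatest)
      show "mdist m y ` D \<noteq> {}" using that by simp
      fix t assume "t \<in> mdist m y ` D"
      then obtain z where z: "z \<in> D" "t = mdist m y z" by blast
      have "mdist m x z \<le> mdist m x y + mdist m y z"
        using subsetD[OF that(1) z(1)] that(3,4) by (intro mdist_triangle)
      then show "a D x - mdist m x y \<le> t" using a_le[OF z(1), of x] z(2) by linarith
    qed
    then show ?thesis by linarith
  qed
  have ne: "D1 \<noteq> {}" "D2 \<noteq> {}" using False by auto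
  define w where "w x = a D1 x + a D2 x" for x
  have w_fin: "finite {x \<in> mspace m. w x \<le> r}" for r
  proof -
    let ?E = "{x \<in> D1. \<exists>y\<in>D2. mdist m x y \<le> 2 * (r + 1)}"
    have sub: "{x \<in> mspace m. w x \<le> r} \<subseteq> (\<Union>y\<in>?E. {x \<in> mspace m. mdist m y x \<le> r + 1})"
    proof
      fix x assume "x \<in> {x \<in> mspace m. w x \<le> r}"
      then have x: "x \<in> mspace m" "a D1 x + a D2 x \<le> r" by (simp_all add: w_def)
      have ar: "a D1 x \<le> r" "a D2 x \<le> r" using x(2) a0[OF ne(1), of x] a0[OF ne(2), of x] by linarith+
      obtain y where y: "y \<in> D1" "mdist m x y \<le> r + 1" using a_near[OF ar(1) ne(1)] ..
      obtain z where z: "z \<in> D2" "mdist m x z \<le> r + 1" using a_near[OF ar(2) ne(2)] ..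
      note yz = y z
      have "mdist m y z \<le> mdist m y x + mdist m x z"
        using subsetD[OF D1 yz(1)] subsetD[OF D2 yz(3)] x(1) by (intro mdist_triangle)
      then have "mdist m y z \<le> 2 * (r + 1)" using yz by (simp add: mdist_commute)
      then have "y \<in> ?E" using yz by blast
      then show "x \<in> (\<Union>y\<in>?E. {x \<in> mspace m. mdist m y x \<le> r + 1})"
        using x(1) yz(2) mdist_commute[of m x y] by auto
    qed
    have fin: "finite (\<Union>y\<in>?E. {x \<in> mspace m. mdist m y x \<le> r + 1})"
    proof (rule finite_UN_I[OF div])
      fix y assume "y \<in> ?E"
      then have "y \<in> mspace m" using D1 by blast
      then show "finite {x \<in> mspace m. mdist m y x \<le> r + 1}" by (rule finite_balls_mcball[OF _ m])
    qed
    show ?thesis by (rule finite_subset[OF sub fin])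
  qed
  define f where "f = (\<lambda>x\<in>mspace m. a D1 x / w x)"
  have f01: "0 \<le> f x \<and> f x \<le> 1" if "x \<in> mspace m" for x
  proof -
    have "0 \<le> a D1 x" "a D1 x \<le> w x" using a0[OF ne(1), of x] a0[OF ne(2), of x] by (simp_all add: w_def)
    then show ?thesis using that by (cases "w x = 0") (auto simp: f_def divide_le_eq_1)
  qed
  have f_osc: "\<bar>f x - f y\<bar> \<le> r / w x"
    if x: "x \<in> mspace m" and y: "y \<in> mspace m" and xy: "mdist m x y \<le> r" and w: "0 < w x" "0 < w y" for x y r
  proof -
    let ?a = "a D1 x" and ?b = "a D2 x" and ?c = "a D1 y" and ?d = "a D2 y"
    have 1: "\<bar>?a - ?c\<bar> \<le> r" "\<bar>?d - ?b\<bar> \<le> r"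
      using a_lip[OF D1 ne(1) x y] a_lip[OF D1 ne(1) y x] a_lip[OF D2 ne(2) x y] a_lip[OF D2 ne(2) y x] xy
        mdist_commute[of m x y] by linarith+
    have 2: "0 \<le> ?c" "0 \<le> ?d" using a0 ne by blast+
    have "f x - f y = ((?a - ?c) * ?d + ?c * (?d - ?b)) / (w x * w y)"
      using x y w by (simp add: f_def diff_frac_eq) (simp add: w_def algebra_simps)
    moreover have "\<bar>(?a - ?c) * ?d + ?c * (?d - ?b)\<bar> \<le> r * w y"
    proof -
      have "\<bar>(?a - ?c) * ?d\<bar> \<le> r * ?d" using 1(1) 2(2) by (simp add: abs_mult mult_right_mono)
      moreover have "\<bar>?c * (?d - ?b)\<bar> \<le> ?c * r" using 1(2) 2(1) by (simp add: abs_mult mult_left_mono)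
      ultimately show ?thesis unfolding w_def by (simp add: algebra_simps)
    qed
    moreover have "0 < w x * w y" using w by simp
    ultimately have "\<bar>f x - f y\<bar> \<le> (r * w y) / (w x * w y)"
      by (simp only: abs_divide abs_of_pos) (rule divide_right_mono, assumption, rule less_imp_le)
    then show ?thesis using w by simp
  qed
  have 1: "f \<in> higson_functions m"
    unfolding higson_functions_finite_balls[OF m]
  proof (intro conjI allI impI)
    show "f \<in> extensional (mspace m)" by (simp add: f_def)
    have "f ` mspace m \<subseteq> {0..1}" using f01 by auto
    then show "bounded (f ` mspace m)" using bounded_closed_interval by (rule bounded_subset[rotated])
    fix r e :: real assume e: "0 < e"
    let ?K = "{x \<in> mspace m. w x \<le> \<bar>r\<bar> / e} \<union> (\<Union>y\<in>{x \<in> mspace m. w x \<le> 0}. {x \<in> mspace m. mdist m y x \<le> r})"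
    have sub: "oscillation_set m f r e \<subseteq> ?K"
    proof
      fix x assume "x \<in> oscillation_set m f r e"
      then obtain y where xy: "x \<in> mspace m" "y \<in> mspace m" "mdist m x y \<le> r" "e \<le> \<bar>f x - f y\<bar>"
        by (auto simp: oscillation_set_def)
      show "x \<in> ?K"
      proof (cases "0 < w y \<and> 0 < w x")
        case True
        then have "e \<le> r / w x" using f_osc[OF xy(1-3)] xy(4) by linarith
        then have "w x \<le> r / e" using True e by (simp add: field_simps)
        also have "\<dots> \<le> \<bar>r\<bar> / e" using e by (intro divide_right_mono) auto
        finally show ?thesis using xy(1) by blast
      next
        case False
        then consider "w y \<le> 0" | "w x \<le> 0" by linarith
        then show ?thesis
        proof cases
          case 1
          moreover have "mdist m y x \<le> r" using xy(3) by (simp add: mdist_commute)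
          ultimately show ?thesis using xy(1,2) by blast
        next
          case 2
          have "0 \<le> \<bar>r\<bar> / e" using e by simp
          then have "w x \<le> \<bar>r\<bar> / e" using 2 by linarith
          then show ?thesis using xy(1) by blast
        qed
      qed
    qed
    have fin: "finite ?K"
    proof (intro finite_UnI w_fin finite_UN_I)
      fix y assume "y \<in> {x \<in> mspace m. w x \<le> 0}"
      then show "finite {x \<in> mspace m. mdist m y x \<le> r}" by (intro finite_balls_mcball[OF _ m]) simp
    qed
    show "finite (oscillation_set m f r e)" by (rule finite_subset[OF sub fin])
  qed
  have 2: "f x = 0" if "x \<in> D1" for x
  proof -
    have "x \<in> mspace m" using that D1 by blast
    then show ?thesis using a_mem[OF that] by (simp add: f_def)
  qed
  have 3: "finite {x \<in> D2. f x \<noteq> 1}"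
  proof (rule finite_subset[OF _ w_fin[of 0]])
    show "{x \<in> D2. f x \<noteq> 1} \<subseteq> {x \<in> mspace m. w x \<le> 0}"
    proof
      fix x assume "x \<in> {x \<in> D2. f x \<noteq> 1}"
      then have x: "x \<in> D2" "x \<in> mspace m" "f x \<noteq> 1" using D2 by auto
      then have "w x = a D1 x" using a_mem[of x D2] by (simp add: w_def)
      then have "w x = 0" using x by (cases "a D1 x = 0") (simp_all add: f_def)
      then show "x \<in> {x \<in> mspace m. w x \<le> 0}" using x(2) by simp
    qed
  qed
  show ?thesis by (rule that[OF 1 2 3])
qed

corollary divergent_sets_limits:
  assumes m: "finite_balls m" and D: "D1 \<subseteq> mspace m" "D2 \<subseteq> mspace m"
    "\<And>r. finite {x \<in> D1. \<exists>y\<in>D2. mdist m x y \<le> r}"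
  obtains f where "f \<in> higson_functions m" "\<And>q. q \<in> corona_closure m D1 \<Longrightarrow> q f = 0"
    "\<And>q. q \<in> corona_closure m D2 \<Longrightarrow> q f = 1"
proof -
  obtain f where f: "f \<in> higson_functions m" "\<And>x. x \<in> D1 \<Longrightarrow> f x = 0" "finite {x \<in> D2. f x \<noteq> 1}"
    by (rule divergent_sets_separated[OF m D]) blast
  show ?thesis
  proof (rule that[OF f(1)])
    fix q assume q: "q \<in> corona_closure m D1"
    show "q f = 0"
    proof (rule corona_closure_limit[OF q f(1)])
      fix d :: real assume "0 < d"
      then have "{x \<in> D1. d \<le> \<bar>f x - 0\<bar>} = {}" using f(2) by auto
      then show "finite {x \<in> D1. d \<le> \<bar>f x - 0\<bar>}" by (simp only: finite.emptyI)
    qed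
  next
    fix q assume q: "q \<in> corona_closure m D2"
    show "q f = 1"
    proof (rule corona_closure_limit[OF q f(1)])
      fix d :: real assume "0 < d"
      then have "{x \<in> D2. d \<le> \<bar>f x - 1\<bar>} \<subseteq> {x \<in> D2. f x \<noteq> 1}" by auto
      then show "finite {x \<in> D2. d \<le> \<bar>f x - 1\<bar>}" using f(3) by (rule finite_subset)
    qed
  qed
qed

section \<open>The Higson corona of the natural numbers\<close>

lemma finite_balls_nat: "finite_balls nat_metric"
  unfolding finite_balls_def mcball_of_eq nat_metric_simps
proof (intro ballI allI)
  fix x :: nat and r :: real
  have "{y. x \<in> UNIV \<and> y \<in> UNIV \<and> \<bar>real x - real y\<bar> \<le> r} \<subseteq> {..nat \<lceil>real x + r\<rceil>}"
  proof
    fix y assume "y \<in> {y. x \<in> UNIV \<and> y \<in> UNIV \<and> \<bar>real x - real y\<bar> \<le> r}"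
    then have "\<bar>real x - real y\<bar> \<le> r" by simp
    then have "real y \<le> real x + r" by linarith
    then show "y \<in> {..nat \<lceil>real x + r\<rceil>}" by (simp add: le_nat_iff) linarith
  qed
  then show "finite {y. x \<in> UNIV \<and> y \<in> UNIV \<and> \<bar>real x - real y\<bar> \<le> r}"
    by (rule finite_subset) simp
qed

text \<open>The boundary of a coarsely clopen set of natural numbers at scale 1 is finite, so that the set is
  finite or cofinite.\<close>

lemma connected_nat_corona: "connected_space (higson_corona nat_metric)"
  unfolding connected_space_clopen_in
proof (intro allI impI)
  fix U assume U: "openin (higson_corona nat_metric) U \<and> closedin (higson_corona nat_metric) U"
  have top: "topspace (higson_corona nat_metric) = corona_points nat_metric"
    by (rule topspace_higson_corona[OF finite_balls_nat])
  have "openin (higson_corona nat_metric) (corona_points nat_metric - U)"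
    using conjunct2[OF U] unfolding closedin_def top by simp
  then obtain A where A: "coarsely_clopen nat_metric A" "U = corona_part nat_metric A"
    using clopen_subset_corona[OF finite_balls_nat conjunct1[OF U]] by blast
  have "finite {x \<in> A. \<exists>y\<in>UNIV - A. \<bar>real x - real y\<bar> \<le> 1}"
    using A(1) unfolding coarsely_clopen_def nat_metric_simps by simp
  then obtain N where N: "\<And>x. x \<in> {x \<in> A. \<exists>y\<in>UNIV - A. \<bar>real x - real y\<bar> \<le> 1} \<Longrightarrow> x < N"
    unfolding finite_nat_set_iff_bounded by blast
  have step: "Suc n \<in> A" if "n \<in> A" "N \<le> n" for n
  proof (rule ccontr)
    assume "Suc n \<notin> A"
    moreover have "\<bar>real n - real (Suc n)\<bar> \<le> 1" by simp
    ultimately have "n \<in> {x \<in> A. \<exists>y\<in>UNIV - A. \<bar>real x - real y\<bar> \<le> 1}" using that(1) by blast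
    then show False using N[of n] that(2) by simp
  qed
  have "finite A \<or> finite (UNIV - A)"
  proof (cases "\<exists>n\<in>A. N \<le> n")
    case True
    then obtain n where n: "n \<in> A" "N \<le> n" by blast
    have "k \<in> A" if "n \<le> k" for k
      using that by (induction k rule: dec_induct) (use n step in auto)
    then have "UNIV - A \<subseteq> {..<n}" by (auto simp: not_le[symmetric])
    then show ?thesis using finite_subset by blast
  next
    case False
    then have "A \<subseteq> {..<N}" by (auto simp: not_le)
    then show ?thesis using finite_subset by blast
  qed
  then show "U = {} \<or> U = topspace (higson_corona nat_metric)"
  proof
    assume "finite A"
    then show ?thesis using corona_part_nonempty_iff[OF finite_balls_nat A(1)] A(2) by simp
  next
    assume "finite (UNIV - A)"
    then have "corona_part nat_metric (mspace nat_metric - A) = {}"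
      using corona_part_nonempty_iff[OF finite_balls_nat coarsely_clopen_complement[OF finite_balls_nat A(1)]]
      by (simp add: nat_metric_simps)
    then have "corona_points nat_metric - U = {}"
      using corona_part_complement[OF finite_balls_nat A(1)] A(2) by simp
    moreover have "U \<subseteq> corona_points nat_metric" unfolding A(2) corona_part_def by simp
    ultimately show ?thesis unfolding top by simp
  qed
qed

lemma continuum_nat_corona: "continuum (higson_corona nat_metric)"
  unfolding continuum_def
proof (intro conjI)
  show "topspace (higson_corona nat_metric) \<noteq> {}"
    unfolding topspace_higson_corona[OF finite_balls_nat]
    by (rule higson_corona_nonempty[OF finite_balls_nat]) (simp add: nat_metric_simps)
qed (rule compact_higson_corona[OF finite_balls_nat] connected_nat_corona
    Hausdorff_higson_corona[OF finite_balls_nat])+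

text \<open>Higson functions vary slowly, so that a neighbourhood of a point of the corona contains
  arbitrarily long intervals arbitrarily far out.\<close>

lemma higson_nbhd_long_interval:
  assumes p: "p \<in> corona_points nat_metric" and F: "finite F" "F \<subseteq> higson_functions nat_metric" and e: "0 < e"
  obtains n where "M \<le> n" "\<And>k. \<bar>real n - real k\<bar> \<le> L \<Longrightarrow> k \<in> higson_nbhd nat_metric p F e"
proof -
  let ?N = "higson_nbhd nat_metric p F (e/2)"
  let ?O = "(\<Union>f\<in>F. oscillation_set nat_metric f L (e/2)) \<union> {..<M}"
  have inf: "infinite ?N" using corona_pointsD[OF p F, of "e/2"] e by simp
  have "finite (oscillation_set nat_metric f L (e/2))" if "f \<in> F" for f
    using subsetD[OF F(2) that] e unfolding higson_functions_finite_balls[OF finite_balls_nat] by simp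
  then have "finite ?O" using F(1) by simp
  then have "\<not> ?N \<subseteq> ?O" using inf finite_subset by blast
  then obtain n where n: "n \<in> ?N" "n \<notin> ?O" by blast
  have "k \<in> higson_nbhd nat_metric p F e" if k: "\<bar>real n - real k\<bar> \<le> L" for k
  proof -
    have "\<bar>f k - p f\<bar> < e" if f: "f \<in> F" for f
    proof -
      have "n \<notin> oscillation_set nat_metric f L (e/2)" using n(2) f by simp
      then have "\<not> (\<bar>real n - real k\<bar> \<le> L \<and> e/2 \<le> \<bar>f n - f k\<bar>)"
        unfolding oscillation_set_def nat_metric_simps by blast
      then have "\<bar>f n - f k\<bar> < e/2" using k by linarith
      moreover have "\<bar>f n - p f\<bar> < e/2" using n(1) f by (simp add: higson_nbhd_def)
      ultimately show ?thesis by linarith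
    qed
    then show ?thesis by (simp add: higson_nbhd_def nat_metric_simps)
  qed
  moreover have "M \<le> n" using n(2) by simp
  ultimately show ?thesis using that by blast
qed

lemma nat_corona_subcontinuum_coordinate:
  assumes P: "connectedin (higson_corona nat_metric) P" and f: "f \<in> higson_functions nat_metric"
    and vals: "\<And>p. p \<in> P \<Longrightarrow> p f = 0 \<or> p f = 1"
    and p: "p \<in> P" "p f = 0" and q: "q \<in> P" "q f = (1::real)"
  shows False
proof -
  have "continuous_map (real_product (higson_functions nat_metric)) euclideanreal (\<lambda>p. p f)"
    using f by (rule continuous_map_product_projection)
  then have "continuous_map (higson_corona nat_metric) euclideanreal (\<lambda>p. p f)"
    unfolding higson_corona_eq[OF finite_balls_nat] by (rule continuous_map_from_subtopology)
  then have "connectedin euclideanreal ((\<lambda>p. p f) ` P)"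
    using P by (rule connectedin_continuous_map_image)
  then have "connected ((\<lambda>p. p f) ` P)" by (simp add: connectedin_iff_connected)
  moreover have "0 \<in> (\<lambda>p. p f) ` P" "1 \<in> (\<lambda>p. p f) ` P" using p q by force+
  ultimately have "1/2 \<in> (\<lambda>p. p f) ` P"
    by (rule connectedD_interval) simp_all
  then show False using vals by force
qed

text \<open>A proper subcontinuum \<open>P\<close> misses a neighbourhood of a point, which contains long intervals
  around \<open>a 0 < a 1 < \<dots>\<close>. The union \<open>D\<close> of every other block \<open>{a k..<a (Suc k)}\<close> has all of its
  boundary in the middle of these intervals, and so is separated from its complement outside the
  neighbourhood by a Higson function, which takes only the values 0 and 1 on \<open>P\<close>. If \<open>P\<close> had
  interior, as it does when \<open>Q\<close> is proper too, then it would contain accumulation points of blocks of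
  either kind, and so would not be connected.\<close>

lemma nat_corona_proper_subcontinua:
  assumes P: "closedin (higson_corona nat_metric) P" "connectedin (higson_corona nat_metric) P"
    and Q: "closedin (higson_corona nat_metric) Q"
    and PQ: "P \<union> Q = corona_points nat_metric" and Pp: "P \<noteq> corona_points nat_metric"
  shows "Q = corona_points nat_metric"
proof (rule ccontr)
  assume Qp: "Q \<noteq> corona_points nat_metric"
  let ?m = nat_metric
  note fb = finite_balls_nat
  have top: "topspace (higson_corona ?m) = corona_points ?m" by (rule topspace_higson_corona[OF fb])
  obtain y where y: "y \<in> corona_points ?m" "y \<notin> P" using Pp PQ by blast
  obtain z where z: "z \<in> corona_points ?m" "z \<notin> Q" using Qp PQ by blast
  have opP: "openin (higson_corona ?m) (corona_points ?m - P)"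
    and opQ: "openin (higson_corona ?m) (corona_points ?m - Q)"
    using P(1) Q unfolding closedin_def top by simp_all
  obtain F e where F: "finite F" "F \<subseteq> higson_functions ?m" "0 < e"
    and FP: "\<And>p. p \<in> corona_points ?m \<Longrightarrow> (\<And>f. f \<in> F \<Longrightarrow> \<bar>p f - y f\<bar> < e) \<Longrightarrow> p \<in> corona_points ?m - P"
    using corona_nbhd_mem[OF fb opP, of y] y by blast
  obtain F' e' where F': "finite F'" "F' \<subseteq> higson_functions ?m" "0 < e'"
    and FQ: "\<And>p. p \<in> corona_points ?m \<Longrightarrow> (\<And>f. f \<in> F' \<Longrightarrow> \<bar>p f - z f\<bar> < e') \<Longrightarrow> p \<in> corona_points ?m - Q"
    using corona_nbhd_mem[OF fb opQ, of z] z by blast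
  \<comment> \<open>Halving the radius keeps the accumulation points of \<open>A\<close> in the open neighbourhood of \<open>y\<close>, off \<open>P\<close>;
    likewise those of \<open>B\<close> stay off \<open>Q\<close>, and so in \<open>P\<close>.\<close>
  define A where "A = higson_nbhd ?m y F (e/2)"
  define B where "B = higson_nbhd ?m z F' (e'/2)"
  have clA: "p \<notin> P" if p: "p \<in> corona_closure ?m A" for p
  proof -
    have "\<bar>p f - y f\<bar> < e" if "f \<in> F" for f
      using corona_closure_nbhd[OF p[unfolded A_def] that F(2)] F(3) by simp
    then have "p \<in> corona_points ?m - P" using corona_closure_points[OF p] by (intro FP)
    then show ?thesis by simp
  qed
  have clB: "p \<in> P" if p: "p \<in> corona_closure ?m B" for p
  proof -
    have "\<bar>p f - z f\<bar> < e'" if "f \<in> F'" for f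
      using corona_closure_nbhd[OF p[unfolded B_def] that F'(2)] F'(3) by simp
    then have "p \<in> corona_points ?m - Q" using corona_closure_points[OF p] by (intro FQ)
    then show ?thesis using PQ by blast
  qed
  have infB: "infinite B" unfolding B_def using corona_pointsD[OF z(1) F'(1,2), of "e'/2"] F'(3) by simp
  \<comment> \<open>A pair consists of the centre of an interval of radius \<open>k\<close> in \<open>A\<close> and of a witness in \<open>B\<close> beyond it.\<close>
  define good where "good k s \<longleftrightarrow> (\<forall>j. \<bar>real (fst s) - real j\<bar> \<le> real k \<longrightarrow> j \<in> A) \<and> snd s \<in> B \<and> fst s < snd s"
    for k :: nat and s :: "nat \<times> nat"
  have ex: "\<exists>s. good k s \<and> M < fst s" for k M
  proof -
    obtain n where n: "Suc M \<le> n" "\<And>j. \<bar>real n - real j\<bar> \<le> real k \<Longrightarrow> j \<in> A"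
      unfolding A_def using higson_nbhd_long_interval[OF y(1) F(1,2), of "e/2" "Suc M" "real k"] F(3)
      by (metis half_gt_zero)
    obtain b where "b \<in> B" "n < b" using infB by (meson infinite_nat_iff_unbounded)
    then show ?thesis using n by (intro exI[of _ "(n, b)"]) (simp add: good_def)
  qed
  have "\<exists>s. \<forall>k. good k (s k) \<and> snd (s k) < fst (s (Suc k))"
    by (rule dependent_nat_choice[of good "\<lambda>k s t. snd s < fst t"]) (use ex in blast)+
  then obtain s where s: "\<And>k. good k (s k)" "\<And>k. snd (s k) < fst (s (Suc k))" by blast
  define a where "a k = fst (s k)" for k
  define b where "b k = snd (s k)" for k
  have aA: "j \<in> A" if "\<bar>real (a k) - real j\<bar> \<le> real k" for j k
    using s(1)[of k] that unfolding good_def a_def by blast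
  have ab: "a k < b k" "b k < a (Suc k)" "b k \<in> B" for k
    using s(1)[of k] s(2)[of k] unfolding good_def a_def b_def by blast+
  have a_mono: "strict_mono a"
    by (rule strict_mono_Suc_iff[THEN iffD2]) (use ab less_trans in blast)
  have b_mono: "strict_mono b"
    by (rule strict_mono_Suc_iff[THEN iffD2]) (use ab less_trans in blast)
  define D where "D = (\<Union>k\<in>{k. even k}. {a k..<a (Suc k)})"
  have bD: "b k \<in> D \<longleftrightarrow> even k" for k
  proof
    assume "even k"
    then show "b k \<in> D" unfolding D_def using ab[of k] by (auto intro!: bexI[of _ k])
  next
    assume "b k \<in> D"
    then obtain i where i: "even i" "a i \<le> b k" "b k < a (Suc i)" unfolding D_def by auto
    have "a i < a (Suc k)" "a k < a (Suc i)" using i ab[of k] by linarith+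
    then have "i < Suc k" "k < Suc i" using strict_mono_less[OF a_mono] by blast+
    then show "even k" using i(1) by (simp add: less_Suc_eq_le)
  qed
  \<comment> \<open>On the way from \<open>D\<close> to its complement one passes some \<open>a k\<close>.\<close>
  have between: "\<exists>k. \<bar>real x - real (a k)\<bar> \<le> \<bar>real x - real w\<bar>" if x: "x \<in> D" and w: "w \<notin> D" for x w
  proof -
    obtain i where i: "even i" "a i \<le> x" "x < a (Suc i)" using x unfolding D_def by auto
    have "w < a i \<or> a (Suc i) \<le> w" 
    proof (rule ccontr)
      assume "\<not> ?thesis"
      then have "w \<in> {a i..<a (Suc i)}" by auto
      then show False using w i(1) unfolding D_def by blast
    qed
    then show ?thesis
    proof
      assume "w < a i"
      then show ?thesis using i(2) by (intro exI[of _ i]) simp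
    next
      assume "a (Suc i) \<le> w"
      then show ?thesis using i(3) by (intro exI[of _ "Suc i"]) simp
    qed
  qed
  have div: "finite {x \<in> D - A. \<exists>w\<in>(UNIV - D) - A. mdist ?m x w \<le> r}" for r
  proof -
    have sub: "{x \<in> D - A. \<exists>w\<in>(UNIV - D) - A. mdist ?m x w \<le> r} \<subseteq> {..a (nat \<lceil>r\<rceil>) + nat \<lceil>r\<rceil>}"
    proof
      fix x assume "x \<in> {x \<in> D - A. \<exists>w\<in>(UNIV - D) - A. mdist ?m x w \<le> r}"
      then obtain w where x: "x \<in> D" "x \<notin> A" and w: "w \<notin> D" "\<bar>real x - real w\<bar> \<le> r"
        by (auto simp: nat_metric_simps)
      obtain k where k: "\<bar>real x - real (a k)\<bar> \<le> \<bar>real x - real w\<bar>" using between[OF x(1) w(1)] ..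
      have "real k < \<bar>real (a k) - real x\<bar>" using aA[of k x] x(2) by linarith
      then have "real k < r" and xa: "real x \<le> real (a k) + r" using k w(2) by linarith+
      then have kr: "k \<le> nat \<lceil>r\<rceil>" by linarith
      have "a k \<le> a (nat \<lceil>r\<rceil>)" using kr strict_mono_less_eq[OF a_mono] by blast
      moreover have "real x \<le> real (a k + nat \<lceil>r\<rceil>)" using xa by simp linarith
      ultimately show "x \<in> {..a (nat \<lceil>r\<rceil>) + nat \<lceil>r\<rceil>}" by simp
    qed
    show ?thesis by (rule finite_subset[OF sub]) simp
  qed
  have sub: "D - A \<subseteq> mspace ?m" "(UNIV - D) - A \<subseteq> mspace ?m" by (simp_all add: nat_metric_simps)
  obtain f where f: "f \<in> higson_functions ?m"
    and lim0: "\<And>p. p \<in> corona_closure ?m (D - A) \<Longrightarrow> p f = 0"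
    and lim1: "\<And>p. p \<in> corona_closure ?m ((UNIV - D) - A) \<Longrightarrow> p f = 1"
    by (rule divergent_sets_limits[OF fb sub div]) blast
  have drop: "p \<in> corona_closure ?m (E - A)" if p: "p \<in> P" "p \<in> corona_closure ?m E" for p E
  proof -
    have "E \<subseteq> (E - A) \<union> A" by blast
    then have "p \<in> corona_closure ?m ((E - A) \<union> A)" using p(2) by (rule corona_closure_mono)
    then show ?thesis using corona_closure_Un clA p(1) by blast
  qed
  have vals: "p f = 0 \<or> p f = 1" if p: "p \<in> P" for p
  proof -
    have "p \<in> corona_points ?m" using p PQ by blast
    then have "p \<in> corona_closure ?m (D \<union> (UNIV - D))"
      using corona_closure_mspace[of p ?m] by (simp add: nat_metric_simps)
    then show ?thesis using corona_closure_Un[of p ?m D "UNIV - D"] drop[OF p] lim0 lim1 by blast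
  qed
  have blocks: "\<exists>p\<in>P. p \<in> corona_closure ?m (b ` K)" if "infinite K" for K
  proof -
    have "inj b" using b_mono by (rule strict_mono_imp_inj_on)
    then have "infinite (b ` K)" using that by (simp add: finite_image_iff inj_on_subset[OF _ subset_UNIV])
    then obtain p where p: "p \<in> corona_closure ?m (b ` K)"
      using corona_closure_nonempty[OF fb, of "b ` K"] by (auto simp: nat_metric_simps)
    have "b ` K \<subseteq> B" using ab(3) by blast
    then have "p \<in> P" using p by (intro clB) (rule corona_closure_mono)
    then show ?thesis using p by blast
  qed
  have "infinite {k::nat. even k}" "infinite {k::nat. odd k}"
    by (simp_all add: infinite_nat_iff_unbounded)
       (metis even_Suc lessI less_SucI)+
  then obtain p q where p: "p \<in> P" "p \<in> corona_closure ?m (b ` {k. even k})"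
    and q: "q \<in> P" "q \<in> corona_closure ?m (b ` {k. odd k})"
    using blocks by blast
  have "b ` {k. even k} \<subseteq> D" "b ` {k. odd k} \<subseteq> UNIV - D" using bD by auto
  then have "p \<in> corona_closure ?m D" "q \<in> corona_closure ?m (UNIV - D)"
    using p(2) q(2) by (blast intro: corona_closure_mono)+
  then have pf: "p f = 0" "q f = 1" using lim0[OF drop] lim1[OF drop] p(1) q(1) by blast+
  show False
    by (rule nat_corona_subcontinuum_coordinate[OF P(2) f _ p(1) pf(1) q(1) pf(2)]) (rule vals)
qed

theorem indecomposable_nat_corona: "indecomposable_continuum (higson_corona nat_metric)"
  unfolding indecomposable_continuum_def decomposable_def
proof (intro conjI continuum_nat_corona notI)
  let ?X = "higson_corona nat_metric"
  assume "\<exists>A B. A \<subset> topspace ?X \<and> B \<subset> topspace ?X \<and> A \<union> B = topspace ?X \<and>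
        continuum (subtopology ?X A) \<and> continuum (subtopology ?X B)"
  then obtain A B where AB: "A \<subset> topspace ?X" "B \<subset> topspace ?X" "A \<union> B = topspace ?X"
    "continuum (subtopology ?X A)" "continuum (subtopology ?X B)" by blast
  have H: "Hausdorff_space ?X" by (rule Hausdorff_higson_corona[OF finite_balls_nat])
  have top: "topspace ?X = corona_points nat_metric" by (rule topspace_higson_corona[OF finite_balls_nat])
  have "compactin ?X A" "compactin ?X B"
    using AB by (auto simp: continuum_def compactin_subspace)
  then have "closedin ?X A" "closedin ?X B" using compactin_imp_closedin[OF H] by blast+
  moreover have "connectedin ?X A" using AB by (auto simp: continuum_def connectedin_def)
  ultimately have "B = corona_points nat_metric"
    using nat_corona_proper_subcontinua[of A B] AB(1,3) unfolding top by blast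
  then show False using AB(2) unfolding top by blast
qed

text \<open>If the corona were metrizable, then countably many Higson functions would determine a point
  \<open>p\<close> of it, and a sparse sequence in \<open>\<nat>\<close> along which these functions converge to their values
  at \<open>p\<close> would have \<open>p\<close> as its only accumulation point. But a Higson function separates the terms
  of even index from those of odd index.\<close>

theorem not_metrizable_nat_corona: "\<not> metrizable_space (higson_corona nat_metric)"
proof
  let ?X = "higson_corona nat_metric" and ?m = nat_metric and ?H = "higson_functions nat_metric"
  note fb = finite_balls_nat
  have top: "topspace ?X = corona_points ?m" by (rule topspace_higson_corona[OF fb])
  assume "metrizable_space ?X"
  then obtain M d where Md: "Metric_space M d" and X: "?X = Metric_space.mtopology M d"
    unfolding metrizable_space_def by blast
  interpret Metric_space M d by (rule Md)
  have Mc: "M = corona_points ?m" using top unfolding X by simp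
  obtain p where p: "p \<in> corona_points ?m"
    using higson_corona_nonempty[OF fb] by (auto simp: nat_metric_simps)
  have "\<exists>F e. finite F \<and> F \<subseteq> ?H \<and> 0 < e \<and> (\<forall>q\<in>corona_points ?m. (\<forall>f\<in>F. \<bar>q f - p f\<bar> < e) \<longrightarrow> q \<in> mball p (1 / real (Suc i)))"
    for i
  proof -
    have op: "openin ?X (mball p (1 / real (Suc i)))" unfolding X by (rule openin_mball)
    have "0 < 1 / real (Suc i)" "p \<in> M" using p Mc by simp_all
    then have "p \<in> mball p (1 / real (Suc i))" by simp
    from corona_nbhd_mem[OF fb op this] obtain F e where
      "finite F" "F \<subseteq> ?H" "0 < e" "\<And>q. q \<in> corona_points ?m \<Longrightarrow> (\<And>f. f \<in> F \<Longrightarrow> \<bar>q f - p f\<bar> < e) \<Longrightarrow> q \<in> mball p (1 / real (Suc i))"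
      by blast
    then show ?thesis by (intro exI[of _ F] exI[of _ e]) simp
  qed
  then obtain F e where F: "\<And>i. finite (F i)" "\<And>i. F i \<subseteq> ?H" "\<And>i. (0::real) < e i"
    and Fe: "\<And>i q. q \<in> corona_points ?m \<Longrightarrow> \<forall>f\<in>F i. \<bar>q f - p f\<bar> < e i \<Longrightarrow> q \<in> mball p (1 / real (Suc i))"
    by metis
  have determined: "q = p" if q: "q \<in> corona_points ?m" and eq: "\<And>i f. f \<in> F i \<Longrightarrow> q f = p f" for q
  proof (rule ccontr)
    assume "q \<noteq> p"
    then have "0 < d p q" using p q Mc by simp
    then obtain i where i: "1 / real (Suc i) < d p q" using nat_approx_posE by metis
    have "\<forall>f\<in>F i. \<bar>q f - p f\<bar> < e i" using eq F(3)[of i] by simp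
    then have "q \<in> mball p (1 / real (Suc i))" using q by (intro Fe)
    then show False using i by simp
  qed
  define N where "N i = higson_nbhd ?m p (\<Union>j\<le>i. F j) (1 / real (Suc i))" for i
  have N_inf: "infinite (N i)" for i
    unfolding N_def by (rule corona_pointsD[OF p]) (use F in auto)
  have ex: "\<exists>x. x \<in> N k \<and> M < x" for k M
    using N_inf[of k] by (meson infinite_nat_iff_unbounded)
  have "\<exists>x. \<forall>k. x k \<in> N k \<and> x k + k < x (Suc k)"
    by (rule dependent_nat_choice[of "\<lambda>k x. x \<in> N k" "\<lambda>k x y. x + k < y"]) (use ex in blast)+
  then obtain x where x: "\<And>k. x k \<in> N k" "\<And>k. x k + k < x (Suc k)" by blast
  have x_mono: "strict_mono x"
    by (rule strict_mono_Suc_iff[THEN iffD2]) (use x(2) add_lessD1 in blast)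
  have x_inj: "inj x" using x_mono by (rule strict_mono_imp_inj_on)
  have limit: "q = p" if q: "q \<in> corona_closure ?m (x ` K)" for q K
  proof (rule determined[OF corona_closure_points[OF q]])
    fix i f assume f: "f \<in> F i"
    show "q f = p f"
    proof (rule corona_closure_limit[OF q subsetD[OF F(2) f]])
      fix c :: real assume "0 < c"
      then obtain n where n: "1 / real (Suc n) < c" using nat_approx_posE by metis
      have "{y \<in> x ` K. c \<le> \<bar>f y - p f\<bar>} \<subseteq> x ` {..<max i n}"
      proof
        fix y assume "y \<in> {y \<in> x ` K. c \<le> \<bar>f y - p f\<bar>}"
        then obtain k where k: "y = x k" "c \<le> \<bar>f (x k) - p f\<bar>" by blast
        have "k < max i n"
        proof (rule ccontr)
          assume "\<not> k < max i n"
          then have ki: "i \<le> k" "n \<le> k" by simp_all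
          have "\<bar>f (x k) - p f\<bar> < 1 / real (Suc k)"
            using x(1)[of k] f ki(1) unfolding N_def higson_nbhd_def by blast
          also have "\<dots> \<le> 1 / real (Suc n)" using ki(2) by (simp add: frac_le)
          finally show False using k(2) n by linarith
        qed
        then show "y \<in> x ` {..<max i n}" using k(1) by blast
      qed
      then show "finite {y \<in> x ` K. c \<le> \<bar>f y - p f\<bar>}" by (rule finite_subset) simp
    qed
  qed
  let ?E = "x ` {k. even k}" and ?O = "x ` {k. odd k}"
  have gap: "real (min i j) < \<bar>real (x i) - real (x j)\<bar>" if "i \<noteq> j" for i j
  proof -
    have *: "real i < \<bar>real (x i) - real (x j)\<bar>" if "i < j" for i j
    proof -
      have "x (Suc i) \<le> x j" using that strict_mono_less_eq[OF x_mono] by simp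
      then have "x i + i < x j" using x(2)[of i] by linarith
      then show ?thesis by linarith
    qed
    show ?thesis using that *[of i j] *[of j i] by (cases "i < j") (auto simp: min_def abs_minus_commute)
  qed
  have div: "finite {y \<in> ?E. \<exists>z\<in>?O. mdist ?m y z \<le> r}" for r
  proof -
    have sub: "{y \<in> ?E. \<exists>z\<in>?O. mdist ?m y z \<le> r} \<subseteq> {..x (nat \<lceil>r\<rceil>) + nat \<lceil>r\<rceil>}"
    proof
      fix y assume "y \<in> {y \<in> ?E. \<exists>z\<in>?O. mdist ?m y z \<le> r}"
      then obtain i j where ij: "even i" "odd j" "y = x i" "\<bar>real (x i) - real (x j)\<bar> \<le> r"
        by (auto simp: nat_metric_simps)
      then have "i \<noteq> j" by blast
      then have "real (min i j) < r" using gap[of i j] ij(4) by linarith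
      then have "min i j \<le> nat \<lceil>r\<rceil>" by linarith
      then have "x (min i j) \<le> x (nat \<lceil>r\<rceil>)" using strict_mono_less_eq[OF x_mono] by blast
      moreover have "real (x i) \<le> real (x (min i j)) + r"
        using ij(4) by (simp add: min_def) linarith
      then have "real (x i) \<le> real (x (min i j) + nat \<lceil>r\<rceil>)" by simp linarith
      ultimately show "y \<in> {..x (nat \<lceil>r\<rceil>) + nat \<lceil>r\<rceil>}" using ij(3) by simp
    qed
    show ?thesis by (rule finite_subset[OF sub]) simp
  qed
  have sub: "?E \<subseteq> mspace ?m" "?O \<subseteq> mspace ?m" by (simp_all add: nat_metric_simps)
  obtain f where f: "\<And>q. q \<in> corona_closure ?m ?E \<Longrightarrow> q f = 0" "\<And>q. q \<in> corona_closure ?m ?O \<Longrightarrow> q f = 1"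
    by (rule divergent_sets_limits[OF fb sub div]) blast
  have "infinite {k::nat. even k}" "infinite {k::nat. odd k}"
    by (simp_all add: infinite_nat_iff_unbounded)
       (metis even_Suc lessI less_SucI)+
  then have inf: "infinite ?E" "infinite ?O"
    by (simp_all add: finite_image_iff inj_on_subset[OF x_inj subset_UNIV])
  obtain q where q: "q \<in> corona_closure ?m ?E" by (rule corona_closure_nonempty[OF fb sub(1) inf(1)])
  obtain q' where q': "q' \<in> corona_closure ?m ?O" by (rule corona_closure_nonempty[OF fb sub(2) inf(2)])
  have "q f = 0" "q' f = 1" using f q q' by blast+
  then show False using limit[OF q] limit[OF q'] by simp
qed

section \<open>Almost invariant sets and two-ended groups\<close>

text \<open>In a word metric these are the coarsely clopen sets, and in a Cayley graph the sets of vertices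
  that are separated from their complement by finitely many edges, for any finite generating set.
  The notion itself does not refer to generators, and so it connects a corona and a space of ends
  that come from different generating sets.\<close>

definition almost_invariant :: "('a, 'b) monoid_scheme \<Rightarrow> 'a set \<Rightarrow> bool" where
  "almost_invariant G A \<longleftrightarrow> A \<subseteq> carrier G \<and> (\<forall>w\<in>carrier G. finite {x \<in> A. x \<otimes>\<^bsub>G\<^esub> w \<notin> A})"

definition translate :: "('a, 'b) monoid_scheme \<Rightarrow> 'a \<Rightarrow> 'a set \<Rightarrow> 'a set" where
  "translate G g A = {x \<in> carrier G. inv\<^bsub>G\<^esub> g \<otimes>\<^bsub>G\<^esub> x \<in> A}"

text \<open>For a finitely generated group: at least three ends.\<close>

definition three_pieces :: "('a, 'b) monoid_scheme \<Rightarrow> bool" where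
  "three_pieces G \<longleftrightarrow> (\<exists>A B C. almost_invariant G A \<and> almost_invariant G B \<and> almost_invariant G C \<and>
     infinite A \<and> infinite B \<and> infinite C \<and> A \<inter> B = {} \<and> A \<inter> C = {} \<and> B \<inter> C = {})"

context group
begin

lemma almost_invariantD:
  "almost_invariant G A \<Longrightarrow> w \<in> carrier G \<Longrightarrow> finite {x \<in> A. x \<otimes> w \<notin> A}"
  "almost_invariant G A \<Longrightarrow> A \<subseteq> carrier G"
  by (simp_all add: almost_invariant_def)

lemma inv_mult_cancel: "g \<in> carrier G \<Longrightarrow> x \<in> carrier G \<Longrightarrow> inv g \<otimes> (g \<otimes> x) = x"
  "g \<in> carrier G \<Longrightarrow> x \<in> carrier G \<Longrightarrow> g \<otimes> (inv g \<otimes> x) = x"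
  "g \<in> carrier G \<Longrightarrow> x \<in> carrier G \<Longrightarrow> (x \<otimes> g) \<otimes> inv g = x"
  "g \<in> carrier G \<Longrightarrow> x \<in> carrier G \<Longrightarrow> (x \<otimes> inv g) \<otimes> g = x"
  by (simp_all add: m_assoc[symmetric]) (simp_all add: m_assoc)

lemma almost_invariant_compl:
  assumes A: "almost_invariant G A"
  shows "almost_invariant G (carrier G - A)"
  unfolding almost_invariant_def
proof (intro conjI ballI)
  fix w assume w: "w \<in> carrier G"
  have Ac: "A \<subseteq> carrier G" using A by (rule almost_invariantD)
  have "{x \<in> carrier G - A. x \<otimes> w \<notin> carrier G - A} \<subseteq> (\<lambda>y. y \<otimes> inv w) ` {y \<in> A. y \<otimes> inv w \<notin> A}"
  proof
    fix x assume "x \<in> {x \<in> carrier G - A. x \<otimes> w \<notin> carrier G - A}"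
    then have x: "x \<in> carrier G" "x \<notin> A" "x \<otimes> w \<in> A" using w by auto
    have e: "(x \<otimes> w) \<otimes> inv w = x" using x w by (simp add: inv_mult_cancel)
    then have "x \<otimes> w \<in> {y \<in> A. y \<otimes> inv w \<notin> A}" using x by simp
    then show "x \<in> (\<lambda>y. y \<otimes> inv w) ` {y \<in> A. y \<otimes> inv w \<notin> A}"  using e by (intro image_eqI[of x _ "x \<otimes> w"]) simp_all
  qed
  moreover have "finite {y \<in> A. y \<otimes> inv w \<notin> A}" using A w by (simp add: almost_invariantD)
  ultimately show "finite {x \<in> carrier G - A. x \<otimes> w \<notin> carrier G - A}"
    by (meson finite_imageI finite_subset)
qed simp

lemma almost_invariant_Int:
  assumes A: "almost_invariant G A" and B: "almost_invariant G B"
  shows "almost_invariant G (A \<inter> B)"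
  unfolding almost_invariant_def
proof (intro conjI ballI)
  show "A \<inter> B \<subseteq> carrier G" using almost_invariantD(2)[OF A] by blast
  fix w assume w: "w \<in> carrier G"
  have "{x \<in> A \<inter> B. x \<otimes> w \<notin> A \<inter> B} \<subseteq> {x \<in> A. x \<otimes> w \<notin> A} \<union> {x \<in> B. x \<otimes> w \<notin> B}" by blast
  moreover have "finite ({x \<in> A. x \<otimes> w \<notin> A} \<union> {x \<in> B. x \<otimes> w \<notin> B})"
    using almost_invariantD(1)[OF A w] almost_invariantD(1)[OF B w] by simp
  ultimately show "finite {x \<in> A \<inter> B. x \<otimes> w \<notin> A \<inter> B}" by (rule finite_subset)
qed

lemma almost_invariant_Diff:
  assumes A: "almost_invariant G A" and B: "almost_invariant G B"
  shows "almost_invariant G (A - B)"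
proof -
  have "A - B = A \<inter> (carrier G - B)" using almost_invariantD(2)[OF A] by blast
  then show ?thesis using almost_invariant_Int[OF A almost_invariant_compl[OF B]] by simp
qed

lemma translate_iff: "x \<in> carrier G \<Longrightarrow> x \<in> translate G g A \<longleftrightarrow> inv g \<otimes> x \<in> A"
  by (simp add: translate_def)

lemma translate_mult_iff:
  "g \<in> carrier G \<Longrightarrow> x \<in> carrier G \<Longrightarrow> g \<otimes> x \<in> translate G g A \<longleftrightarrow> x \<in> A"
  by (simp add: translate_def inv_mult_cancel)

lemma translate_eq_image:
  assumes "g \<in> carrier G" "A \<subseteq> carrier G"
  shows "translate G g A = (\<lambda>x. g \<otimes> x) ` A"
proof (intro equalityI subsetI)
  fix x assume "x \<in> translate G g A"
  then have "x \<in> carrier G" "inv g \<otimes> x \<in> A" by (simp_all add: translate_def)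
  moreover from this have "x = g \<otimes> (inv g \<otimes> x)" using assms by (simp add: inv_mult_cancel)
  ultimately show "x \<in> (\<lambda>x. g \<otimes> x) ` A" by blast
next
  fix x assume "x \<in> (\<lambda>x. g \<otimes> x) ` A"
  then show "x \<in> translate G g A" using assms by (auto simp: translate_def inv_mult_cancel subset_iff)
qed

lemma finite_translate_iff:
  assumes "g \<in> carrier G" "A \<subseteq> carrier G"
  shows "finite (translate G g A) \<longleftrightarrow> finite A"
  unfolding translate_eq_image[OF assms]
  by (rule finite_image_iff) (use assms in \<open>auto simp: inj_on_def subset_iff\<close>)

lemma almost_invariant_translate:
  assumes A: "almost_invariant G A" and g: "g \<in> carrier G"
  shows "almost_invariant G (translate G g A)"
  unfolding almost_invariant_def
proof (intro conjI ballI)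
  show "translate G g A \<subseteq> carrier G" by (auto simp: translate_def)
  fix w assume w: "w \<in> carrier G"
  have "{x \<in> translate G g A. x \<otimes> w \<notin> translate G g A} \<subseteq> translate G g {x \<in> A. x \<otimes> w \<notin> A}"
    using g w by (auto simp: translate_def m_assoc)
  moreover have "finite (translate G g {x \<in> A. x \<otimes> w \<notin> A})"
    using almost_invariantD(1)[OF A w] almost_invariantD(2)[OF A]
    by (subst finite_translate_iff[OF g]) auto
  ultimately show "finite {x \<in> translate G g A. x \<otimes> w \<notin> translate G g A}" by (rule finite_subset)
qed

lemma third_piece_finite:
  assumes "\<not> three_pieces G" "almost_invariant G A" "almost_invariant G B" "almost_invariant G C"
    "infinite A" "infinite B" "A \<inter> B = {}" "A \<inter> C = {}" "B \<inter> C = {}"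
  shows "finite C"
  using assms unfolding three_pieces_def by blast

text \<open>The Cayley graph is connected.\<close>

lemma letters_closed_subset:
  assumes T: "generating_set G T" and B: "B \<subseteq> carrier G"
    and closed: "\<And>x t. x \<in> B \<Longrightarrow> t \<in> T \<union> m_inv G ` T \<Longrightarrow> x \<otimes> t \<in> B"
  shows "B = {} \<or> B = carrier G"
proof (rule disjCI)
  assume "B \<noteq> carrier G"
  have L: "T \<union> m_inv G ` T \<subseteq> carrier G" by (rule generating_set_letters[OF T])
  have word: "x \<otimes> word_product G ws \<in> B" if "x \<in> B" "set ws \<subseteq> T \<union> m_inv G ` T" for x ws
    using that
  proof (induction ws arbitrary: x)
    case Nil
    then show ?case using B by (auto simp: subset_iff)
  next
    case (Cons t ws)
    have t: "t \<in> T \<union> m_inv G ` T" and ws: "set ws \<subseteq> T \<union> m_inv G ` T" using Cons.prems by auto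
    have "(x \<otimes> t) \<otimes> word_product G ws \<in> B" using Cons.IH closed[OF Cons.prems(1) t] ws by blast
    moreover have "(x \<otimes> t) \<otimes> word_product G ws = x \<otimes> (t \<otimes> word_product G ws)"
      using Cons.prems(1) B t L ws by (intro m_assoc) (auto intro!: word_product_closed)
    ultimately show ?case by simp
  qed
  show "B = {}"
  proof (rule ccontr)
    assume "B \<noteq> {}"
    then obtain x where x: "x \<in> B" "x \<in> carrier G" using B by blast
    have "y \<in> B" if y: "y \<in> carrier G" for y
    proof -
      obtain ws where "set ws \<subseteq> T \<union> m_inv G ` T" "word_product G ws = inv x \<otimes> y"
        using word_exists[OF T, of "inv x \<otimes> y"] x y by auto
      then show ?thesis using word[OF x(1), of ws] x(2) y by (simp add: inv_mult_cancel)
    qed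
    then show False using B \<open>B \<noteq> carrier G\<close> by blast
  qed
qed

definition frontier_vertices :: "'a set \<Rightarrow> 'a set \<Rightarrow> 'a set" where
  "frontier_vertices T A = {x \<in> carrier G. \<exists>t\<in>T \<union> m_inv G ` T. (x \<in> A) \<noteq> (x \<otimes> t \<in> A)}"

lemma finite_frontier_vertices:
  assumes T: "finite T" "generating_set G T" and A: "almost_invariant G A"
  shows "finite (frontier_vertices T A)"
proof -
  let ?L = "T \<union> m_inv G ` T" and ?B = "carrier G - A"
  have L: "?L \<subseteq> carrier G" by (rule generating_set_letters[OF T(2)])
  have "frontier_vertices T A \<subseteq> (\<Union>t\<in>?L. {x \<in> A. x \<otimes> t \<notin> A} \<union> {x \<in> ?B. x \<otimes> t \<notin> ?B})"
    unfolding frontier_vertices_def by blast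
  moreover have "finite (\<Union>t\<in>?L. {x \<in> A. x \<otimes> t \<notin> A} \<union> {x \<in> ?B. x \<otimes> t \<notin> ?B})"
  proof (rule finite_UN_I)
    show "finite ?L" using T(1) by simp
    fix t assume "t \<in> ?L"
    then have "t \<in> carrier G" using L by blast
    then show "finite ({x \<in> A. x \<otimes> t \<notin> A} \<union> {x \<in> ?B. x \<otimes> t \<notin> ?B})"
      using almost_invariantD(1)[OF A] almost_invariantD(1)[OF almost_invariant_compl[OF A]] by simp
  qed
  ultimately show ?thesis by (rule finite_subset)
qed

lemma frontier_translate:
  assumes T: "generating_set G T" and g: "g \<in> carrier G" and x: "x \<in> carrier G"
    and t: "t \<in> T \<union> m_inv G ` T" and change: "(x \<in> translate G g A) \<noteq> (x \<otimes> t \<in> translate G g A)"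
  shows "inv g \<otimes> x \<in> frontier_vertices T A"
proof -
  have tc: "t \<in> carrier G" using t generating_set_letters[OF T] by blast
  have "(inv g \<otimes> x \<in> A) \<noteq> ((inv g \<otimes> x) \<otimes> t \<in> A)"
    using change g x tc by (simp add: translate_iff m_assoc)
  then show ?thesis unfolding frontier_vertices_def using g x t by blast
qed

text \<open>All but finitely many translates of \<open>A\<close> are nested with \<open>A\<close>, up to complements: the frontier of the translate
  lies on one side of \<open>A\<close> and vice versa, and then the corner that both frontiers avoid has no
  frontier itself.\<close>

lemma translate_corner_empty:
  assumes T: "finite T" "generating_set G T" and A: "almost_invariant G A" "A \<noteq> {}" "A \<noteq> carrier G"
  obtains E where "finite E"
    "\<And>g. g \<in> carrier G \<Longrightarrow> g \<notin> E \<Longrightarrow> translate G g A \<noteq> A \<and>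
      (translate G g A \<subseteq> A \<or> A \<subseteq> translate G g A \<or> A \<inter> translate G g A = {} \<or>
       carrier G \<subseteq> A \<union> translate G g A)"
proof -
  let ?V = "frontier_vertices T A" and ?L = "T \<union> m_inv G ` T"
  have Ac: "A \<subseteq> carrier G" by (rule almost_invariantD(2)[OF A(1)])
  have Vc: "?V \<subseteq> carrier G" by (auto simp: frontier_vertices_def)
  have Vf: "finite ?V" by (rule finite_frontier_vertices[OF T A(1)])
  have Vne: "?V \<noteq> {}"
  proof
    assume e: "?V = {}"
    have "A = {} \<or> A = carrier G"
    proof (rule letters_closed_subset[OF T(2) Ac])
      fix x t assume "x \<in> A" "t \<in> ?L"
      then show "x \<otimes> t \<in> A" using e Ac unfolding frontier_vertices_def by blast
    qed
    then show False using A(2,3) by blast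
  qed
  \<comment> \<open>The elements that move two frontier vertices to different sides of \<open>A\<close>. Each pair of vertices
    contributes finitely many since \<open>A\<close> is almost invariant under the step from one to the other.\<close>
  define E1 where "E1 = (\<Union>x\<in>?V. \<Union>y\<in>?V. {g \<in> carrier G. g \<otimes> x \<in> A \<and> g \<otimes> y \<notin> A})"
  have "finite E1"
    unfolding E1_def
  proof (intro finite_UN_I Vf)
    fix x y assume "x \<in> ?V" "y \<in> ?V"
    then have xy: "x \<in> carrier G" "y \<in> carrier G" using Vc by blast+
    have "{g \<in> carrier G. g \<otimes> x \<in> A \<and> g \<otimes> y \<notin> A} \<subseteq> (\<lambda>z. z \<otimes> inv x) ` {z \<in> A. z \<otimes> (inv x \<otimes> y) \<notin> A}"
    proof
      fix g assume "g \<in> {g \<in> carrier G. g \<otimes> x \<in> A \<and> g \<otimes> y \<notin> A}"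
      then have g: "g \<in> carrier G" "g \<otimes> x \<in> A" "g \<otimes> y \<notin> A" by auto
      have "(g \<otimes> x) \<otimes> (inv x \<otimes> y) = g \<otimes> y" using g xy by (simp add: m_assoc inv_mult_cancel)
      then have "g \<otimes> x \<in> {z \<in> A. z \<otimes> (inv x \<otimes> y) \<notin> A}" using g by simp
      moreover have "g = (g \<otimes> x) \<otimes> inv x" using g xy by (simp add: inv_mult_cancel)
      ultimately show "g \<in> (\<lambda>z. z \<otimes> inv x) ` {z \<in> A. z \<otimes> (inv x \<otimes> y) \<notin> A}" by blast
    qed
    moreover have "finite {z \<in> A. z \<otimes> (inv x \<otimes> y) \<notin> A}" using xy by (intro almost_invariantD(1)[OF A(1)]) simp
    ultimately show "finite {g \<in> carrier G. g \<otimes> x \<in> A \<and> g \<otimes> y \<notin> A}" by (meson finite_imageI finite_subset)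
  qed
  \<comment> \<open>The stabilizer of \<open>A\<close> permutes the finite frontier.\<close>
  define E2 where "E2 = {g \<in> carrier G. translate G g A = A}"
  have "finite E2"
  proof -
    obtain v where v: "v \<in> ?V" using Vne by blast
    then have vc: "v \<in> carrier G" using Vc by blast
    obtain t where t: "t \<in> ?L" "(v \<in> A) \<noteq> (v \<otimes> t \<in> A)" using v unfolding frontier_vertices_def by blast
    have tc: "t \<in> carrier G" using t(1) generating_set_letters[OF T(2)] by blast
    have "E2 \<subseteq> (\<lambda>z. z \<otimes> inv v) ` ?V"
    proof
      fix g assume "g \<in> E2"
      then have g: "g \<in> carrier G" "translate G g A = A" by (simp_all add: E2_def)
      have "(g \<otimes> v \<in> A) \<longleftrightarrow> (v \<in> A)" "(g \<otimes> (v \<otimes> t) \<in> A) \<longleftrightarrow> (v \<otimes> t \<in> A)"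
        using translate_mult_iff[OF g(1), of _ A] vc tc unfolding g(2) by simp_all
      then have "(g \<otimes> v \<in> A) \<noteq> ((g \<otimes> v) \<otimes> t \<in> A)" using t(2) g vc tc by (simp add: m_assoc)
      then have "g \<otimes> v \<in> ?V" using t(1) g vc unfolding frontier_vertices_def by blast
      moreover have "g = (g \<otimes> v) \<otimes> inv v" using g vc by (simp add: inv_mult_cancel)
      ultimately show "g \<in> (\<lambda>z. z \<otimes> inv v) ` ?V" by blast
    qed
    then show ?thesis using Vf by (meson finite_imageI finite_subset)
  qed
  define E where "E = E1 \<union> m_inv G ` E1 \<union> E2"
  have "finite E" using \<open>finite E1\<close> \<open>finite E2\<close> by (simp add: E_def)
  moreover have "translate G g A \<noteq> A \<and> (translate G g A \<subseteq> A \<or> A \<subseteq> translate G g A \<or>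
      A \<inter> translate G g A = {} \<or> carrier G \<subseteq> A \<union> translate G g A)"
    if g: "g \<in> carrier G" "g \<notin> E" for g
  proof
    show "translate G g A \<noteq> A" using g by (auto simp: E_def E2_def)
    let ?B = "translate G g A"
    have Bc: "?B \<subseteq> carrier G" by (auto simp: translate_def)
    have "g \<notin> E1" using g(2) by (simp add: E_def)
    moreover have "inv g \<notin> E1"
    proof
      assume "inv g \<in> E1"
      then have "inv (inv g) \<in> m_inv G ` E1" by blast
      then show False using g by (simp add: E_def)
    qed
    ultimately have side: "(\<forall>x\<in>?V. g \<otimes> x \<in> A) \<or> (\<forall>x\<in>?V. g \<otimes> x \<notin> A)"
        "(\<forall>x\<in>?V. inv g \<otimes> x \<in> A) \<or> (\<forall>x\<in>?V. inv g \<otimes> x \<notin> A)"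
      using g(1) inv_closed[OF g(1)] unfolding E1_def by blast+
    \<comment> \<open>The side of \<open>A\<close> without the frontier of the translate, and the side of the translate without
      the frontier of \<open>A\<close>.\<close>
    define S1 where "S1 = (if \<forall>x\<in>?V. g \<otimes> x \<in> A then carrier G - A else A)"
    define S2 where "S2 = (if \<forall>x\<in>?V. inv g \<otimes> x \<in> A then carrier G - ?B else ?B)"
    have S1: "g \<otimes> x \<notin> S1" if "x \<in> ?V" for x using side(1) that by (auto simp: S1_def)
    have S2: "x \<notin> S2" if "x \<in> ?V" for x
      using side(2) that translate_iff[OF subsetD[OF Vc that], of g A] by (auto simp: S2_def)
    have "S1 \<inter> S2 = {} \<or> S1 \<inter> S2 = carrier G"
    proof (rule letters_closed_subset[OF T(2)])
      show "S1 \<inter> S2 \<subseteq> carrier G" using Ac by (auto simp: S1_def)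
      fix x t assume x: "x \<in> S1 \<inter> S2" and t: "t \<in> ?L"
      have xc: "x \<in> carrier G" using x Ac by (auto simp: S1_def split: if_splits)
      have tc: "t \<in> carrier G" using t generating_set_letters[OF T(2)] by blast
      show "x \<otimes> t \<in> S1 \<inter> S2"
      proof (rule ccontr)
        assume "x \<otimes> t \<notin> S1 \<inter> S2"
        then consider "x \<otimes> t \<notin> S1" | "x \<otimes> t \<notin> S2" by blast
        then show False
        proof cases
          case 1
          then have "(x \<in> A) \<noteq> (x \<otimes> t \<in> A)" using x xc tc by (auto simp: S1_def split: if_splits)
          then have "x \<in> ?V" using xc t unfolding frontier_vertices_def by blast
          then show False using S2 x by blast
        next
          case 2
          then have "(x \<in> ?B) \<noteq> (x \<otimes> t \<in> ?B)" using x xc tc by (auto simp: S2_def split: if_splits)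
          then have "inv g \<otimes> x \<in> ?V" by (rule frontier_translate[OF T(2) g(1) xc t])
          then have "g \<otimes> (inv g \<otimes> x) \<notin> S1" by (rule S1)
          then show False using x xc g(1) by (simp add: inv_mult_cancel)
        qed
      qed
    qed
    moreover have "S1 \<noteq> carrier G" using A(2,3) Ac by (auto simp: S1_def)
    ultimately have corner: "S1 \<inter> S2 = {}" using Ac by (auto simp: S1_def split: if_splits)
    show "?B \<subseteq> A \<or> A \<subseteq> ?B \<or> A \<inter> ?B = {} \<or> carrier G \<subseteq> A \<union> ?B"
    proof (cases "\<forall>x\<in>?V. g \<otimes> x \<in> A")
      case True
      then have "S1 = carrier G - A" by (simp add: S1_def)
      then show ?thesis using corner Bc by (cases "\<forall>x\<in>?V. inv g \<otimes> x \<in> A") (auto simp: S2_def)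
    next
      case False
      then have "S1 = A" by (simp only: S1_def if_False)
      then show ?thesis using corner Ac by (cases "\<forall>x\<in>?V. inv g \<otimes> x \<in> A") (auto simp: S2_def)
    qed
  qed
  ultimately show ?thesis by (rule that)
qed

text \<open>If \<open>A\<close> and a translate are disjoint or cover the group, then the translate is almost equal to the
  complement of \<open>A\<close>, since there is no room for a third piece. Two such elements differ by one that
  moves \<open>A\<close> to an almost equal set, and this one is nested with \<open>A\<close> by inclusion. It or its inverse
  moves \<open>A\<close> into itself.\<close>

lemma two_ended_translation:
  assumes T: "finite T" "generating_set G T" and A: "almost_invariant G A"
    and inf: "infinite A" "infinite (carrier G - A)" and no3: "\<not> three_pieces G"
  obtains g where "g \<in> carrier G" "translate G g A \<subseteq> A" "translate G g A \<noteq> A" "finite (A - translate G g A)"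
proof -
  have Ac: "A \<subseteq> carrier G" by (rule almost_invariantD(2)[OF A])
  let ?C = "carrier G - A"
  have ne: "A \<noteq> {}" "A \<noteq> carrier G" using inf by auto
  obtain E where E: "finite E"
    "\<And>g. g \<in> carrier G \<Longrightarrow> g \<notin> E \<Longrightarrow> translate G g A \<noteq> A \<and>
      (translate G g A \<subseteq> A \<or> A \<subseteq> translate G g A \<or> A \<inter> translate G g A = {} \<or>
       carrier G \<subseteq> A \<union> translate G g A)"
    using translate_corner_empty[OF T A ne] by blast
  have infc: "infinite (carrier G)" using inf(1) Ac finite_subset by blast
  have ai: "almost_invariant G (translate G g A)" if "g \<in> carrier G" for g
    by (rule almost_invariant_translate[OF A that])
  have inft: "infinite (translate G g A)" if "g \<in> carrier G" for g
    using finite_translate_iff[OF that Ac] inf(1) by simp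
  have aiC: "almost_invariant G ?C" by (rule almost_invariant_compl[OF A])
  have flip_fin: "finite (?C - translate G g A)" "finite (A \<inter> translate G g A)"
    if g: "g \<in> carrier G" and fl: "A \<inter> translate G g A = {} \<or> carrier G \<subseteq> A \<union> translate G g A" for g
  proof -
    let ?B = "translate G g A"
    have Bc: "?B \<subseteq> carrier G" by (auto simp: translate_def)
    have infCB: "infinite (carrier G - ?B)"
    proof -
      have "carrier G - ?B = translate G g ?C" using g by (auto simp: translate_def)
      then show ?thesis using finite_translate_iff[OF g, of ?C] inf(2) by simp
    qed
    show "finite (?C - ?B)"
      using fl
    proof
      assume "A \<inter> ?B = {}"
      then show ?thesis
        by (intro third_piece_finite[OF no3 A ai[OF g] almost_invariant_Diff[OF aiC ai[OF g]] inf(1) inft[OF g]]) blast+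
    next
      assume "carrier G \<subseteq> A \<union> ?B"
      then have "?C - ?B = {}" by blast
      then show ?thesis by (simp only: finite.emptyI)
    qed
    show "finite (A \<inter> ?B)"
      using fl
    proof
      assume "A \<inter> ?B = {}"
      then show ?thesis by simp
    next
      assume "carrier G \<subseteq> A \<union> ?B"
      then show ?thesis
        by (intro third_piece_finite[OF no3 aiC almost_invariant_compl[OF ai[OF g]] almost_invariant_Int[OF A ai[OF g]] inf(2) infCB]) blast+
    qed
  qed
  have "\<exists>g\<in>carrier G. translate G g A \<noteq> A \<and> (translate G g A \<subseteq> A \<or> A \<subseteq> translate G g A)"
  proof (rule ccontr)
    assume n: "\<not> ?thesis"
    have flip: "A \<inter> translate G g A = {} \<or> carrier G \<subseteq> A \<union> translate G g A"
      if "g \<in> carrier G" "g \<notin> E" for g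
      using E(2)[OF that] n that(1) by blast
    obtain h where h: "h \<in> carrier G" "h \<notin> E"
      using infc E(1) by (meson finite_subset subsetI)
    have "finite (E \<union> (\<lambda>k. h \<otimes> k) ` E)" using E(1) by simp
    then obtain g where g: "g \<in> carrier G" "g \<notin> E \<union> (\<lambda>k. h \<otimes> k) ` E"
      using infc by (meson finite_subset subsetI)
    define k where "k = inv h \<otimes> g"
    have k: "k \<in> carrier G" "h \<otimes> k = g" using g h by (simp_all add: k_def inv_mult_cancel)
    have "k \<notin> E" using g(2) k(2) by blast
    have "finite (A \<inter> translate G k A)" by (rule flip_fin(2)[OF k(1) flip[OF k(1) \<open>k \<notin> E\<close>]])
    then have f1: "finite (translate G h (A \<inter> translate G k A))"
      using Ac by (subst finite_translate_iff[OF h(1)]) auto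
    have f2: "finite (?C - translate G g A)" using g by (intro flip_fin(1) flip) auto
    have f3: "finite (?C - translate G h A)" using h by (intro flip_fin(1) flip) auto
    have "?C \<subseteq> (?C - translate G g A) \<union> (?C - translate G h A) \<union> translate G h (A \<inter> translate G k A)"
    proof
      fix x assume x: "x \<in> ?C"
      have xc: "x \<in> carrier G" using x by simp
      have "inv k \<otimes> (inv h \<otimes> x) = inv g \<otimes> x"
        using k h(1) xc inv_mult_group[OF h(1) k(1)] by (simp add: m_assoc)
      then have "x \<in> translate G h (A \<inter> translate G k A)" if "x \<in> translate G g A" "x \<in> translate G h A"
        using that xc h(1) by (simp add: translate_def)
      then show "x \<in> (?C - translate G g A) \<union> (?C - translate G h A) \<union> translate G h (A \<inter> translate G k A)"
        using x by blast
    qed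
    then have "finite ?C" using f1 f2 f3 by (meson finite_UnI finite_subset)
    then show False using inf(2) by simp
  qed
  then obtain g where g: "g \<in> carrier G" "translate G g A \<noteq> A" "translate G g A \<subseteq> A \<or> A \<subseteq> translate G g A"
    by blast
  have "\<exists>g\<in>carrier G. translate G g A \<noteq> A \<and> translate G g A \<subseteq> A"
    using g(3)
  proof
    assume "translate G g A \<subseteq> A"
    then show ?thesis using g(1,2) by blast
  next
    assume sub: "A \<subseteq> translate G g A"
    have sub': "translate G (inv g) A \<subseteq> A"
    proof
      fix x assume "x \<in> translate G (inv g) A"
      then have x: "x \<in> carrier G" "g \<otimes> x \<in> A" using g(1) by (simp_all add: translate_def)
      then have "g \<otimes> x \<in> translate G g A" using sub by blast
      then show "x \<in> A" using x g(1) by (simp add: translate_mult_iff)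
    qed
    have "translate G (inv g) A \<noteq> A"
    proof
      assume e: "translate G (inv g) A = A"
      have "translate G g A \<subseteq> A"
      proof
        fix x assume "x \<in> translate G g A"
        then have x: "x \<in> carrier G" "inv g \<otimes> x \<in> A" by (simp_all add: translate_def)
        then have "inv g \<otimes> x \<in> translate G (inv g) A" using e by simp
        then show "x \<in> A" using x g(1) by (simp add: translate_def inv_mult_cancel)
      qed
      then show False using sub g(2) by blast
    qed
    then show ?thesis using sub' inv_closed[OF g(1)] by blast
  qed
  then obtain k where k: "k \<in> carrier G" "translate G k A \<noteq> A" "translate G k A \<subseteq> A" by blast
  have "finite (A - translate G k A)"
    by (rule third_piece_finite[OF no3 aiC ai[OF k(1)] almost_invariant_Diff[OF A ai[OF k(1)]] inf(2) inft[OF k(1)]])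
       (use k(3) in blast)+
  then show ?thesis using that k by blast
qed

lemma threshold_int:
  fixes P :: "int \<Rightarrow> bool"
  assumes down: "\<And>n. P (n + 1) \<Longrightarrow> P n" and "P a" and "\<not> P b"
  shows "\<exists>n. \<forall>i. P i \<longleftrightarrow> i \<le> n"
proof -
  have dn: "P i" if "P j" "i \<le> j" for i j
    using that(2,1) by (induction i rule: int_le_induct) (use down[of "_ - 1"] in auto)
  have ab: "a < b" using dn[of a b] assms(2,3) by linarith
  define k where "k = (LEAST k::nat. \<not> P (a + int k))"
  have "\<not> P (a + int (nat (b - a)))" using assms(3) ab by simp
  then have k: "\<not> P (a + int k)" unfolding k_def by (rule LeastI)
  then have "k \<noteq> 0" using assms(2) by (metis add.right_neutral of_nat_0)
  then have "P (a + int (k - 1))" using not_less_Least[of "k - 1" "\<lambda>k. \<not> P (a + int k)"] unfolding k_def by simp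
  then have "P (a + int k - 1)" using \<open>k \<noteq> 0\<close> by (simp add: of_nat_diff add_diff_eq)
  then have "P i \<longleftrightarrow> i \<le> a + int k - 1" for i using dn[of "a + int k - 1" i] dn[of i "a + int k"] k by force
  then show ?thesis by blast
qed

text \<open>If \<open>g\<close> pushes \<open>A\<close> into itself, then the translates of \<open>A\<close> by the powers of \<open>g\<close> form a
  filtration of the group, since their intersection and their union have no frontier. The step at
  which an element leaves the filtration is a height function; \<open>g\<close> raises the height by one, and
  the level sets are the translates of the finite difference \<open>A - translate G g A\<close>. So the group
  is a line up to bounded distance.\<close>

lemma two_ended_height:
  assumes T: "finite T" "generating_set G T" and A: "almost_invariant G A"
    and inf: "infinite A" "infinite (carrier G - A)" and no3: "\<not> three_pieces G"
  obtains g and height :: "'a \<Rightarrow> int" where "g \<in> carrier G"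
    "\<And>x. x \<in> carrier G \<Longrightarrow> height (g \<otimes> x) = height x + 1"
    "\<And>n. finite {x \<in> carrier G. height x = n}"
    "A = {x \<in> carrier G. 0 \<le> height x}"
    "\<exists>x\<in>carrier G. height x = 0"
proof -
  have Ac: "A \<subseteq> carrier G" by (rule almost_invariantD(2)[OF A])
  obtain g where g: "g \<in> carrier G" "translate G g A \<subseteq> A" "translate G g A \<noteq> A" "finite (A - translate G g A)"
    by (rule two_ended_translation[OF T A inf no3])
  obtain d where d: "d \<in> A" "d \<notin> translate G g A" using g(2,3) by blast
  have dc: "d \<in> carrier G" using d(1) Ac by blast
  define P where "P x n \<longleftrightarrow> g [^] (- n) \<otimes> x \<in> A" for x and n :: int
  have pc: "g [^] (n::int) \<in> carrier G" for n using g(1) by simp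
  have Pg: "P (g \<otimes> x) n \<longleftrightarrow> P x (n - 1)" if "x \<in> carrier G" for x n
  proof -
    have "g [^] (- n) \<otimes> (g \<otimes> x) = (g [^] (- n) \<otimes> g [^] (1::int)) \<otimes> x"
      using that g(1) pc by (simp add: m_assoc int_pow_1)
    also have "g [^] (- n) \<otimes> g [^] (1::int) = g [^] (- (n - 1))"
      using int_pow_mult[OF g(1), of "- n" 1] by simp
    finally show ?thesis by (simp add: P_def)
  qed
  have P_down: "P x n" if x: "x \<in> carrier G" and p: "P x (n + 1)" for x n
  proof -
    have e: "g [^] (- n) \<otimes> x = g \<otimes> (g [^] (- (n + 1)) \<otimes> x)"
    proof -
      have "g \<otimes> (g [^] (- (n + 1)) \<otimes> x) = (g [^] (1::int) \<otimes> g [^] (- (n + 1))) \<otimes> x"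
        using x g(1) pc by (simp add: m_assoc int_pow_1)
      also have "g [^] (1::int) \<otimes> g [^] (- (n + 1)) = g [^] (- n)"
        using int_pow_mult[OF g(1), of 1 "- (n + 1)"] by simp
      finally show ?thesis by simp
    qed
    let ?y = "g [^] (- (n + 1)) \<otimes> x"
    have y: "?y \<in> A" "?y \<in> carrier G" using p x pc by (simp_all add: P_def)
    then have "g \<otimes> ?y \<in> translate G g A" using g(1) by (simp add: translate_mult_iff)
    then show ?thesis unfolding P_def e using g(2) by blast
  qed
  let ?V = "frontier_vertices T A"
  have Vf: "finite ?V" by (rule finite_frontier_vertices[OF T A])
  have Pd: "\<not> P d 1" "P d 0"
    using d g(1) dc by (simp_all add: P_def translate_def int_pow_neg int_pow_1)
  have P_dn: "P x i" if "x \<in> carrier G" "P x j" "i \<le> j" for x i j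
    using that(3,2) by (induction i rule: int_le_induct) (use P_down[OF that(1), of "_ - 1"] in auto)
  have Ppow: "P (g [^] (k::int) \<otimes> x) n \<longleftrightarrow> P x (n - k)" if "x \<in> carrier G" for x n k
  proof -
    have "g [^] (- n) \<otimes> (g [^] k \<otimes> x) = (g [^] (- n) \<otimes> g [^] k) \<otimes> x"
      using that pc by (simp add: m_assoc)
    also have "g [^] (- n) \<otimes> g [^] k = g [^] (- (n - k))"
      using int_pow_mult[OF g(1), of "- n" k] by simp
    finally show ?thesis by (simp add: P_def)
  qed
  have free: "k = 0" if "g [^] (k::int) \<otimes> x = x" "x \<in> carrier G" for k x
  proof -
    have "g [^] k = (g [^] k \<otimes> x) \<otimes> inv x" using that(2) pc by (simp add: m_assoc)
    also have "\<dots> = \<one>" unfolding that(1) using that(2) by simp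
    finally have "g [^] k = \<one>" .
    have "g [^] k \<otimes> d = d" using \<open>g [^] k = \<one>\<close> dc by simp
    then have "P d n \<longleftrightarrow> P d (n - k)" for n using Ppow[OF dc, of k n] by simp
    from this[of k] this[of 0] have "P d k" "P d (- k)" using Pd(2) by simp_all
    moreover have "k < 1" if "P d k" for k using P_dn[OF dc that, of 1] Pd(1) by linarith
    ultimately have "k < 1" "- k < 1" by blast+
    then show ?thesis by linarith
  qed
  \<comment> \<open>Membership in the filtration changes between \<open>x\<close> and \<open>x \<otimes> t\<close> only where a power of \<open>g\<close> moves \<open>x\<close>
    to the finite frontier.\<close>
  have stable: "\<exists>N. \<forall>n. N \<le> \<bar>n\<bar> \<longrightarrow> P x n = P (x \<otimes> t) n"
    if x: "x \<in> carrier G" and t: "t \<in> T \<union> m_inv G ` T" for x t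
  proof -
    have tc: "t \<in> carrier G" using t generating_set_letters[OF T(2)] by blast
    let ?S = "{n :: int. g [^] (- n) \<otimes> x \<in> ?V}"
    have "inj (\<lambda>n. g [^] (- n::int) \<otimes> x)"
    proof (rule injI)
      fix i j :: int assume e: "g [^] (- i) \<otimes> x = g [^] (- j) \<otimes> x"
      then have "g [^] j \<otimes> (g [^] (- i) \<otimes> x) = x"
        using x pc g(1) by (simp add: m_assoc[symmetric] int_pow_mult[OF g(1), symmetric])
      then have "g [^] (j - i) \<otimes> x = x"
        using x pc g(1) by (simp add: m_assoc[symmetric] int_pow_mult[OF g(1), symmetric])
      then show "i = j" using free x by force
    qed
    then have "finite ((\<lambda>n. g [^] (- n::int) \<otimes> x) -` ?V)" by (rule finite_vimageI[OF Vf])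
    then have "finite ?S" by (simp add: vimage_def)
    then have fin: "finite (abs ` ?S)" by (rule finite_imageI)
    define N where "N = Max (insert 0 (abs ` ?S)) + 1"
    have N: "n < N" if "n \<in> abs ` ?S" for n
    proof -
      have "n \<le> Max (insert 0 (abs ` ?S))" using fin that by (intro Max_ge) simp_all
      then show ?thesis by (simp add: N_def)
    qed
    have "P x n = P (x \<otimes> t) n" if "N \<le> \<bar>n\<bar>" for n
    proof (rule ccontr)
      assume "P x n \<noteq> P (x \<otimes> t) n"
      then have "(g [^] (- n) \<otimes> x \<in> A) \<noteq> ((g [^] (- n) \<otimes> x) \<otimes> t \<in> A)"
        using x tc pc by (simp add: P_def m_assoc)
      moreover have "g [^] (- n) \<otimes> x \<in> carrier G" using x pc by simp
      ultimately have "g [^] (- n) \<otimes> x \<in> ?V" using t unfolding frontier_vertices_def by blast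
      then have "\<bar>n\<bar> \<in> abs ` ?S" by blast
      then show False using N that by force
    qed
    then show ?thesis by blast
  qed
  define I where "I = {x \<in> carrier G. \<forall>n. P x n}"
  define U where "U = {x \<in> carrier G. \<exists>n. P x n}"
  have "I = {} \<or> I = carrier G"
  proof (rule letters_closed_subset[OF T(2)])
    show "I \<subseteq> carrier G" by (auto simp: I_def)
    fix x t assume x: "x \<in> I" and t: "t \<in> T \<union> m_inv G ` T"
    have xc: "x \<in> carrier G" "\<And>n. P x n" using x by (simp_all add: I_def)
    have tc: "x \<otimes> t \<in> carrier G" using xc t generating_set_letters[OF T(2)] by blast
    obtain N where N: "\<And>n. N \<le> \<bar>n\<bar> \<Longrightarrow> P x n = P (x \<otimes> t) n" using stable[OF xc(1) t] by blast
    have "P (x \<otimes> t) n" for n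
    proof (rule P_dn[OF tc])
      show "P (x \<otimes> t) (max n (max N 0))" using N[of "max n (max N 0)"] xc(2) by simp
    qed simp
    then show "x \<otimes> t \<in> I" unfolding I_def using tc by blast
  qed
  moreover have "d \<notin> I" using Pd(1) by (auto simp: I_def)
  ultimately have I: "I = {}" using dc by blast
  have "U = {} \<or> U = carrier G"
  proof (rule letters_closed_subset[OF T(2)])
    show "U \<subseteq> carrier G" by (auto simp: U_def)
    fix x t assume x: "x \<in> U" and t: "t \<in> T \<union> m_inv G ` T"
    then obtain n where xc: "x \<in> carrier G" "P x n" by (auto simp: U_def)
    have tc: "x \<otimes> t \<in> carrier G" using xc t generating_set_letters[OF T(2)] by blast
    obtain N where N: "\<And>n. N \<le> \<bar>n\<bar> \<Longrightarrow> P x n = P (x \<otimes> t) n" using stable[OF xc(1) t] by blast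
    have "P x (min n (- \<bar>N\<bar>))" by (rule P_dn[OF xc]) simp
    moreover have "N \<le> \<bar>min n (- \<bar>N\<bar>)\<bar>" by linarith
    ultimately have "P (x \<otimes> t) (min n (- \<bar>N\<bar>))" using N by blast
    then show "x \<otimes> t \<in> U" using tc by (auto simp: U_def)
  qed
  moreover have "d \<in> U" using Pd(2) dc by (auto simp: U_def)
  ultimately have U: "U = carrier G" by blast
  have ex: "\<exists>n. \<forall>i. P x i \<longleftrightarrow> i \<le> n" if x: "x \<in> carrier G" for x
  proof -
    obtain a where a: "P x a" using x U by (auto simp: U_def)
    have "x \<notin> I" using I by simp
    then obtain b where "\<not> P x b" using x by (auto simp: I_def)
    then show ?thesis using threshold_int[of "P x", OF P_down[OF x] a] by blast
  qed
  define height where "height x = (SOME n. \<forall>i. P x i \<longleftrightarrow> i \<le> n)" for x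
  have height: "P x i \<longleftrightarrow> i \<le> height x" if "x \<in> carrier G" for x i
    using someI_ex[OF ex[OF that]] unfolding height_def by blast
  have eqI: "height x = n" if x: "x \<in> carrier G" and "\<And>i. P x i \<longleftrightarrow> i \<le> n" for x n
    using that(2)[of n] that(2)[of "height x"] height[OF x] by fastforce
  have hg: "height (g [^] (k::int) \<otimes> x) = height x + k" if x: "x \<in> carrier G" for x k
    by (rule eqI) (use x pc Ppow[OF x] height[OF x] in auto)
  have Ah: "A = {x \<in> carrier G. 0 \<le> height x}"
  proof -
    have "x \<in> A \<longleftrightarrow> 0 \<le> height x" if "x \<in> carrier G" for x
      using height[OF that, of 0] that by (simp add: P_def)
    then show ?thesis using Ac by blast
  qed
  have h0: "{x \<in> carrier G. height x = 0} \<subseteq> A - translate G g A"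
  proof
    fix x assume "x \<in> {x \<in> carrier G. height x = 0}"
    then have x: "x \<in> carrier G" "height x = 0" by simp_all
    have "x \<in> A" using x Ah by simp
    moreover have "\<not> P x 1" using height[OF x(1), of 1] x(2) by simp
    then have "x \<notin> translate G g A" using x g(1) by (simp add: P_def translate_def int_pow_neg int_pow_1)
    ultimately show "x \<in> A - translate G g A" by simp
  qed
  have fin: "finite {x \<in> carrier G. height x = n}" for n
  proof -
    have "{x \<in> carrier G. height x = n} \<subseteq> (\<lambda>x. g [^] n \<otimes> x) ` {x \<in> carrier G. height x = 0}"
    proof
      fix x assume "x \<in> {x \<in> carrier G. height x = n}"
      then have x: "x \<in> carrier G" "height x = n" by simp_all
      have "g [^] (- n) \<otimes> x \<in> {x \<in> carrier G. height x = 0}" using x hg[OF x(1), of "- n"] pc by simp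
      moreover have "x = g [^] n \<otimes> (g [^] (- n) \<otimes> x)"
        using x(1) pc g(1) by (simp add: m_assoc[symmetric] int_pow_mult[OF g(1), symmetric])
      ultimately show "x \<in> (\<lambda>x. g [^] n \<otimes> x) ` {x \<in> carrier G. height x = 0}" by blast
    qed
    then show ?thesis using finite_subset[OF h0 g(4)] by (meson finite_imageI finite_subset)
  qed
  have "height d = 0" using height[OF dc, of 0] height[OF dc, of 1] Pd by simp
  then have ex0: "\<exists>x\<in>carrier G. height x = 0" using dc by blast
  show ?thesis
  proof (rule that[OF g(1) _ fin Ah ex0])
    show "height (g \<otimes> x) = height x + 1" if "x \<in> carrier G" for x
      using hg[OF that, of 1] g(1) by (simp add: int_pow_1)
  qed
qed

end

section \<open>The coarse structure of a group with a height function\<close>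

context group
begin

lemma finite_word_length_ball:
  assumes S: "finite S" "generating_set G S"
  shows "finite {g \<in> carrier G. real (word_length G S g) \<le> r}"
proof -
  let ?L = "S \<union> m_inv G ` S"
  have "{g \<in> carrier G. real (word_length G S g) \<le> r} \<subseteq>
      word_product G ` {ws. set ws \<subseteq> ?L \<and> length ws \<le> nat \<lceil>r\<rceil>}"
  proof
    fix g assume "g \<in> {g \<in> carrier G. real (word_length G S g) \<le> r}"
    then have g: "g \<in> carrier G" "real (word_length G S g) \<le> r" by simp_all
    obtain ws where ws: "length ws = word_length G S g" "set ws \<subseteq> ?L" "word_product G ws = g"
      by (rule word_length_witness[OF S(2) g(1)])
    have "length ws \<le> nat \<lceil>r\<rceil>" using g(2) ws(1) by linarith
    then show "g \<in> word_product G ` {ws. set ws \<subseteq> ?L \<and> length ws \<le> nat \<lceil>r\<rceil>}"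
      using ws(2,3) by blast
  qed
  moreover have "finite {ws. set ws \<subseteq> ?L \<and> length ws \<le> nat \<lceil>r\<rceil>}"
    using S(1) by (intro finite_lists_length_le) simp
  ultimately show ?thesis by (meson finite_imageI finite_subset)
qed

lemma word_dist_mult:
  assumes "x \<in> carrier G" "w \<in> carrier G"
  shows "word_dist G S x (x \<otimes> w) = real (word_length G S w)"
  using assms by (simp add: word_dist_def inv_mult_cancel)

lemma mdist_word_metric_cases:
  assumes S: "generating_set G S" and x: "x \<in> carrier G" and y: "y \<in> carrier G"
    and d: "mdist (word_metric G S) x y \<le> r"
  obtains w where "w \<in> carrier G" "real (word_length G S w) \<le> r" "y = x \<otimes> w"
proof (rule that)
  show "inv x \<otimes> y \<in> carrier G" using x y by simp
  show "real (word_length G S (inv x \<otimes> y)) \<le> r" using d x y by (simp add: word_metric_simps[OF S] word_dist_def)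
  show "y = x \<otimes> (inv x \<otimes> y)" using x y by (simp add: inv_mult_cancel)
qed

lemma finite_balls_word_metric:
  assumes S: "finite S" "generating_set G S"
  shows "finite_balls (word_metric G S)"
  unfolding finite_balls_def mcball_of_eq
proof (intro ballI allI)
  fix x r assume "x \<in> mspace (word_metric G S)"
  then have x: "x \<in> carrier G" by (simp add: word_metric_simps[OF S(2)])
  have "{y. x \<in> mspace (word_metric G S) \<and> y \<in> mspace (word_metric G S) \<and> mdist (word_metric G S) x y \<le> r}
      \<subseteq> (\<lambda>w. x \<otimes> w) ` {g \<in> carrier G. real (word_length G S g) \<le> r}"
  proof
    fix y assume "y \<in> {y. x \<in> mspace (word_metric G S) \<and> y \<in> mspace (word_metric G S) \<and> mdist (word_metric G S) x y \<le> r}"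
    then have "y \<in> carrier G" "mdist (word_metric G S) x y \<le> r" by (simp_all add: word_metric_simps(1)[OF S(2)])
    then obtain w where "w \<in> carrier G" "real (word_length G S w) \<le> r" "y = x \<otimes> w"
      using mdist_word_metric_cases[OF S(2) x] by metis
    then show "y \<in> (\<lambda>w. x \<otimes> w) ` {g \<in> carrier G. real (word_length G S g) \<le> r}" by blast
  qed
  then show "finite {y. x \<in> mspace (word_metric G S) \<and> y \<in> mspace (word_metric G S) \<and> mdist (word_metric G S) x y \<le> r}"
    using finite_word_length_ball[OF S] by (meson finite_imageI finite_subset)
qed

lemma coarsely_clopen_word_metric_iff:
  assumes S: "finite S" "generating_set G S"
  shows "coarsely_clopen (word_metric G S) A \<longleftrightarrow> almost_invariant G A"
proof
  let ?m = "word_metric G S"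
  have ms: "mspace ?m = carrier G" by (rule word_metric_simps(1)[OF S(2)])
  {
    assume A: "coarsely_clopen ?m A"
    then have Ac: "A \<subseteq> carrier G" by (simp add: coarsely_clopen_def ms)
    show "almost_invariant G A"
      unfolding almost_invariant_def
    proof (intro conjI ballI Ac)
      fix w assume w: "w \<in> carrier G"
      let ?r = "real (word_length G S w)"
      have "{x \<in> A. x \<otimes> w \<notin> A} \<subseteq> {x \<in> A. \<exists>y\<in>mspace ?m - A. mdist ?m x y \<le> ?r}"
      proof
        fix x assume "x \<in> {x \<in> A. x \<otimes> w \<notin> A}"
        then have x: "x \<in> A" "x \<in> carrier G" "x \<otimes> w \<notin> A" using Ac by auto
        have "mdist ?m x (x \<otimes> w) \<le> ?r"
          using word_dist_mult[OF x(2) w] by (simp add: word_metric_simps(2)[OF S(2)])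
        moreover have "x \<otimes> w \<in> mspace ?m - A" using x w ms by simp
        ultimately show "x \<in> {x \<in> A. \<exists>y\<in>mspace ?m - A. mdist ?m x y \<le> ?r}" using x(1) by blast
      qed
      moreover have "finite {x \<in> A. \<exists>y\<in>mspace ?m - A. mdist ?m x y \<le> ?r}"
        using A unfolding coarsely_clopen_def by blast
      ultimately show "finite {x \<in> A. x \<otimes> w \<notin> A}" by (rule finite_subset)
    qed
  next
    assume A: "almost_invariant G A"
    then have Ac: "A \<subseteq> carrier G" by (rule almost_invariantD)
    show "coarsely_clopen ?m A"
      unfolding coarsely_clopen_def
    proof (intro conjI allI)
      show "A \<subseteq> mspace ?m" using Ac ms by simp
      fix r
      let ?W = "{g \<in> carrier G. real (word_length G S g) \<le> r}"
      have "{x \<in> A. \<exists>y\<in>mspace ?m - A. mdist ?m x y \<le> r} \<subseteq> (\<Union>w\<in>?W. {x \<in> A. x \<otimes> w \<notin> A})"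
      proof
        fix x assume "x \<in> {x \<in> A. \<exists>y\<in>mspace ?m - A. mdist ?m x y \<le> r}"
        then obtain y where x: "x \<in> A" "x \<in> carrier G" and y: "y \<in> carrier G" "y \<notin> A" "mdist ?m x y \<le> r"
          using Ac ms by blast
        obtain w where "w \<in> carrier G" "real (word_length G S w) \<le> r" "y = x \<otimes> w"
          by (rule mdist_word_metric_cases[OF S(2) x(2) y(1,3)])
        then show "x \<in> (\<Union>w\<in>?W. {x \<in> A. x \<otimes> w \<notin> A})" using x(1) y(2) by blast
      qed
      moreover have "finite (\<Union>w\<in>?W. {x \<in> A. x \<otimes> w \<notin> A})"
        using finite_word_length_ball[OF S] almost_invariantD(1)[OF A] by (intro finite_UN_I) simp_all
      ultimately show "finite {x \<in> A. \<exists>y\<in>mspace ?m - A. mdist ?m x y \<le> r}" by (rule finite_subset)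
    qed
  }
qed

text \<open>The two halves of a group with a height function are coarsely equivalent to the natural
  numbers: a ray is given by the orbit of a point of height 0 under the powers of \<open>g\<close>, and the
  retraction onto it by the height. On the negative half the height is counted from \<open>-1\<close> downwards.\<close>

lemma height_function_halves:
  assumes S: "finite S" "generating_set G S" and g: "g \<in> carrier G"
    and height: "\<And>x. x \<in> carrier G \<Longrightarrow> height (g \<otimes> x) = height x + (1::int)"
    and fin: "\<And>n. finite {x \<in> carrier G. height x = n}"
    and d: "d \<in> carrier G" "height d = 0"
    and A: "almost_invariant G A" and A_eq: "A = {x \<in> carrier G. 0 \<le> height x}"
  shows "subtopology (higson_corona (word_metric G S)) (corona_part (word_metric G S) A)
      homeomorphic_space higson_corona nat_metric"
    and "subtopology (higson_corona (word_metric G S)) (corona_part (word_metric G S) (carrier G - A))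
      homeomorphic_space higson_corona nat_metric"
proof -
  let ?m = "word_metric G S"
  have ms: "mspace ?m = carrier G" by (rule word_metric_simps(1)[OF S(2)])
  have md: "mdist ?m = word_dist G S" by (rule word_metric_simps(2)[OF S(2)])
  have fb: "finite_balls ?m" by (rule finite_balls_word_metric[OF S])
  have pc: "g [^] (n::int) \<in> carrier G" for n using g by simp
  let ?D = "{x \<in> carrier G. height x = 0}"
  have hg: "height (g [^] (k::int) \<otimes> x) = height x + k" if x: "x \<in> carrier G" for x k
  proof -
    have up: "height (g [^] (int n) \<otimes> x) = height x + int n" if x: "x \<in> carrier G" for x n
    proof (induction n)
      case 0
      then show ?case using x by simp
    next
      case (Suc n)
      have "g [^] int (Suc n) = g [^] (1::int) \<otimes> g [^] int n"
        using int_pow_mult[OF g, of 1 "int n"] by simp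
      then have "g [^] int (Suc n) \<otimes> x = g \<otimes> (g [^] int n \<otimes> x)"
        using x g pc by (simp add: m_assoc int_pow_1)
      then show ?case using height[of "g [^] int n \<otimes> x"] x pc Suc by simp
    qed
    show ?thesis
    proof (cases "0 \<le> k")
      case True
      then show ?thesis using up[OF x, of "nat k"] by simp
    next
      case False
      let ?y = "g [^] k \<otimes> x"
      have "g [^] (- k) \<otimes> ?y = x"
        using x pc g by (simp add: m_assoc[symmetric] int_pow_mult[OF g, symmetric])
      then show ?thesis using up[of ?y "nat (- k)"] False x pc by simp
    qed
  qed
  \<comment> \<open>Every element is a power of \<open>g\<close> times an element of the finite set of height 0, so that the
    height changes by a bounded amount over a bounded distance.\<close>
  have split: "g [^] (- height x) \<otimes> x \<in> ?D" "x = g [^] (height x) \<otimes> (g [^] (- height x) \<otimes> x)"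
    if x: "x \<in> carrier G" for x
    using hg[OF x, of "- height x"] x pc
    by (simp_all add: m_assoc[symmetric] int_pow_mult[OF g, symmetric])
  have height_lip: "\<exists>s. \<forall>x\<in>carrier G. \<forall>y\<in>carrier G. mdist ?m x y \<le> r \<longrightarrow> \<bar>height x - height y\<bar> \<le> s" for r
  proof -
    let ?W = "{w \<in> carrier G. real (word_length G S w) \<le> r}"
    let ?Z = "(\<lambda>(e, w). \<bar>height (e \<otimes> w)\<bar>) ` (?D \<times> ?W)"
    have "finite ?Z" using fin[of 0] finite_word_length_ball[OF S, of r] by simp
    have "\<bar>height x - height y\<bar> \<le> Max ?Z"
      if x: "x \<in> carrier G" and y: "y \<in> carrier G" and xy: "mdist ?m x y \<le> r" for x y
    proof -
      obtain w where w: "w \<in> carrier G" "real (word_length G S w) \<le> r" "y = x \<otimes> w"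
        by (rule mdist_word_metric_cases[OF S(2) x y xy])
      let ?e = "g [^] (- height x) \<otimes> x"
      have e: "?e \<in> ?D" "x = g [^] (height x) \<otimes> ?e" by (rule split[OF x])+
      have ec: "?e \<in> carrier G" using e(1) by blast
      have "y = g [^] (height x) \<otimes> (?e \<otimes> w)"
        using e(2) w(1,3) ec pc by (metis m_assoc)
      then have "height y = height (?e \<otimes> w) + height x"
        using hg[of "?e \<otimes> w" "height x"] ec w(1) by simp
      then have "\<bar>height x - height y\<bar> = \<bar>height (?e \<otimes> w)\<bar>" by simp
      also have "\<dots> \<in> ?Z" using e(1) w(1,2) by (intro image_eqI[of _ _ "(?e, w)"]) simp_all
      finally show ?thesis using \<open>finite ?Z\<close> by (intro Max_ge)
    qed
    then show ?thesis by blast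
  qed
  define up where "up n = g [^] (int n) \<otimes> d" for n
  define down where "down n = g [^] (- 1 - int n) \<otimes> d" for n
  define pos where "pos x = nat (if 0 \<le> height x then height x else - 1 - height x)" for x
  have h_up: "height (up n) = int n" for n using hg[OF d(1)] d(2) by (simp add: up_def)
  have h_down: "height (down n) = - 1 - int n" for n using hg[OF d(1)] d(2) by (simp add: down_def)
  have c_up: "up n \<in> carrier G" "down n \<in> carrier G" for n using pc d(1) by (simp_all add: up_def down_def)
  have orbit: "\<exists>s. \<forall>i j. \<bar>i - j\<bar> \<le> (r::int) \<longrightarrow> mdist ?m (g [^] i \<otimes> d) (g [^] j \<otimes> d) \<le> s" for r
  proof -
    let ?Z = "(\<lambda>k. real (word_length G S (inv d \<otimes> (g [^] k \<otimes> d)))) ` {-r..r}"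
    have "mdist ?m (g [^] i \<otimes> d) (g [^] j \<otimes> d) \<le> Max ?Z" if ij: "\<bar>i - j\<bar> \<le> r" for i j
    proof -
      let ?w = "inv d \<otimes> (g [^] (j - i) \<otimes> d)"
      have w: "?w \<in> carrier G" using d pc by simp
      have "(g [^] i \<otimes> d) \<otimes> ?w = g [^] i \<otimes> (g [^] (j - i) \<otimes> d)"
        using d pc by (simp add: m_assoc inv_mult_cancel)
      also have "\<dots> = (g [^] i \<otimes> g [^] (j - i)) \<otimes> d" using d pc by (simp add: m_assoc)
      also have "g [^] i \<otimes> g [^] (j - i) = g [^] j" using int_pow_mult[OF g, of i "j - i"] by simp
      finally have "mdist ?m (g [^] i \<otimes> d) (g [^] j \<otimes> d) = real (word_length G S ?w)"
        using word_dist_mult[of "g [^] i \<otimes> d" ?w S] d pc w by (simp add: md)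
      also have "\<dots> \<in> ?Z" using ij by (intro image_eqI[of _ _ "j - i"]) auto
      finally show ?thesis by (intro Max_ge) simp_all
    qed
    then show ?thesis by blast
  qed
  have coarse_orbit: "coarse_map nat_metric ?m (\<lambda>n. g [^] (e n) \<otimes> d)"
    if e: "\<And>i j. \<bar>e i - e j\<bar> = \<bar>int i - int j\<bar>" for e :: "nat \<Rightarrow> int"
    unfolding coarse_map_def nat_metric_simps ms
  proof (intro conjI allI)
    show "range (\<lambda>n. g [^] (e n) \<otimes> d) \<subseteq> carrier G" using pc d(1) by blast
    fix y
    have "inj e"
    proof (rule injI)
      show "i = j" if "e i = e j" for i j using e[of i j] that by simp
    qed
    then have "finite (e -` {height y})" by (intro finite_vimageI) simp_all
    moreover have "{n \<in> UNIV. g [^] (e n) \<otimes> d = y} \<subseteq> e -` {height y}" using hg[OF d(1)] d(2) by auto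
    ultimately show "finite {n \<in> UNIV. g [^] (e n) \<otimes> d = y}" by (rule finite_subset[rotated])
  next
    fix r :: real
    obtain s where s: "\<And>i j. \<bar>i - j\<bar> \<le> \<lceil>r\<rceil> \<Longrightarrow> mdist ?m (g [^] i \<otimes> d) (g [^] j \<otimes> d) \<le> s"
      using orbit[of "\<lceil>r\<rceil>"] by blast
    have "mdist ?m (g [^] (e x) \<otimes> d) (g [^] (e y) \<otimes> d) \<le> s" if "\<bar>real x - real y\<bar> \<le> r" for x y
    proof (rule s)
      have "\<bar>int x - int y\<bar> \<le> \<lceil>r\<rceil>" using that by linarith
      then show "\<bar>e x - e y\<bar> \<le> \<lceil>r\<rceil>" by (simp only: e)
    qed
    then show "\<exists>s. \<forall>x\<in>UNIV. \<forall>y\<in>UNIV. \<bar>real x - real y\<bar> \<le> r \<longrightarrow>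
        mdist ?m (g [^] (e x) \<otimes> d) (g [^] (e y) \<otimes> d) \<le> s" by blast
  qed
  have coarse_up: "coarse_map nat_metric ?m up" unfolding up_def[abs_def] by (rule coarse_orbit) simp
  have coarse_down: "coarse_map nat_metric ?m down" unfolding down_def[abs_def] by (rule coarse_orbit) simp
  have coarse_pos: "coarse_map ?m nat_metric pos"
    unfolding coarse_map_def nat_metric_simps ms
  proof (intro conjI allI)
    show "pos ` carrier G \<subseteq> UNIV" by simp
    fix n
    have "{x \<in> carrier G. pos x = n} \<subseteq> {x \<in> carrier G. height x = int n} \<union> {x \<in> carrier G. height x = - 1 - int n}"
      by (auto simp: pos_def)
    then show "finite {x \<in> carrier G. pos x = n}" using fin by (meson finite_UnI finite_subset)
  next
    fix r :: real
    obtain s where s: "\<And>x y. x \<in> carrier G \<Longrightarrow> y \<in> carrier G \<Longrightarrow> mdist ?m x y \<le> r \<Longrightarrow> \<bar>height x - height y\<bar> \<le> s"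
      using height_lip[of r] by blast
    have "\<bar>real (pos x) - real (pos y)\<bar> \<le> real_of_int s"
      if "x \<in> carrier G" "y \<in> carrier G" "mdist ?m x y \<le> r" for x y
    proof -
      have "\<bar>int (pos x) - int (pos y)\<bar> \<le> \<bar>height x - height y\<bar>" by (auto simp: pos_def)
      then have "\<bar>int (pos x) - int (pos y)\<bar> \<le> s" using s[OF that] by linarith
      then have "real_of_int \<bar>int (pos x) - int (pos y)\<bar> \<le> real_of_int s" by (simp only: of_int_le_iff)
      then show ?thesis by simp
    qed
    then show "\<exists>s. \<forall>x\<in>carrier G. \<forall>y\<in>carrier G. mdist ?m x y \<le> r \<longrightarrow> \<bar>real (pos x) - real (pos y)\<bar> \<le> s" by blast
  qed
  define R where "R = Max ((\<lambda>e. real (word_length G S (inv e \<otimes> d))) ` ?D)"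
  have near: "mdist ?m x (g [^] (height x) \<otimes> d) \<le> R" if x: "x \<in> carrier G" for x
  proof -
    let ?e = "g [^] (- height x) \<otimes> x"
    have e: "?e \<in> ?D" "x = g [^] (height x) \<otimes> ?e" by (rule split[OF x])+
    have ec: "?e \<in> carrier G" using e(1) by blast
    let ?w = "inv ?e \<otimes> d"
    have "(g [^] (height x) \<otimes> ?e) \<otimes> ?w = g [^] (height x) \<otimes> (?e \<otimes> ?w)"
      using ec d pc by (intro m_assoc) simp_all
    also have "?e \<otimes> ?w = d" using ec d(1) by (intro inv_mult_cancel)
    finally have "x \<otimes> ?w = g [^] (height x) \<otimes> d" by (simp only: e(2)[symmetric])
    then have "mdist ?m x (g [^] (height x) \<otimes> d) = real (word_length G S ?w)"
      using word_dist_mult[of x ?w S] x ec d by (simp add: md)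
    also have "\<dots> \<le> R"
      unfolding R_def using fin[of 0] e(1) by (intro Max_ge finite_imageI imageI)
    finally show ?thesis .
  qed
  have ccA: "coarsely_clopen ?m A" using A coarsely_clopen_word_metric_iff[OF S] by blast
  show "subtopology (higson_corona ?m) (corona_part ?m A) homeomorphic_space higson_corona nat_metric"
  proof (rule corona_part_homeomorphic[OF fb finite_balls_nat ccA coarse_up coarse_pos])
    show "up ` mspace nat_metric \<subseteq> A" using h_up c_up by (auto simp: A_eq)
    show "pos (up n) = n" for n by (simp add: pos_def h_up)
    show "mdist ?m x (up (pos x)) \<le> R" if "x \<in> A" for x
      using near[of x] that by (simp add: A_eq up_def pos_def)
  qed
  have ccA': "coarsely_clopen ?m (carrier G - A)" using coarsely_clopen_complement[OF fb ccA] by (simp add: ms)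
  show "subtopology (higson_corona ?m) (corona_part ?m (carrier G - A)) homeomorphic_space higson_corona nat_metric"
  proof (rule corona_part_homeomorphic[OF fb finite_balls_nat ccA' coarse_down coarse_pos])
    show "down ` mspace nat_metric \<subseteq> carrier G - A" using h_down c_up by (auto simp: A_eq)
    show "pos (down n) = n" for n by (simp add: pos_def h_down)
    show "mdist ?m x (down (pos x)) \<le> R" if "x \<in> carrier G - A" for x
    proof -
      have x: "x \<in> carrier G" "height x < 0" using that by (auto simp: A_eq)
      then have "- 1 - int (pos x) = height x" by (simp add: pos_def)
      then show ?thesis using near[OF x(1)] by (simp add: down_def)
    qed
  qed
qed

end

section \<open>The ends of a Cayley graph\<close>

text \<open>Koenig's lemma. Only edges that lead away from \<open>P\<close> are followed, so that the path cannot return to a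
  vertex.\<close>

lemma koenig_ray:
  assumes fin: "\<And>x. finite (E `` {x})" and P: "finite P" and inf: "infinite (E\<^sup>* `` P)"
  obtains v :: "nat \<Rightarrow> 'a" where "inj v" "\<And>n. (v n, v (Suc n)) \<in> E"
proof -
  define dep where "dep x = (LEAST n. x \<in> (E ^^ n) `` P)" for x
  have ex: "\<exists>n. x \<in> (E ^^ n) `` P" if "x \<in> E\<^sup>* `` P" for x
    using that rtrancl_imp_relpow by blast
  have dep: "x \<in> (E ^^ dep x) `` P" if "x \<in> E\<^sup>* `` P" for x
    unfolding dep_def by (rule LeastI_ex[OF ex[OF that]])
  have dep_le: "dep x \<le> n" if "x \<in> (E ^^ n) `` P" for x n
    unfolding dep_def using that by (rule Least_le)
  define D where "D = {(x, y) \<in> E. dep y = Suc (dep x)}"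
  have reach: "\<exists>p\<in>P. (p, y) \<in> D\<^sup>*" if "y \<in> E\<^sup>* `` P" "dep y = n" for y n
    using that
  proof (induction n arbitrary: y)
    case 0
    then have "y \<in> P" using dep[OF 0(1)] by simp
    then show ?case by blast
  next
    case (Suc n)
    have "y \<in> (E ^^ Suc n) `` P" using dep[OF Suc.prems(1)] Suc.prems(2) by simp
    then obtain p x where p: "p \<in> P" "(p, x) \<in> E ^^ n" "(x, y) \<in> E" by auto
    have xS: "x \<in> (E ^^ n) `` P" using p by blast
    have "y \<in> (E ^^ Suc (dep x)) `` P"
    proof -
      have "x \<in> E\<^sup>* `` P" using p(1,2) relpow_imp_rtrancl by blast
      then obtain p' where "p' \<in> P" "(p', x) \<in> E ^^ dep x" using dep by blast
      then show ?thesis using p(3) by auto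
    qed
    then have "Suc n \<le> Suc (dep x)" using dep_le Suc.prems(2) by metis
    moreover have "dep x \<le> n" by (rule dep_le[OF xS])
    ultimately have dx: "dep x = n" by simp
    have "x \<in> E\<^sup>* `` P" using p(1,2) relpow_imp_rtrancl by blast
    then obtain q where "q \<in> P" "(q, x) \<in> D\<^sup>*" using Suc.IH dx by blast
    moreover have "(x, y) \<in> D" using p(3) dx Suc.prems(2) by (simp add: D_def)
    ultimately show ?case by (meson rtrancl.rtrancl_into_rtrancl)
  qed
  have "E\<^sup>* `` P \<subseteq> (\<Union>p\<in>P. D\<^sup>* `` {p})" using reach by blast
  then have "\<exists>p\<in>P. infinite (D\<^sup>* `` {p})" using P inf by (meson finite_UN_I finite_subset)
  then obtain p where p: "infinite (D\<^sup>* `` {p})" by blast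
  have step: "\<exists>y. infinite (D\<^sup>* `` {y}) \<and> (x, y) \<in> D" if x: "infinite (D\<^sup>* `` {x})" for x
  proof (rule ccontr)
    assume n: "\<not> ?thesis"
    have "D\<^sup>* `` {x} \<subseteq> insert x (\<Union>y\<in>D `` {x}. D\<^sup>* `` {y})"
      using converse_rtranclE by fastforce
    moreover have "finite (D `` {x})" by (rule finite_subset[OF _ fin[of x]]) (auto simp: D_def)
    then have "finite (insert x (\<Union>y\<in>D `` {x}. D\<^sup>* `` {y}))" using n by auto
    ultimately show False using x finite_subset by blast
  qed
  have "\<exists>v. \<forall>n. infinite (D\<^sup>* `` {v n}) \<and> (v n, v (Suc n)) \<in> D"
    by (rule dependent_nat_choice[of "\<lambda>_ x. infinite (D\<^sup>* `` {x})" "\<lambda>_ x y. (x, y) \<in> D"])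
       (use p step in blast)+
  then obtain v where v: "\<And>n. (v n, v (Suc n)) \<in> D" by blast
  have "dep (v n) = dep (v 0) + n" for n
    by (induction n) (use v in \<open>auto simp: D_def\<close>)
  then have "inj v" by (metis injI add_left_cancel)
  moreover have "(v n, v (Suc n)) \<in> E" for n using v by (auto simp: D_def)
  ultimately show ?thesis by (rule that)
qed

lemma card_quotient_2_iff:
  assumes R: "equiv A R"
  shows "card (A // R) = 2 \<longleftrightarrow> (\<exists>x\<in>A. \<exists>y\<in>A. (x, y) \<notin> R) \<and>
    \<not> (\<exists>x\<in>A. \<exists>y\<in>A. \<exists>z\<in>A. (x, y) \<notin> R \<and> (x, z) \<notin> R \<and> (y, z) \<notin> R)" (is "?L \<longleftrightarrow> ?R1 \<and> \<not> ?R2")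
proof
  assume ?L
  then obtain P Q where PQ: "A // R = {P, Q}" "P \<noteq> Q" by (auto simp: card_2_iff)
  have "P \<in> A // R" "Q \<in> A // R" using PQ by simp_all
  then obtain x y where x: "x \<in> A" "P = R `` {x}" and y: "y \<in> A" "Q = R `` {y}"
    by (meson quotientE)
  have "(x, y) \<notin> R" using PQ(2) eq_equiv_class_iff[OF R x(1) y(1)] x(2) y(2) by simp
  then have ?R1 using x(1) y(1) by blast
  moreover have "\<not> ?R2"
  proof
    assume ?R2
    then obtain x y z where xyz: "x \<in> A" "y \<in> A" "z \<in> A" "(x, y) \<notin> R" "(x, z) \<notin> R" "(y, z) \<notin> R" by blast
    have "R `` {x} \<in> {P, Q}" "R `` {y} \<in> {P, Q}" "R `` {z} \<in> {P, Q}"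
      unfolding PQ(1)[symmetric] using xyz(1-3) by (simp_all add: quotientI)
    then have "R `` {x} = R `` {y} \<or> R `` {x} = R `` {z} \<or> R `` {y} = R `` {z}" by auto
    then show False using xyz eq_equiv_class_iff[OF R] by blast
  qed
  ultimately show "?R1 \<and> \<not> ?R2" by blast
next
  assume RR: "?R1 \<and> \<not> ?R2"
  then obtain x y where xy: "x \<in> A" "y \<in> A" "(x, y) \<notin> R" by blast
  have "A // R \<subseteq> {R `` {x}, R `` {y}}"
  proof
    fix P assume "P \<in> A // R"
    then obtain z where z: "z \<in> A" "P = R `` {z}" by (rule quotientE)
    then have "(x, z) \<in> R \<or> (y, z) \<in> R" using RR xy by blast
    then show "P \<in> {R `` {x}, R `` {y}}" using equiv_class_eq[OF R] z(2) by blast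
  qed
  moreover have "{R `` {x}, R `` {y}} \<subseteq> A // R" using quotientI[OF xy(1)] quotientI[OF xy(2)] by simp
  ultimately have "A // R = {R `` {x}, R `` {y}}" by (rule equalityI)
  moreover have "R `` {x} \<noteq> R `` {y}" using eq_equiv_class_iff[OF R xy(1,2)] xy(3) by blast
  ultimately show ?L by simp
qed

definition edge_point :: "('a, 'b) monoid_scheme \<Rightarrow> 'a \<Rightarrow> 'a \<Rightarrow> real \<Rightarrow> 'a \<Rightarrow> real" where
  "edge_point G x y s = (\<lambda>k\<in>carrier G. (1 - s) * cayley_vertex G x k + s * cayley_vertex G y k)"

lemma cayley_edge_eq: "cayley_edge G x y = edge_point G x y ` {0..1}"
  by (simp add: cayley_edge_def edge_point_def)

lemma edge_point_apply:
  "k \<in> carrier G \<Longrightarrow> edge_point G x y s k = (1 - s) * (if k = x then 1 else 0) + s * (if k = y then 1 else 0)"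
  by (simp add: edge_point_def cayley_vertex_def)

lemma edge_point_0: "edge_point G x y 0 = cayley_vertex G x"
  by (rule ext) (simp add: edge_point_def cayley_vertex_def)

lemma edge_point_1: "edge_point G x y 1 = cayley_vertex G y"
  by (rule ext) (simp add: edge_point_def cayley_vertex_def)

lemma edge_point_refl: "edge_point G x x s = cayley_vertex G x"
  by (rule ext) (simp add: edge_point_def cayley_vertex_def)

lemma edge_point_swap: "edge_point G x y s = edge_point G y x (1 - s)"
  by (rule ext) (simp add: edge_point_def)

lemma cayley_edge_swap: "cayley_edge G x y = cayley_edge G y x"
proof -
  have "cayley_edge G x y \<subseteq> cayley_edge G y x" for x y :: 'a
    unfolding cayley_edge_eq
  proof
    fix z assume "z \<in> edge_point G x y ` {0..1}"
    then obtain s where "s \<in> {0..1}" "z = edge_point G x y s" by blast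
    then have "z = edge_point G y x (1 - s)" "1 - s \<in> {0..1}" by (simp_all add: edge_point_swap[of G x y])
    then show "z \<in> edge_point G y x ` {0..1}" by blast
  qed
  then show ?thesis by blast
qed

lemma cayley_edge_support:
  assumes "z \<in> cayley_edge G x y" "k \<in> carrier G" "z k \<noteq> 0"
  shows "k = x \<or> k = y"
  using assms by (auto simp: cayley_edge_eq edge_point_apply split: if_splits)

context group
begin

text \<open>The step by a word is a succession of steps by letters.\<close>

lemma almost_invariant_letters:
  assumes T: "generating_set G T" and A: "A \<subseteq> carrier G"
    and fin: "\<And>t. t \<in> T \<union> m_inv G ` T \<Longrightarrow> finite {x \<in> A. x \<otimes> t \<notin> A}"
  shows "almost_invariant G A"
  unfolding almost_invariant_def
proof (intro conjI ballI A)
  have L: "T \<union> m_inv G ` T \<subseteq> carrier G" by (rule generating_set_letters[OF T])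
  have word: "finite {x \<in> A. x \<otimes> word_product G ws \<notin> A}" if "set ws \<subseteq> T \<union> m_inv G ` T" for ws
    using that
  proof (induction ws)
    case Nil
    have "{x \<in> A. x \<otimes> word_product G [] \<notin> A} = {}" using A by (auto simp: subset_iff)
    then show ?case by (simp only: finite.emptyI)
  next
    case (Cons t ws)
    have t: "t \<in> T \<union> m_inv G ` T" "t \<in> carrier G" and ws: "set ws \<subseteq> T \<union> m_inv G ` T" using Cons.prems L by auto
    have wc: "word_product G ws \<in> carrier G" using ws L by (intro word_product_closed) blast
    have "{x \<in> A. x \<otimes> word_product G (t # ws) \<notin> A} \<subseteq> {x \<in> A. x \<otimes> t \<notin> A} \<union>
        (\<lambda>y. y \<otimes> inv t) ` {y \<in> A. y \<otimes> word_product G ws \<notin> A}"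
    proof
      fix x assume "x \<in> {x \<in> A. x \<otimes> word_product G (t # ws) \<notin> A}"
      then have x: "x \<in> A" "x \<in> carrier G" "(x \<otimes> t) \<otimes> word_product G ws \<notin> A"
        using A t(2) wc by (auto simp: m_assoc)
      show "x \<in> {x \<in> A. x \<otimes> t \<notin> A} \<union> (\<lambda>y. y \<otimes> inv t) ` {y \<in> A. y \<otimes> word_product G ws \<notin> A}"
      proof (cases "x \<otimes> t \<in> A")
        case True
        have "x = (x \<otimes> t) \<otimes> inv t" using x(2) t(2) by (simp add: inv_mult_cancel)
        then show ?thesis using True x(3) by blast
      next
        case False
        then show ?thesis using x(1) by blast
      qed
    qed
    then show ?case using fin[OF t(1)] Cons.IH[OF ws] by (meson finite_UnI finite_imageI finite_subset)
  qed
  fix w assume "w \<in> carrier G"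
  then obtain ws where "set ws \<subseteq> T \<union> m_inv G ` T" "word_product G ws = w"
    using word_exists[OF T] by blast
  then show "finite {x \<in> A. x \<otimes> w \<notin> A}" using word by blast
qed

end

locale finitely_generated_group = group +
  fixes T
  assumes finite_T: "finite T" and generating_T: "generating_set G T"
begin

abbreviation letters :: "'a set" where "letters \<equiv> T \<union> m_inv G ` T"
abbreviation graph :: "('a \<Rightarrow> real) topology" where "graph \<equiv> cayley_graph G T"

text \<open>The closed star of a vertex; the letter \<open>\<one>\<close> contributes the vertex itself, also if it lies on no
  edge.\<close>

definition star :: "'a \<Rightarrow> ('a \<Rightarrow> real) set" where
  "star x = (\<Union>t\<in>insert \<one> letters. cayley_edge G x (x \<otimes> t))"

lemma letters_closed: "t \<in> letters \<Longrightarrow> t \<in> carrier G"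
  using generating_set_letters[OF generating_T] by blast

lemma finite_letters: "finite letters"
  using finite_T by simp

lemma letters_inv: "t \<in> letters \<Longrightarrow> inv t \<in> letters"
  using letters_closed by auto

definition graph_points :: "('a \<Rightarrow> real) set" where
  "graph_points = cayley_vertex G ` carrier G \<union> (\<Union>g\<in>carrier G. \<Union>s\<in>T. cayley_edge G g (g \<otimes> s))"

lemma graph_points_PiE: "graph_points \<subseteq> topspace (product_topology (\<lambda>_. euclideanreal) (carrier G))"
  by (auto simp: graph_points_def PiE_iff cayley_edge_eq edge_point_def cayley_vertex_def)

lemma topspace_graph: "topspace graph = graph_points"
  unfolding cayley_graph_def graph_points_def[symmetric] topspace_subtopology
  by (rule Int_absorb1[OF graph_points_PiE])

lemma star_subset: "x \<in> carrier G \<Longrightarrow> star x \<subseteq> graph_points"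
proof
  fix z assume x: "x \<in> carrier G" and "z \<in> star x"
  then obtain t where t: "t \<in> insert \<one> letters" "z \<in> cayley_edge G x (x \<otimes> t)" unfolding star_def by blast
  show "z \<in> graph_points"
  proof (cases "t = \<one>")
    case True
    then have "z = cayley_vertex G x" using t(2) x by (auto simp: cayley_edge_eq edge_point_refl)
    then show ?thesis using x by (auto simp: graph_points_def)
  next
    case False
    show ?thesis
    proof (cases "t \<in> T")
      case True
      then show ?thesis using t(2) x by (auto simp: graph_points_def)
    next
      case False
      then obtain s where s: "s \<in> T" "t = inv s" using t(1) \<open>t \<noteq> \<one>\<close> by blast
      have sc: "s \<in> carrier G" using letters_closed s(1) by blast
      have "(x \<otimes> t) \<otimes> s = x" using x sc s(2) by (simp add: inv_mult_cancel)
      then have "z \<in> cayley_edge G (x \<otimes> t) ((x \<otimes> t) \<otimes> s)" using t(2) cayley_edge_swap by metis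
      moreover have "x \<otimes> t \<in> carrier G" using x sc s(2) by simp
      ultimately show ?thesis using s(1) unfolding graph_points_def by blast
    qed
  qed
qed

lemma graph_point_in_star:
  assumes z: "z \<in> graph_points" and k: "k \<in> carrier G" "z k \<noteq> 0"
  shows "z \<in> star k"
proof -
  from z consider x where "x \<in> carrier G" "z = cayley_vertex G x"
    | x s where "x \<in> carrier G" "s \<in> T" "z \<in> cayley_edge G x (x \<otimes> s)"
    unfolding graph_points_def by blast
  then show ?thesis
  proof cases
    case 1
    then have "k = x" using k by (auto simp: cayley_vertex_def split: if_splits)
    then have "z = edge_point G k (k \<otimes> \<one>) 0" using 1 by (simp add: edge_point_0)
    then have "z \<in> cayley_edge G k (k \<otimes> \<one>)" unfolding cayley_edge_eq by simp
    then show ?thesis unfolding star_def by blast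
  next
    case 2
    have sc: "s \<in> carrier G" using letters_closed 2(2) by blast
    have "k = x \<or> k = x \<otimes> s" by (rule cayley_edge_support[OF 2(3) k])
    then show ?thesis
    proof
      assume "k = x"
      then show ?thesis using 2(2,3) unfolding star_def by blast
    next
      assume kx: "k = x \<otimes> s"
      then have "x = k \<otimes> inv s" using 2(1) sc by (simp add: inv_mult_cancel)
      then have "z \<in> cayley_edge G k (k \<otimes> inv s)" using 2(3) kx cayley_edge_swap by metis
      then show ?thesis using 2(2) unfolding star_def by blast
    qed
  qed
qed

lemma graph_point_positive:
  assumes z: "z \<in> graph_points"
  obtains k where "k \<in> carrier G" "0 < z k"
proof -
  have edge: "\<exists>k\<in>carrier G. 0 < w k" if w: "w \<in> cayley_edge G x y" and x: "x \<in> carrier G" and y: "y \<in> carrier G" for w x y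
  proof -
    obtain s where s: "0 \<le> s" "s \<le> 1" "w = edge_point G x y s" using w by (auto simp: cayley_edge_eq)
    show ?thesis
    proof (cases "s = 1")
      case True
      then have "0 < w y" using s(3) y by (simp add: edge_point_1 cayley_vertex_def)
      then show ?thesis using y by blast
    next
      case False
      then have "0 < w x" using s x by (simp add: edge_point_apply)
      then show ?thesis using x by blast
    qed
  qed
  from z consider x where "x \<in> carrier G" "z = cayley_vertex G x"
    | x s where "x \<in> carrier G" "s \<in> T" "z \<in> cayley_edge G x (x \<otimes> s)"
    unfolding graph_points_def by blast
  then have "\<exists>k\<in>carrier G. 0 < z k"
  proof cases
    case 1
    then have "0 < z x" by (simp add: cayley_vertex_def)
    then show ?thesis using 1 by blast
  next
    case 2
    then show ?thesis using edge[OF 2(3,1)] letters_closed[of s] by simp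
  qed
  then show ?thesis using that by blast
qed

lemma continuous_edge:
  assumes "cayley_edge G x y \<subseteq> graph_points"
  shows "continuous_map (top_of_set {0..1}) graph (edge_point G x y)"
  unfolding cayley_graph_def graph_points_def[symmetric] continuous_map_in_subtopology
proof
  show "continuous_map (top_of_set {0..1}) (product_topology (\<lambda>_. euclideanreal) (carrier G)) (edge_point G x y)"
    unfolding continuous_map_componentwise edge_point_def
    by (auto intro!: continuous_intros)
  show "edge_point G x y \<in> topspace (top_of_set {0..1}) \<rightarrow> graph_points"
    using assms by (auto simp: cayley_edge_eq)
qed

lemma compact_edge:
  assumes "cayley_edge G x y \<subseteq> graph_points"
  shows "compactin graph (cayley_edge G x y)"
  unfolding cayley_edge_eq
  by (rule image_compactin[OF _ continuous_edge[OF assms]]) (simp add: compactin_subtopology)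

lemma path_connected_edge:
  assumes "cayley_edge G x y \<subseteq> graph_points"
  shows "path_connectedin graph (cayley_edge G x y)"
  unfolding cayley_edge_eq
  by (rule path_connectedin_continuous_map_image[OF continuous_edge[OF assms]])
     (simp add: path_connectedin_subtopology)

lemma compact_star: "x \<in> carrier G \<Longrightarrow> compactin graph (star x)"
  unfolding star_def
proof (rule compactin_Union)
  assume x: "x \<in> carrier G"
  show "finite ((\<lambda>t. cayley_edge G x (x \<otimes> t)) ` insert \<one> letters)" using finite_letters by simp
  fix S assume "S \<in> (\<lambda>t. cayley_edge G x (x \<otimes> t)) ` insert \<one> letters"
  then obtain t where t: "t \<in> insert \<one> letters" "S = cayley_edge G x (x \<otimes> t)" by blast
  then have "S \<subseteq> graph_points" using star_subset[OF x] unfolding star_def by blast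
  then show "compactin graph S" using compact_edge t(2) by blast
qed

lemma compact_stars:
  assumes "finite W" "W \<subseteq> carrier G"
  shows "compactin graph (\<Union>k\<in>W. star k)"
  by (rule compactin_Union) (use assms compact_star in auto)

lemma continuous_coordinate:
  assumes "k \<in> carrier G"
  shows "continuous_map graph euclideanreal (\<lambda>z. z k)"
  unfolding cayley_graph_def
  by (rule continuous_map_from_subtopology) (rule continuous_map_product_projection[OF assms])

lemma open_positive:
  assumes "k \<in> carrier G"
  shows "openin graph {z \<in> graph_points. 0 < z k}"
proof -
  have "openin graph {z \<in> topspace graph. z k \<in> {0<..}}"
    by (rule openin_continuous_map_preimage[OF continuous_coordinate[OF assms]]) simp
  then show ?thesis by (simp add: topspace_graph)
qed

text \<open>Together with the compactness of closed stars this translates between compact subsets of the graph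
  and finite sets of vertices: the open stars cover the graph.\<close>

lemma compact_meets_finitely_many:
  assumes K: "compactin graph K"
  obtains V where "finite V" "V \<subseteq> carrier G" "\<And>z. z \<in> K \<Longrightarrow> \<exists>k\<in>V. 0 < z k"
proof -
  define Pos where "Pos k = {z \<in> graph_points. 0 < z k}" for k
  have Kg: "K \<subseteq> graph_points" using compactin_subset_topspace[OF K] by (simp add: topspace_graph)
  have "K \<subseteq> \<Union>(Pos ` carrier G)"
  proof
    fix z assume "z \<in> K"
    then have z: "z \<in> graph_points" using Kg by blast
    obtain k where "k \<in> carrier G" "0 < z k" by (rule graph_point_positive[OF z])
    then show "z \<in> \<Union>(Pos ` carrier G)" using z unfolding Pos_def by blast
  qed
  moreover have "openin graph U" if "U \<in> Pos ` carrier G" for U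
    using that open_positive unfolding Pos_def by blast
  ultimately obtain \<F> where F: "finite \<F>" "\<F> \<subseteq> Pos ` carrier G" "K \<subseteq> \<Union>\<F>"
    using compactinD[OF K, of "Pos ` carrier G"] by blast
  obtain V where V: "V \<subseteq> carrier G" "finite V" "\<F> = Pos ` V"
    using finite_subset_image[OF F(1,2)] by blast
  show ?thesis
  proof (rule that[OF V(2,1)])
    fix z assume "z \<in> K"
    then have "z \<in> \<Union>(Pos ` V)" using F(3) V(3) by blast
    then show "\<exists>k\<in>V. 0 < z k" unfolding Pos_def by blast
  qed
qed

lemma Hausdorff_graph: "Hausdorff_space graph"
  unfolding cayley_graph_def
  by (intro Hausdorff_space_subtopology) (simp add: Hausdorff_space_product_topology)

text \<open>The graph is metrizable because the group is countable. It follows that properness of a ray is a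
  matter of preimages of compact sets.\<close>

lemma k_space_graph: "k_space graph"
proof -
  have "carrier G \<subseteq> word_product G ` lists letters"
  proof
    fix g assume "g \<in> carrier G"
    then obtain ws where "set ws \<subseteq> letters" "word_product G ws = g"
      using word_exists[OF generating_T] by blast
    then show "g \<in> word_product G ` lists letters" by blast
  qed
  moreover have "countable (lists letters)" using finite_letters by (intro countable_lists countable_finite)
  ultimately have "countable (carrier G)" by (meson countable_image countable_subset)
  then have "metrizable_space (product_topology (\<lambda>_. euclideanreal) (carrier G))"
    by (auto simp: metrizable_space_product_topology metrizable_space_euclidean intro: countable_subset)
  then have "metrizable_space graph"
    unfolding cayley_graph_def by (rule metrizable_space_subtopology)
  then show ?thesis by (rule metrizable_imp_k_space)
qed

end

context finitely_generated_group
begin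

definition tail_component :: "('a \<Rightarrow> real) set \<Rightarrow> (real \<Rightarrow> 'a \<Rightarrow> real) \<Rightarrow> ('a \<Rightarrow> real) set \<Rightarrow> bool" where
  "tail_component K r C \<longleftrightarrow> C \<in> path_components_of (subtopology graph (topspace graph - K)) \<and>
     (\<exists>N::nat. r ` {real N..} \<subseteq> C)"

text \<open>The two rays may settle in the common component at different times; the later of the two serves for
  both.\<close>

lemma same_end_iff:
  "same_end graph r1 r2 \<longleftrightarrow> (\<forall>K. compactin graph K \<longrightarrow> (\<exists>C. tail_component K r1 C \<and> tail_component K r2 C))"
proof
  assume "same_end graph r1 r2"
  then show "\<forall>K. compactin graph K \<longrightarrow> (\<exists>C. tail_component K r1 C \<and> tail_component K r2 C)"
    unfolding same_end_def tail_component_def by blast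
next
  assume R: "\<forall>K. compactin graph K \<longrightarrow> (\<exists>C. tail_component K r1 C \<and> tail_component K r2 C)"
  show "same_end graph r1 r2"
    unfolding same_end_def
  proof (intro allI impI)
    fix K assume "compactin graph K"
    then obtain C N M where C: "C \<in> path_components_of (subtopology graph (topspace graph - K))"
      "r1 ` {real (N::nat)..} \<subseteq> C" "r2 ` {real (M::nat)..} \<subseteq> C"
      using R unfolding tail_component_def by blast
    have "r1 ` {real (max N M)..} \<subseteq> r1 ` {real N..}" "r2 ` {real (max N M)..} \<subseteq> r2 ` {real M..}"
      by (intro image_mono; simp)+
    then have "r1 ` {real (max N M)..} \<subseteq> C" "r2 ` {real (max N M)..} \<subseteq> C" using C(2,3) by blast+
    then show "\<exists>N::nat. \<exists>C\<in>path_components_of (subtopology graph (topspace graph - K)).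
        r1 ` {real N..} \<subseteq> C \<and> r2 ` {real N..} \<subseteq> C"
      using C(1) by blast
  qed
qed

lemma tail_component_unique:
  assumes "tail_component K r C" "tail_component K r D"
  shows "C = D"
proof -
  obtain N M where NM: "r ` {real (N::nat)..} \<subseteq> C" "r ` {real (M::nat)..} \<subseteq> D"
    using assms unfolding tail_component_def by blast
  have "r (real (max N M)) \<in> C" "r (real (max N M)) \<in> D" using NM by (auto simp: image_subset_iff)
  then have "\<not> disjnt C D" by (auto simp: disjnt_def)
  then show ?thesis
    using assms path_components_of_disjoint unfolding tail_component_def by blast
qed

lemma proper_ray_eventually_avoids:
  assumes r: "proper_ray graph r" and K: "compactin graph K"
  obtains N :: nat where "\<And>t. real N \<le> t \<Longrightarrow> r t \<notin> K"
proof -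
  have "compactin (top_of_set {0..}) {t \<in> topspace (top_of_set {0..}). r t \<in> K}"
    using r K unfolding proper_ray_def by (intro compactin_proper_map_preimage) auto
  then have "bounded {t \<in> topspace (top_of_set {0..}). r t \<in> K}"
    by (intro compact_imp_bounded) (simp add: compactin_subtopology)
  then obtain B where B: "\<And>t. 0 \<le> t \<Longrightarrow> r t \<in> K \<Longrightarrow> \<bar>t\<bar> \<le> B"
    unfolding bounded_iff by auto
  have "r t \<notin> K" if t: "real (Suc (nat \<lceil>B\<rceil>)) \<le> t" for t
  proof
    assume "r t \<in> K"
    moreover have "0 \<le> t" using t by linarith
    ultimately have "\<bar>t\<bar> \<le> B" using B by blast
    then show False using t by linarith
  qed
  then show ?thesis by (rule that)
qed

lemma tail_component_exists:
  assumes r: "proper_ray graph r" and K: "compactin graph K"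
  obtains C where "tail_component K r C"
proof -
  obtain N :: nat where N: "\<And>t. real N \<le> t \<Longrightarrow> r t \<notin> K" by (rule proper_ray_eventually_avoids[OF r K]) blast
  let ?X = "subtopology graph (topspace graph - K)"
  have cont: "continuous_map (top_of_set {0..}) graph r" using r by (simp add: proper_ray_def)
  have "continuous_map (top_of_set {real N..}) graph r"
    using continuous_map_from_subtopology_mono[OF cont, of "{real N..}"] by auto
  moreover have "r ` {real N..} \<subseteq> topspace graph - K"
    using continuous_map_image_subset_topspace[OF cont] N by force
  ultimately have "continuous_map (top_of_set {real N..}) ?X r"
    by (auto simp: continuous_map_in_subtopology)
  then have "path_connectedin ?X (r ` {real N..})"
    by (rule path_connectedin_continuous_map_image)
       (simp add: path_connectedin_subtopology convex_imp_path_connected)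
  moreover have "r (real N) \<in> topspace ?X" using \<open>r ` {real N..} \<subseteq> topspace graph - K\<close> by auto
  then have "topspace ?X \<noteq> {}" by blast
  ultimately obtain C where "C \<in> path_components_of ?X" "r ` {real N..} \<subseteq> C"
    using exists_path_component_of_superset by metis
  then show ?thesis using that unfolding tail_component_def by blast
qed

lemma tail_component_mono:
  assumes "tail_component K' r C'" "K \<subseteq> K'"
  obtains C where "C' \<subseteq> C" "tail_component K r C"
proof -
  let ?X = "subtopology graph (topspace graph - K)" and ?X' = "subtopology graph (topspace graph - K')"
  have C': "C' \<in> path_components_of ?X'" using assms(1) by (simp add: tail_component_def)
  have "path_connectedin ?X' C'" using C' by (rule path_connectedin_path_components_of)
  then have "path_connectedin ?X C'" using assms(2) by (auto simp: path_connectedin_subtopology)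
  moreover have "C' \<noteq> {}" by (rule nonempty_path_components_of[OF C'])
  then have "topspace ?X \<noteq> {}" using path_connectedin_subset_topspace[OF \<open>path_connectedin ?X C'\<close>] by blast
  ultimately obtain C where "C \<in> path_components_of ?X" "C' \<subseteq> C"
    using exists_path_component_of_superset by metis
  then show ?thesis using that assms(1) unfolding tail_component_def by blast
qed

definition component_vertices :: "('a \<Rightarrow> real) set \<Rightarrow> 'a set" where
  "component_vertices C = {x \<in> carrier G. cayley_vertex G x \<in> C}"

text \<open>An edge that leaves the component of the tail meets the compact set, so that the vertices in
  the component have finite frontier; and there are infinitely many, since the ray leaves every
  finite set of stars.\<close>

lemma tail_component_vertices:
  assumes r: "proper_ray graph r" and K: "compactin graph K" and C: "tail_component K r C"
  shows "almost_invariant G (component_vertices C)" and "infinite (component_vertices C)"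
proof -
  let ?A = "component_vertices C" and ?X = "subtopology graph (topspace graph - K)"
  have Ac: "?A \<subseteq> carrier G" by (auto simp: component_vertices_def)
  have Cp: "C \<in> path_components_of ?X" using C by (simp add: tail_component_def)
  obtain V where V: "finite V" "V \<subseteq> carrier G" "\<And>z. z \<in> K \<Longrightarrow> \<exists>k\<in>V. 0 < z k"
    by (rule compact_meets_finitely_many[OF K]) blast
  \<comment> \<open>An edge without vertex in \<open>V\<close> lies in one component.\<close>
  have edge: "cayley_edge G x (x \<otimes> t) \<subseteq> C"
    if x: "x \<in> carrier G" "t \<in> insert \<one> letters" "x \<notin> V" "x \<otimes> t \<notin> V" and z: "z \<in> C" "z \<in> cayley_edge G x (x \<otimes> t)" for x t z
  proof -
    let ?e = "cayley_edge G x (x \<otimes> t)"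
    have e: "?e \<subseteq> graph_points" using star_subset[OF x(1)] x(2) unfolding star_def by blast
    have "?e \<inter> K = {}"
    proof (rule ccontr)
      assume "?e \<inter> K \<noteq> {}"
      then obtain w where w: "w \<in> ?e" "w \<in> K" by blast
      then obtain k where k: "k \<in> V" "0 < w k" using V(3) by blast
      then have "k = x \<or> k = x \<otimes> t" using cayley_edge_support[OF w(1), of k] V(2) by auto
      then show False using k(1) x(3,4) by blast
    qed
    then have "path_connectedin ?X ?e"
      using path_connected_edge[OF e] e by (auto simp: path_connectedin_subtopology topspace_graph)
    moreover have "\<not> disjnt C ?e" using z by (auto simp: disjnt_def)
    ultimately show ?thesis using path_components_of_maximal[OF Cp] by blast
  qed
  show "almost_invariant G ?A"
  proof (rule almost_invariant_letters[OF generating_T Ac])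
    fix t assume t: "t \<in> letters"
    have tc: "t \<in> carrier G" using t by (rule letters_closed)
    have "{x \<in> ?A. x \<otimes> t \<notin> ?A} \<subseteq> V \<union> (\<lambda>k. k \<otimes> inv t) ` V"
    proof
      fix x assume "x \<in> {x \<in> ?A. x \<otimes> t \<notin> ?A}"
      then have x: "x \<in> carrier G" "cayley_vertex G x \<in> C" "x \<otimes> t \<notin> ?A"
        by (simp_all add: component_vertices_def)
      have "cayley_vertex G x = edge_point G x (x \<otimes> t) 0" "cayley_vertex G (x \<otimes> t) = edge_point G x (x \<otimes> t) 1"
        by (simp_all add: edge_point_0 edge_point_1)
      then have v: "cayley_vertex G x \<in> cayley_edge G x (x \<otimes> t)" "cayley_vertex G (x \<otimes> t) \<in> cayley_edge G x (x \<otimes> t)"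
        unfolding cayley_edge_eq by simp_all
      have "cayley_vertex G (x \<otimes> t) \<notin> C" using x tc by (simp add: component_vertices_def)
      then have "x \<in> V \<or> x \<otimes> t \<in> V" using edge[OF x(1) _ _ _ x(2) v(1)] t v(2) by blast
      moreover have "x = (x \<otimes> t) \<otimes> inv t" using x(1) tc by (simp add: inv_mult_cancel)
      ultimately show "x \<in> V \<union> (\<lambda>k. k \<otimes> inv t) ` V" by blast
    qed
    moreover have "finite (V \<union> (\<lambda>k. k \<otimes> inv t) ` V)" using V(1) by simp
    ultimately show "finite {x \<in> ?A. x \<otimes> t \<notin> ?A}" by (rule finite_subset)
  qed
  show "infinite ?A"
  proof
    assume fin: "finite ?A"
    define W where "W = V \<union> (\<Union>t\<in>letters. (\<lambda>k. k \<otimes> t) ` V) \<union> ?A"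
    have Wf: "finite W" using V(1) fin finite_letters by (simp add: W_def)
    have Wc: "W \<subseteq> carrier G" using V(2) Ac letters_closed by (auto simp: W_def)
    obtain N :: nat where N: "\<And>t. real N \<le> t \<Longrightarrow> r t \<notin> (\<Union>k\<in>W. star k)"
      by (rule proper_ray_eventually_avoids[OF r compact_stars[OF Wf Wc]]) blast
    obtain M :: nat where M: "r ` {real M..} \<subseteq> C" using C unfolding tail_component_def by blast
    let ?z = "r (real (max N M))"
    have zC: "?z \<in> C" using M by (auto simp: image_subset_iff)
    have "C \<subseteq> topspace ?X" by (rule path_components_of_subset[OF Cp])
    then have zg: "?z \<in> graph_points" using zC by (auto simp: topspace_graph)
    obtain k where k: "k \<in> carrier G" "0 < ?z k" by (rule graph_point_positive[OF zg])
    have zs: "?z \<in> star k" using graph_point_in_star[OF zg k(1)] k(2) by simp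
    have kW: "k \<notin> W" using N[of "real (max N M)"] zs by auto
    obtain t where t: "t \<in> insert \<one> letters" "?z \<in> cayley_edge G k (k \<otimes> t)" using zs unfolding star_def by blast
    have kV: "k \<notin> V" using kW by (simp add: W_def)
    moreover have "k \<otimes> t \<notin> V"
    proof (cases "t = \<one>")
      case True
      then show ?thesis using kV k(1) by simp
    next
      case False
      then have t': "t \<in> letters" using t(1) by blast
      show ?thesis
      proof
        assume "k \<otimes> t \<in> V"
        moreover have "k = (k \<otimes> t) \<otimes> inv t" using k(1) letters_closed[OF t'] by (simp add: inv_mult_cancel)
        moreover have "inv t \<in> letters" by (rule letters_inv[OF t'])
        ultimately have "k \<in> W" unfolding W_def by blast
        then show False using kW by blast
      qed
    qed
    ultimately have "cayley_edge G k (k \<otimes> t) \<subseteq> C" by (intro edge[OF k(1) t(1) _ _ zC t(2)])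
    moreover have "edge_point G k (k \<otimes> t) 0 \<in> cayley_edge G k (k \<otimes> t)" unfolding cayley_edge_eq by simp
    ultimately have "cayley_vertex G k \<in> C" by (auto simp: edge_point_0)
    then have "k \<in> ?A" using k(1) by (simp add: component_vertices_def)
    then show False using kW by (simp add: W_def)
  qed
qed

lemma component_vertices_disjoint:
  assumes "tail_component K r C" "tail_component K r' C'" "C \<noteq> C'"
  shows "component_vertices C \<inter> component_vertices C' = {}"
proof -
  have "disjnt C C'"
    using assms path_components_of_disjoint unfolding tail_component_def by blast
  then show ?thesis by (auto simp: component_vertices_def disjnt_def)
qed

text \<open>The piecewise linear ray along an infinite path without repeated vertices. It is written down by its
  coordinates, each of which is a single tent function or zero, so that its continuity is apparent;
  that it runs through the edges of the path is the next lemma.\<close>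

definition path_ray :: "(nat \<Rightarrow> 'a) \<Rightarrow> real \<Rightarrow> 'a \<Rightarrow> real" where
  "path_ray v t = (\<lambda>k\<in>carrier G. if k \<in> range v then max 0 (1 - \<bar>t - real (inv_into UNIV v k)\<bar>) else 0)"

lemma path_ray_on_edge:
  assumes v: "inj v" and t: "real n \<le> t" "t \<le> real (Suc n)"
  shows "path_ray v t = edge_point G (v n) (v (Suc n)) (t - real n)"
proof (rule ext)
  fix k
  show "path_ray v t k = edge_point G (v n) (v (Suc n)) (t - real n) k"
  proof (cases "k \<in> carrier G")
    case True
    have ne: "v n \<noteq> v (Suc n)" using v by (simp add: inj_eq)
    show ?thesis
    proof (cases "k \<in> range v")
      case True
      then obtain j where j: "k = v j" by blast
      have "inv_into UNIV v k = j" using v j by simp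
      then have "path_ray v t k = max 0 (1 - \<bar>t - real j\<bar>)"
        using \<open>k \<in> carrier G\<close> True by (simp add: path_ray_def)
      moreover have "edge_point G (v n) (v (Suc n)) (t - real n) k =
          (1 - (t - real n)) * (if j = n then 1 else 0) + (t - real n) * (if j = Suc n then 1 else 0)"
        using \<open>k \<in> carrier G\<close> v j by (simp add: edge_point_apply inj_eq)
      moreover have "real (Suc n) + 1 \<le> real j \<or> real j + 1 \<le> real n" if "j \<noteq> n" "j \<noteq> Suc n" using that by linarith
      ultimately show ?thesis using t by (cases "j = n"; cases "j = Suc n") auto
    next
      case False
      then have "k \<noteq> v n" "k \<noteq> v (Suc n)" by blast+
      then show ?thesis using \<open>k \<in> carrier G\<close> False by (simp add: path_ray_def edge_point_apply)
    qed
  next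
    case False
    then show ?thesis by (simp add: path_ray_def edge_point_def)
  qed
qed

lemma path_ray_vertex: "inj v \<Longrightarrow> path_ray v (real n) = cayley_vertex G (v n)"
  using path_ray_on_edge[of v n "real n"] by (simp add: edge_point_0)

lemma proper_path_ray:
  assumes v: "inj v" "\<And>n. v n \<in> carrier G" and step: "\<And>n. \<exists>t\<in>letters. v (Suc n) = v n \<otimes> t"
  shows "proper_ray graph (path_ray v)"
proof -
  have on_edge: "path_ray v t \<in> graph_points" if "0 \<le> t" for t
  proof -
    define n where "n = nat \<lfloor>t\<rfloor>"
    have n: "real n \<le> t" "t \<le> real (Suc n)" using that by (simp_all add: n_def) linarith+
    obtain s where s: "s \<in> letters" "v (Suc n) = v n \<otimes> s" using step by blast
    have "t - real n \<in> {0..1}" using n by simp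
    then have "path_ray v t \<in> cayley_edge G (v n) (v n \<otimes> s)"
      unfolding path_ray_on_edge[OF v(1) n] s(2) cayley_edge_eq by blast
    then show ?thesis using star_subset[OF v(2)[of n]] s(1) unfolding star_def by blast
  qed
  have cont: "continuous_map (top_of_set {0..}) graph (path_ray v)"
    unfolding cayley_graph_def graph_points_def[symmetric] continuous_map_in_subtopology
  proof
    have "continuous_map (top_of_set {0..}) euclideanreal (\<lambda>t. path_ray v t k)" if "k \<in> carrier G" for k
      using that by (cases "k \<in> range v") (auto simp: path_ray_def intro!: continuous_intros)
    then show "continuous_map (top_of_set {0..}) (product_topology (\<lambda>_. euclideanreal) (carrier G)) (path_ray v)"
      unfolding continuous_map_componentwise by (auto simp: path_ray_def)
    show "path_ray v \<in> topspace (top_of_set {0..}) \<rightarrow> graph_points" using on_edge by auto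
  qed
  have "compactin (top_of_set {0..}) {t \<in> topspace (top_of_set {0..}). path_ray v t \<in> K}"
    if K: "compactin graph K" for K
  proof -
    let ?S = "{t \<in> topspace (top_of_set {0..}). path_ray v t \<in> K}"
    obtain V where V: "finite V" "V \<subseteq> carrier G" "\<And>z. z \<in> K \<Longrightarrow> \<exists>k\<in>V. 0 < z k"
      by (rule compact_meets_finitely_many[OF K]) blast
    have "closedin graph K" by (rule compactin_imp_closedin[OF Hausdorff_graph K])
    then have "closedin (top_of_set {0..}) ?S" by (rule closedin_continuous_map_preimage[OF cont])
    then have "closed ?S" by (rule closedin_closed_trans) simp
    moreover have "bounded ?S"
    proof -
      define M where "M = Max (insert 0 ((\<lambda>k. real (inv_into UNIV v k)) ` V))"
      have "\<bar>t\<bar> \<le> M + 1" if t: "t \<in> ?S" for t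
      proof -
        have t0: "0 \<le> t" "path_ray v t \<in> K" using t by auto
        obtain k where k: "k \<in> V" "0 < path_ray v t k" using V(3)[OF t0(2)] by blast
        have "k \<in> carrier G" using k(1) V(2) by blast
        then have "\<bar>t - real (inv_into UNIV v k)\<bar> < 1"
          using k(2) by (simp add: path_ray_def split: if_splits)
        moreover have "real (inv_into UNIV v k) \<le> M" unfolding M_def using V(1) k(1) by (intro Max_ge) simp_all
        ultimately show ?thesis using t0(1) by linarith
      qed
      then show ?thesis unfolding bounded_iff by (intro exI[of _ "M + 1"]) simp
    qed
    ultimately have "compact ?S" by (simp add: compact_eq_bounded_closed)
    then show ?thesis by (auto simp: compactin_subtopology)
  qed
  then have "proper_map (top_of_set {0..}) graph (path_ray v)"
    using proper_eq_compact_map[OF k_space_graph Hausdorff_imp_kc_space[OF Hausdorff_graph]] cont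
      continuous_map_funspace[OF cont] by blast
  then show ?thesis unfolding proper_ray_def using cont by blast
qed

text \<open>An infinite set with finite frontier contains a path to infinity by Koenig's lemma: every
  vertex of the set is joined within the set to the frontier or to the identity, by the initial
  part of a path to the identity.\<close>

lemma almost_invariant_path:
  assumes A: "almost_invariant G A" "infinite A"
  obtains v where "inj v" "\<And>n. v n \<in> A" "\<And>n. \<exists>t\<in>letters. v (Suc n) = v n \<otimes> t"
proof -
  have Ac: "A \<subseteq> carrier G" by (rule almost_invariantD(2)[OF A(1)])
  define E where "E = {(x, y). x \<in> A \<and> y \<in> A \<and> (\<exists>t\<in>letters. y = x \<otimes> t)}"
  define P where "P = insert \<one> (frontier_vertices T A)"
  have Pf: "finite P" using finite_frontier_vertices[OF finite_T generating_T A(1)] by (simp add: P_def)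
  have Ef: "finite (E `` {x})" for x
    by (rule finite_subset[of _ "(\<lambda>t. x \<otimes> t) ` letters"]) (use finite_letters in \<open>auto simp: E_def\<close>)
  have "x \<in> E\<^sup>* `` P" if "set ws \<subseteq> letters" "x \<in> A" "x \<otimes> word_product G ws = \<one>" for ws x
    using that
  proof (induction ws arbitrary: x)
    case Nil
    then have "x = \<one>" using Ac by (auto simp: subset_iff)
    then show ?case by (auto simp: P_def)
  next
    case (Cons t ws)
    have t: "t \<in> letters" "t \<in> carrier G" and ws: "set ws \<subseteq> letters"
      using Cons.prems(1) letters_closed by auto
    have x: "x \<in> carrier G" using Cons.prems(2) Ac by blast
    have wc: "word_product G ws \<in> carrier G" using ws letters_closed by (intro word_product_closed) blast
    show ?case
    proof (cases "x \<otimes> t \<in> A")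
      case True
      have "(x \<otimes> t) \<otimes> word_product G ws = \<one>" using Cons.prems(3) x t(2) wc by (simp add: m_assoc)
      then have "x \<otimes> t \<in> E\<^sup>* `` P" using Cons.IH[OF ws True] by blast
      moreover have "x = (x \<otimes> t) \<otimes> inv t" using x t(2) by (simp add: inv_mult_cancel)
      then have "(x \<otimes> t, x) \<in> E" using True Cons.prems(2) letters_inv[OF t(1)] unfolding E_def by blast
      ultimately show ?thesis by (meson Image_iff rtrancl.rtrancl_into_rtrancl)
    next
      case False
      then have "x \<in> P" using x t(1) Cons.prems(2) unfolding P_def frontier_vertices_def by blast
      then show ?thesis by blast
    qed
  qed
  moreover have "\<exists>ws. set ws \<subseteq> letters \<and> x \<otimes> word_product G ws = \<one>" if "x \<in> A" for x
  proof -
    have x: "x \<in> carrier G" using that Ac by blast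
    then obtain ws where "set ws \<subseteq> letters" "word_product G ws = inv x"
      using word_exists[OF generating_T, of "inv x"] by auto
    then show ?thesis using x by auto
  qed
  ultimately have "A \<subseteq> E\<^sup>* `` P" by blast
  then have "infinite (E\<^sup>* `` P)" using A(2) finite_subset by blast
  then obtain v where v: "inj v" "\<And>n. (v n, v (Suc n)) \<in> E"
    by (rule koenig_ray[OF Ef Pf]) blast
  show ?thesis
    by (rule that[OF v(1)]) (use v(2) in \<open>auto simp: E_def\<close>)
qed

text \<open>Rays in disjoint pieces are separated by the closed stars of the frontier: outside of them no
  point of the graph lies on an edge between the piece and its complement.\<close>

lemma disjoint_pieces_not_same_end:
  assumes A: "almost_invariant G A" and v: "inj v" "\<And>n. v n \<in> A"
    and w: "inj w" "\<And>n. w n \<in> carrier G - A"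
  shows "\<not> same_end graph (path_ray v) (path_ray w)"
proof
  assume same: "same_end graph (path_ray v) (path_ray w)"
  let ?F = "frontier_vertices T A"
  have Ac: "A \<subseteq> carrier G" by (rule almost_invariantD(2)[OF A])
  have F: "finite ?F" "?F \<subseteq> carrier G"
    using finite_frontier_vertices[OF finite_T generating_T A] by (auto simp: frontier_vertices_def)
  let ?K = "\<Union>k\<in>?F. star k"
  obtain C N where C: "C \<in> path_components_of (subtopology graph (topspace graph - ?K))"
    "path_ray v ` {real (N::nat)..} \<subseteq> C" "path_ray w ` {real N..} \<subseteq> C"
    using same compact_stars[OF F] unfolding same_end_def by blast
  have "path_connectedin (subtopology graph (topspace graph - ?K)) C"
    using C(1) by (rule path_connectedin_path_components_of)
  then have con: "connectedin graph C" and CK: "C \<subseteq> graph_points - ?K"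
    by (auto simp: path_connectedin_subtopology path_connectedin_imp_connectedin topspace_graph)
  define U where "U B = (\<Union>k\<in>B. {z \<in> graph_points. 0 < z k})" for B
  have op: "openin graph (U B)" if "B \<subseteq> carrier G" for B
    unfolding U_def using that open_positive by (intro openin_Union) auto
  have "C \<subseteq> U A \<union> U (carrier G - A)"
  proof
    fix z assume "z \<in> C"
    then have z: "z \<in> graph_points" using CK by blast
    obtain k where "k \<in> carrier G" "0 < z k" by (rule graph_point_positive[OF z])
    then show "z \<in> U A \<union> U (carrier G - A)" using z unfolding U_def by blast
  qed
  moreover have "U A \<inter> U (carrier G - A) \<inter> C = {}"
  proof (rule ccontr)
    assume "U A \<inter> U (carrier G - A) \<inter> C \<noteq> {}"
    then obtain z k l where z: "z \<in> C" "z \<in> graph_points" and k: "k \<in> A" "0 < z k" and l: "l \<in> carrier G - A" "0 < z l"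
      unfolding U_def by blast
    have kc: "k \<in> carrier G" using k(1) Ac by blast
    have zs: "z \<in> star k" using graph_point_in_star[OF z(2) kc] k(2) by simp
    then obtain t where t: "t \<in> insert \<one> letters" "z \<in> cayley_edge G k (k \<otimes> t)" unfolding star_def by blast
    have "l = k \<or> l = k \<otimes> t" using cayley_edge_support[OF t(2), of l] l by auto
    then have "l = k \<otimes> t" using k(1) l(1) by blast
    moreover from this have "t \<in> letters" using t(1) kc k(1) l(1) by auto
    ultimately have "k \<in> ?F" using kc k(1) l(1) unfolding frontier_vertices_def by blast
    then show False using zs z(1) CK by blast
  qed
  moreover have "U A \<inter> C \<noteq> {}"
  proof -
    have "path_ray v (real N) \<in> C" using C(2) by (auto simp: image_subset_iff)
    moreover have "0 < path_ray v (real N) (v N)"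
      using v(2)[of N] Ac by (auto simp: path_ray_vertex[OF v(1)] cayley_vertex_def)
    ultimately show ?thesis using CK v(2)[of N] unfolding U_def by blast
  qed
  moreover have "U (carrier G - A) \<inter> C \<noteq> {}"
  proof -
    have "path_ray w (real N) \<in> C" using C(3) by (auto simp: image_subset_iff)
    moreover have "0 < path_ray w (real N) (w N)"
      using w(2)[of N] by (auto simp: path_ray_vertex[OF w(1)] cayley_vertex_def)
    ultimately show ?thesis using CK w(2)[of N] unfolding U_def by blast
  qed
  ultimately show False
    using con op[OF Ac] op[of "carrier G - A"] unfolding connectedin by blast
qed

lemma equiv_same_end:
  "equiv {r. proper_ray graph r} {(r1, r2). proper_ray graph r1 \<and> proper_ray graph r2 \<and> same_end graph r1 r2}"
proof (rule equivI)
  show "refl_on {r. proper_ray graph r} {(r1, r2). proper_ray graph r1 \<and> proper_ray graph r2 \<and> same_end graph r1 r2}"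
    unfolding refl_on_def same_end_iff using tail_component_exists by blast
  show "sym {(r1, r2). proper_ray graph r1 \<and> proper_ray graph r2 \<and> same_end graph r1 r2}"
    unfolding sym_def same_end_iff by blast
  show "trans {(r1, r2). proper_ray graph r1 \<and> proper_ray graph r2 \<and> same_end graph r1 r2}"
  proof (rule transI)
    fix a b c :: "real \<Rightarrow> 'a \<Rightarrow> real"
    assume "(a, b) \<in> {(r1, r2). proper_ray graph r1 \<and> proper_ray graph r2 \<and> same_end graph r1 r2}"
      "(b, c) \<in> {(r1, r2). proper_ray graph r1 \<and> proper_ray graph r2 \<and> same_end graph r1 r2}"
    then have abc: "proper_ray graph a" "proper_ray graph c" "same_end graph a b" "same_end graph b c" by auto
    have "same_end graph a c"
      unfolding same_end_iff
    proof (intro allI impI)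
      fix K assume K: "compactin graph K"
      obtain C where C: "tail_component K a C" "tail_component K b C" using abc(3) K unfolding same_end_iff by blast
      obtain D where D: "tail_component K b D" "tail_component K c D" using abc(4) K unfolding same_end_iff by blast
      have "C = D" by (rule tail_component_unique[OF C(2) D(1)])
      then show "\<exists>C. tail_component K a C \<and> tail_component K c C" using C D by blast
    qed
    then show "(a, c) \<in> {(r1, r2). proper_ray graph r1 \<and> proper_ray graph r2 \<and> same_end graph r1 r2}"
      using abc by blast
  qed
qed auto

lemma not_same_end_witness:
  assumes "\<not> same_end graph a b"
  obtains K where "compactin graph K"
    "\<And>L C D. compactin graph L \<Longrightarrow> K \<subseteq> L \<Longrightarrow> tail_component L a C \<Longrightarrow> tail_component L b D \<Longrightarrow> C \<noteq> D"
proof -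
  obtain K where K: "compactin graph K" "\<not> (\<exists>C. tail_component K a C \<and> tail_component K b C)"
    using assms unfolding same_end_iff by blast
  have "C \<noteq> D" if L: "K \<subseteq> L" "tail_component L a C" "tail_component L b D" for L C D
  proof
    assume CD: "C = D"
    obtain C' where C': "C \<subseteq> C'" "tail_component K a C'" by (rule tail_component_mono[OF L(2,1)])
    obtain M where "b ` {real (M::nat)..} \<subseteq> C" using L(3) CD unfolding tail_component_def by blast
    then have "tail_component K b C'" using C' unfolding tail_component_def by blast
    then show False using K(2) C'(2) by blast
  qed
  then show ?thesis using that[OF K(1)] by blast
qed

text \<open>So the ends of the graph are counted by the disjoint infinite almost invariant sets.\<close>

theorem two_ends_iff:
  "card (ends graph) = 2 \<longleftrightarrow>
     (\<exists>A. almost_invariant G A \<and> infinite A \<and> infinite (carrier G - A)) \<and> \<not> three_pieces G"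
proof -
  let ?R = "{(r1, r2). proper_ray graph r1 \<and> proper_ray graph r2 \<and> same_end graph r1 r2}"
  have ray: "\<exists>v. inj v \<and> (\<forall>n. v n \<in> A) \<and> proper_ray graph (path_ray v)"
    if A: "almost_invariant G A" "infinite A" for A
  proof -
    obtain v where v: "inj v" "\<And>n. v n \<in> A" "\<And>n. \<exists>t\<in>letters. v (Suc n) = v n \<otimes> t"
      by (rule almost_invariant_path[OF A]) blast
    have "v n \<in> carrier G" for n using v(2)[of n] almost_invariantD(2)[OF A(1)] by blast
    then have "proper_ray graph (path_ray v)" by (rule proper_path_ray[OF v(1) _ v(3)])
    then show ?thesis using v by blast
  qed
  have two: "(\<exists>a b. proper_ray graph a \<and> proper_ray graph b \<and> \<not> same_end graph a b) \<longleftrightarrow>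
      (\<exists>A. almost_invariant G A \<and> infinite A \<and> infinite (carrier G - A))"
  proof
    assume "\<exists>a b. proper_ray graph a \<and> proper_ray graph b \<and> \<not> same_end graph a b"
    then obtain a b where ab: "proper_ray graph a" "proper_ray graph b" "\<not> same_end graph a b" by blast
    obtain K where K: "compactin graph K"
      "\<And>L C D. compactin graph L \<Longrightarrow> K \<subseteq> L \<Longrightarrow> tail_component L a C \<Longrightarrow> tail_component L b D \<Longrightarrow> C \<noteq> D"
      by (rule not_same_end_witness[OF ab(3)]) blast
    obtain C where C: "tail_component K a C" by (rule tail_component_exists[OF ab(1) K(1)])
    obtain D where D: "tail_component K b D" by (rule tail_component_exists[OF ab(2) K(1)])
    have "component_vertices C \<inter> component_vertices D = {}"
      using component_vertices_disjoint[OF C D] K(2)[OF K(1) _ C D] by blast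
    then have "component_vertices D \<subseteq> carrier G - component_vertices C" by (auto simp: component_vertices_def)
    then have "infinite (carrier G - component_vertices C)"
      using tail_component_vertices(2)[OF ab(2) K(1) D] by (meson finite_subset)
    then show "\<exists>A. almost_invariant G A \<and> infinite A \<and> infinite (carrier G - A)"
      using tail_component_vertices[OF ab(1) K(1) C] by blast
  next
    assume "\<exists>A. almost_invariant G A \<and> infinite A \<and> infinite (carrier G - A)"
    then obtain A where A: "almost_invariant G A" "infinite A" "infinite (carrier G - A)" by blast
    obtain v where v: "inj v" "\<And>n. v n \<in> A" "proper_ray graph (path_ray v)" using ray[OF A(1,2)] by blast
    obtain w where w: "inj w" "\<And>n. w n \<in> carrier G - A" "proper_ray graph (path_ray w)"
      using ray[OF almost_invariant_compl[OF A(1)] A(3)] by blast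
    show "\<exists>a b. proper_ray graph a \<and> proper_ray graph b \<and> \<not> same_end graph a b"
      using disjoint_pieces_not_same_end[OF A(1) v(1,2) w(1,2)] v(3) w(3) by blast
  qed
  have three: "(\<exists>a b c. proper_ray graph a \<and> proper_ray graph b \<and> proper_ray graph c \<and>
      \<not> same_end graph a b \<and> \<not> same_end graph a c \<and> \<not> same_end graph b c) \<longleftrightarrow> three_pieces G"
  proof
    assume "\<exists>a b c. proper_ray graph a \<and> proper_ray graph b \<and> proper_ray graph c \<and>
      \<not> same_end graph a b \<and> \<not> same_end graph a c \<and> \<not> same_end graph b c"
    then obtain a b c where r: "proper_ray graph a" "proper_ray graph b" "proper_ray graph c"
      and n: "\<not> same_end graph a b" "\<not> same_end graph a c" "\<not> same_end graph b c" by blast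
    obtain K1 where K1: "compactin graph K1"
      "\<And>L C D. compactin graph L \<Longrightarrow> K1 \<subseteq> L \<Longrightarrow> tail_component L a C \<Longrightarrow> tail_component L b D \<Longrightarrow> C \<noteq> D"
      by (rule not_same_end_witness[OF n(1)]) blast
    obtain K2 where K2: "compactin graph K2"
      "\<And>L C D. compactin graph L \<Longrightarrow> K2 \<subseteq> L \<Longrightarrow> tail_component L a C \<Longrightarrow> tail_component L c D \<Longrightarrow> C \<noteq> D"
      by (rule not_same_end_witness[OF n(2)]) blast
    obtain K3 where K3: "compactin graph K3"
      "\<And>L C D. compactin graph L \<Longrightarrow> K3 \<subseteq> L \<Longrightarrow> tail_component L b C \<Longrightarrow> tail_component L c D \<Longrightarrow> C \<noteq> D"
      by (rule not_same_end_witness[OF n(3)]) blast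
    define K where "K = K1 \<union> K2 \<union> K3"
    have K: "compactin graph K" unfolding K_def using K1(1) K2(1) K3(1) by (intro compactin_Un)
    have sub: "K1 \<subseteq> K" "K2 \<subseteq> K" "K3 \<subseteq> K" by (auto simp: K_def)
    obtain A where A: "tail_component K a A" by (rule tail_component_exists[OF r(1) K])
    obtain B where B: "tail_component K b B" by (rule tail_component_exists[OF r(2) K])
    obtain C where C: "tail_component K c C" by (rule tail_component_exists[OF r(3) K])
    have "component_vertices A \<inter> component_vertices B = {}"
      by (rule component_vertices_disjoint[OF A B K1(2)[OF K sub(1) A B]])
    moreover have "component_vertices A \<inter> component_vertices C = {}"
      by (rule component_vertices_disjoint[OF A C K2(2)[OF K sub(2) A C]])
    moreover have "component_vertices B \<inter> component_vertices C = {}"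
      by (rule component_vertices_disjoint[OF B C K3(2)[OF K sub(3) B C]])
    ultimately show "three_pieces G"
      unfolding three_pieces_def
      using tail_component_vertices[OF r(1) K A] tail_component_vertices[OF r(2) K B] tail_component_vertices[OF r(3) K C]
      by blast
  next
    assume "three_pieces G"
    then obtain A B C where ABC: "almost_invariant G A" "infinite A" "almost_invariant G B" "infinite B"
      "almost_invariant G C" "infinite C" "A \<inter> B = {}" "A \<inter> C = {}" "B \<inter> C = {}"
      unfolding three_pieces_def by blast
    obtain u where u: "inj u" "\<And>n. u n \<in> A" "proper_ray graph (path_ray u)" using ray[OF ABC(1,2)] by blast
    obtain v where v: "inj v" "\<And>n. v n \<in> B" "proper_ray graph (path_ray v)" using ray[OF ABC(3,4)] by blast
    obtain w where w: "inj w" "\<And>n. w n \<in> C" "proper_ray graph (path_ray w)" using ray[OF ABC(5,6)] by blast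
    have "v n \<in> carrier G - A" "w n \<in> carrier G - A" "w n \<in> carrier G - B" for n
      using v(2)[of n] w(2)[of n] ABC(7-9) almost_invariantD(2)[OF ABC(3)] almost_invariantD(2)[OF ABC(5)] by blast+
    then have "\<not> same_end graph (path_ray u) (path_ray v)" "\<not> same_end graph (path_ray u) (path_ray w)"
      "\<not> same_end graph (path_ray v) (path_ray w)"
      using disjoint_pieces_not_same_end[OF ABC(1) u(1,2) v(1)] disjoint_pieces_not_same_end[OF ABC(1) u(1,2) w(1)]
        disjoint_pieces_not_same_end[OF ABC(3) v(1,2) w(1)] by blast+
    then show "\<exists>a b c. proper_ray graph a \<and> proper_ray graph b \<and> proper_ray graph c \<and>
      \<not> same_end graph a b \<and> \<not> same_end graph a c \<and> \<not> same_end graph b c"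
      using u(3) v(3) w(3) by blast
  qed
  show ?thesis
    unfolding ends_def card_quotient_2_iff[OF equiv_same_end] two[symmetric] three[symmetric] by blast
qed

end

section \<open>Two-ended groups and their coronas\<close>

lemma homeomorphic_continuum:
  assumes "X homeomorphic_space Y"
  shows "continuum X \<longleftrightarrow> continuum Y"
  unfolding continuum_def
  using homeomorphic_empty_space[OF assms] homeomorphic_compact_space[OF assms]
    homeomorphic_connected_space[OF assms] homeomorphic_Hausdorff_space[OF assms]
  by simp

lemma homeomorphic_decomposable:
  assumes XY: "X homeomorphic_space Y" and X: "decomposable X"
  shows "decomposable Y"
proof -
  obtain f where f: "homeomorphic_map X Y f" using XY by (auto simp: homeomorphic_space)
  have fXY: "f ` topspace X = topspace Y" and inj: "inj_on f (topspace X)"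
    using f by (simp_all add: homeomorphic_eq_everything_map)
  obtain A B where AB: "A \<subset> topspace X" "B \<subset> topspace X" "A \<union> B = topspace X"
    "continuum (subtopology X A)" "continuum (subtopology X B)"
    using X unfolding decomposable_def by blast
  have image: "f ` C \<subset> topspace Y \<and> continuum (subtopology Y (f ` C))"
    if C: "C \<subset> topspace X" "continuum (subtopology X C)" for C
  proof
    obtain x where x: "x \<in> topspace X" "x \<notin> C" using C(1) by blast
    have "f x \<notin> f ` C"
    proof
      assume "f x \<in> f ` C"
      then obtain y where "y \<in> C" "f y = f x" by auto
      then show False using inj_onD[OF inj, of y x] x C(1) by blast
    qed
    moreover have "f x \<in> topspace Y" using x(1) fXY by blast
    moreover have "f ` C \<subseteq> topspace Y" using C(1) fXY by blast
    ultimately show "f ` C \<subset> topspace Y" by blast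
    have "f ` (topspace X \<inter> C) = topspace Y \<inter> f ` C"
      using C(1) \<open>f ` C \<subseteq> topspace Y\<close> by (simp add: Int_absorb1 psubset_imp_subset)
    then have "homeomorphic_map (subtopology X C) (subtopology Y (f ` C)) f"
      by (rule homeomorphic_map_subtopologies[OF f])
    then have "subtopology X C homeomorphic_space subtopology Y (f ` C)"
      by (rule homeomorphic_map_imp_homeomorphic_space)
    then show "continuum (subtopology Y (f ` C))" using C(2) homeomorphic_continuum by blast
  qed
  have "f ` A \<union> f ` B = topspace Y" using AB(3) fXY by blast
  then show ?thesis unfolding decomposable_def using image[OF AB(1,4)] image[OF AB(2,5)] by blast
qed

lemma homeomorphic_indecomposable_continuum:
  assumes "X homeomorphic_space Y" "indecomposable_continuum Y"
  shows "indecomposable_continuum X"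
  using assms homeomorphic_continuum[OF assms(1)] homeomorphic_decomposable[OF assms(1)]
  unfolding indecomposable_continuum_def by blast

lemma sum_of_two_continua:
  fixes X :: "bool \<Rightarrow> 'b topology"
  assumes Y: "Y homeomorphic_space sum_topology X UNIV" and X: "\<And>b. continuum (X b)"
  obtains P where "\<And>b. openin Y (P b)" "\<And>b. connectedin Y (P b)" "\<And>b. P b \<noteq> {}"
    "P True \<inter> P False = {}" "P True \<union> P False = topspace Y"
proof -
  have "sum_topology X UNIV homeomorphic_space Y" using Y homeomorphic_space_sym by blast
  then obtain f where f: "homeomorphic_map (sum_topology X UNIV) Y f" by (auto simp: homeomorphic_space)
  define S where "S b = Pair b ` topspace (X b)" for b
  have top: "topspace (sum_topology X UNIV) = S True \<union> S False"
  proof -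
    have "topspace (sum_topology X UNIV) \<subseteq> S True \<union> S False"
    proof
      fix x assume "x \<in> topspace (sum_topology X UNIV)"
      then obtain b y where "x = (b, y)" "y \<in> topspace (X b)" by auto
      then have "x \<in> S b" by (simp add: S_def)
      then show "x \<in> S True \<union> S False" by (cases b) simp_all
    qed
    moreover have "S b \<subseteq> topspace (sum_topology X UNIV)" for b by (auto simp: S_def)
    ultimately show ?thesis by blast
  qed
  have open_S: "openin (sum_topology X UNIV) (S b)" for b
    using open_map_component_injection[of b UNIV X] unfolding open_map_def S_def by blast
  have con_S: "connectedin (sum_topology X UNIV) (S b)" for b
    unfolding S_def
  proof (rule connectedin_continuous_map_image)
    show "continuous_map (X b) (sum_topology X UNIV) (Pair b)"
      using continuous_map_component_injection[of b UNIV X] by simp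
    show "connectedin (X b) (topspace (X b))" using X by (simp add: continuum_def connectedin_topspace)
  qed
  have inj: "inj_on f (S True \<union> S False)" and im: "f ` (S True \<union> S False) = topspace Y"
    and "open_map (sum_topology X UNIV) Y f" and cont: "continuous_map (sum_topology X UNIV) Y f"
    using f unfolding homeomorphic_eq_everything_map top by auto
  show ?thesis
  proof (rule that[of "\<lambda>b. f ` S b"])
    show "openin Y (f ` S b)" for b
      using \<open>open_map (sum_topology X UNIV) Y f\<close> open_S unfolding open_map_def by blast
    show "connectedin Y (f ` S b)" for b by (rule connectedin_continuous_map_image[OF cont con_S])
    show "f ` S b \<noteq> {}" for b using X[of b] by (simp add: S_def continuum_def)
    have "S True \<inter> S False = {}" by (auto simp: S_def)
    then show "f ` S True \<inter> f ` S False = {}"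
      using inj_on_image_Int[OF inj, of "S True" "S False"] by simp
    show "f ` S True \<union> f ` S False = topspace Y" using im by (simp add: image_Un)
  qed
qed

theorem theorem4p5:
  fixes G :: "('a, 'b) monoid_scheme" and S T :: "'a set"
  assumes "group G"
    and "finite S" and "generating_set G S"
    and "finite T" and "generating_set G T"
  shows "card (ends (cayley_graph G T)) = 2 \<longleftrightarrow>
    (\<exists>X :: bool \<Rightarrow> (('a \<Rightarrow> real) \<Rightarrow> real) topology.
       higson_corona (word_metric G S) homeomorphic_space sum_topology X UNIV \<and>
       (\<forall>b. indecomposable_continuum (X b) \<and> \<not> metrizable_space (X b) \<and>
            X b homeomorphic_space higson_corona nat_metric))"
proof -
  interpret group G by (rule assms(1))
  interpret finitely_generated_group G T
    by unfold_locales (rule assms(4), rule assms(5))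
  let ?m = "word_metric G S" and ?Y = "higson_corona (word_metric G S)"
  note S = assms(2,3)
  have fb: "finite_balls ?m" by (rule finite_balls_word_metric[OF S])
  have ms: "mspace ?m = carrier G" by (rule word_metric_simps(1)[OF S(2)])
  have topY: "topspace ?Y = corona_points ?m" by (rule topspace_higson_corona[OF fb])
  show ?thesis
    unfolding two_ends_iff
  proof
    assume "(\<exists>A. almost_invariant G A \<and> infinite A \<and> infinite (carrier G - A)) \<and> \<not> three_pieces G"
    then obtain A where A: "almost_invariant G A" "infinite A" "infinite (carrier G - A)" and no3: "\<not> three_pieces G"
      by blast
    obtain g and height :: "'a \<Rightarrow> int" where g: "g \<in> carrier G"
      "\<And>x. x \<in> carrier G \<Longrightarrow> height (g \<otimes>\<^bsub>G\<^esub> x) = height x + 1"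
      "\<And>n. finite {x \<in> carrier G. height x = n}"
      "A = {x \<in> carrier G. 0 \<le> height x}"
      "\<exists>x\<in>carrier G. height x = 0"
      by (rule two_ended_height[OF assms(4,5) A no3]) blast
    obtain d where d: "d \<in> carrier G" "height d = 0" using g(5) by blast
    have A': "coarsely_clopen ?m A" using coarsely_clopen_word_metric_iff[OF S] A(1) by blast
    let ?U = "corona_part ?m A"
    define X where "X b = subtopology ?Y (if b then ?U else topspace ?Y - ?U)" for b
    have "?Y homeomorphic_space sum_topology (\<lambda>b. subtopology ?Y (if b then ?U else topspace ?Y - ?U)) UNIV"
      by (rule homeomorphic_space_clopen_sum) (simp_all add: topY clopen_corona_part[OF fb A'])
    then have sum: "?Y homeomorphic_space sum_topology X UNIV" unfolding X_def .
    have compl: "topspace ?Y - ?U = corona_part ?m (carrier G - A)"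
      using corona_part_complement[OF fb A'] by (simp add: topY ms)
    have X: "X b homeomorphic_space higson_corona nat_metric" for b
      using height_function_halves[OF S g(1-3) d A(1) g(4)] unfolding X_def compl by (cases b) simp_all
    have "indecomposable_continuum (X b)" for b
      by (rule homeomorphic_indecomposable_continuum[OF X indecomposable_nat_corona])
    moreover have "\<not> metrizable_space (X b)" for b
      using homeomorphic_metrizable_space[OF X[of b]] not_metrizable_nat_corona by blast
    ultimately show "\<exists>X :: bool \<Rightarrow> (('a \<Rightarrow> real) \<Rightarrow> real) topology. ?Y homeomorphic_space sum_topology X UNIV \<and>
       (\<forall>b. indecomposable_continuum (X b) \<and> \<not> metrizable_space (X b) \<and>
            X b homeomorphic_space higson_corona nat_metric)"
      using sum X by blast
  next
    assume "\<exists>X :: bool \<Rightarrow> (('a \<Rightarrow> real) \<Rightarrow> real) topology. ?Y homeomorphic_space sum_topology X UNIV \<and>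
       (\<forall>b. indecomposable_continuum (X b) \<and> \<not> metrizable_space (X b) \<and>
            X b homeomorphic_space higson_corona nat_metric)"
    then obtain X :: "bool \<Rightarrow> (('a \<Rightarrow> real) \<Rightarrow> real) topology"
      where X: "?Y homeomorphic_space sum_topology X UNIV" "\<And>b. continuum (X b)"
      unfolding indecomposable_continuum_def by blast
    obtain P where P: "\<And>b. openin ?Y (P b)" "\<And>b. connectedin ?Y (P b)" "\<And>b. P b \<noteq> {}"
      "P True \<inter> P False = {}" "P True \<union> P False = topspace ?Y"
      by (rule sum_of_two_continua[OF X]) blast
    have PF: "P False = corona_points ?m - P True" using P(4,5) topY by blast
    have "\<exists>A. almost_invariant G A \<and> infinite A \<and> infinite (carrier G - A)"
    proof -
      obtain A where A: "coarsely_clopen ?m A" "P True = corona_part ?m A"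
        by (rule clopen_subset_corona[OF fb P(1)[of True] P(1)[of False, unfolded PF]]) blast
      have "P False = corona_part ?m (carrier G - A)"
        using corona_part_complement[OF fb A(1)] unfolding PF A(2) ms by simp
      moreover have "coarsely_clopen ?m (carrier G - A)" using coarsely_clopen_complement[OF fb A(1)] by (simp add: ms)
      ultimately have "infinite (carrier G - A)" using corona_part_nonempty_iff[OF fb] P(3)[of False] by metis
      moreover have "infinite A" using corona_part_nonempty_iff[OF fb A(1)] P(3)[of True] A(2) by simp
      ultimately show ?thesis using A(1) coarsely_clopen_word_metric_iff[OF S] by blast
    qed
    moreover have "\<not> three_pieces G"
    proof
      assume "three_pieces G"
      then obtain A B C where ABC: "almost_invariant G A" "almost_invariant G B" "almost_invariant G C"
        "infinite A" "infinite B" "infinite C" "A \<inter> B = {}" "A \<inter> C = {}" "B \<inter> C = {}"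
        unfolding three_pieces_def by blast
      have cc: "coarsely_clopen ?m A" "coarsely_clopen ?m B" "coarsely_clopen ?m C"
        using ABC(1-3) coarsely_clopen_word_metric_iff[OF S] by blast+
      have contains: "\<exists>b. P b \<subseteq> corona_part ?m D" if D: "coarsely_clopen ?m D" "infinite D" for D
      proof -
        have sub: "corona_part ?m D \<subseteq> topspace ?Y" unfolding topY corona_part_def by blast
        have op: "openin ?Y (corona_part ?m D)" by (rule clopen_corona_part(1)[OF fb D(1)])
        have cl: "closedin ?Y (corona_part ?m D)"
          unfolding closedin_def using sub clopen_corona_part(2)[OF fb D(1)] by (simp add: topY)
        have "corona_part ?m D \<noteq> {}" using corona_part_nonempty_iff[OF fb D(1)] D(2) by simp
        then obtain b where "P b \<inter> corona_part ?m D \<noteq> {}" using sub P(5) by blast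
        then show ?thesis using connectedin_clopen_cases[OF P(2)[of b] cl op] by (auto simp: disjnt_def)
      qed
      obtain a where a: "P a \<subseteq> corona_part ?m A" using contains[OF cc(1) ABC(4)] by blast
      obtain b where b: "P b \<subseteq> corona_part ?m B" using contains[OF cc(2) ABC(5)] by blast
      obtain c where c: "P c \<subseteq> corona_part ?m C" using contains[OF cc(3) ABC(6)] by blast
      have "a \<noteq> b" using corona_part_disjoint[OF fb cc(1,2) ABC(7)] a b P(3)[of a] by blast
      moreover have "a \<noteq> c" using corona_part_disjoint[OF fb cc(1,3) ABC(8)] a c P(3)[of a] by blast
      moreover have "b \<noteq> c" using corona_part_disjoint[OF fb cc(2,3) ABC(9)] b c P(3)[of b] by blast
      ultimately show False by blast
    qed
    ultimately show "(\<exists>A. almost_invariant G A \<and> infinite A \<and> infinite (carrier G - A)) \<and> \<not> three_pieces G"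
      by blast
  qed
qed

end
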